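(* For $\mathfrak g=A_2$, let $\lambda\in\mathfrak h^*_{\mathbb R}$ lie on exactly one vanishing line $P(n_0,\alpha_0)$. Then for all sufficiently small $\epsilon>0$, $$\sigma(\lambda)=\frac{\tilde f(a(\lambda+\epsilon\alpha_0))+\tilde f(a(\lambda-\epsilon\alpha_0))}{2(1-x_1^2)(1-x_2^2)(1-x_1^2x_2^2)},$$ i.e. $\sigma(\lambda)$ is $\tfrac12$ times the sum of $\tilde f$ over the two regions adjacent to $\lambda$, divided by $(1-x_1^2)(1-x_2^2)(1-x_1^2x_2^2)$.
   Context: $\mathfrak g=A_2$ with simple roots $\alpha_1,\alpha_2$, $(\alpha_1,\alpha_1)=(\alpha_2,\alpha_2)=2$, $(\alpha_1,\alpha_2)=-1$, $\alpha_3=\alpha_1+\alpha_2$, $\Delta_+=\{\alpha_1,\alpha_2,\alpha_3\}$, $\rho=\alpha_3$; $\mathfrak h^*_{\mathbb R}$ is the real span of $\alpha_1,\alpha_2$. Vanishing lines: $P(n,\alpha)=\{\lambda:(\alpha,\lambda+\rho)=n\}$, $n\in\mathbb Z_{\ge1}$, $\alpha\in\Delta_+$. For $\lambda\in\mathfrak h^*_{\mathbb R}$, $V(\lambda)$ is the Verma module with highest weight vector $|\lambda\rangle$; the Shapovalov form is the unique bilinear form with $\langle\lambda|\lambda\rangle=1$, $\langle x\lambda,y\lambda\rangle=\langle\lambda,x^\dagger y\lambda\rangle$, $\dagger$ the anti-automorphism with $H_i^\dagger=H_i$, $E_{\pm\alpha_i}^\dagger=E_{\mp\alpha_i}$. $M_{(m_1,m_2)}(\lambda)$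 is its real symmetric Gram matrix on the weight space of weight $\lambda-m_1\alpha_1-m_2\alpha_2$, and $\sigma(\lambda)=\sum_{m_1,m_2\ge0}{\rm sig}(M_{(m_1,m_2)}(\lambda))x_1^{m_1}x_2^{m_2}$. For $\mu\in\mathfrak h^*_{\mathbb R}$, $a(\mu)=(a_1,a_2,a_3)$ with $a_i=\max(0,\lfloor(\alpha_i,\mu+\rho)\rfloor)$, and $\tilde f(a_1,a_2,a_3)=(1+x_1)(1+x_2)(1+x_1x_2)-2x_1^{a_1+1}(1+x_2)(1+x_1x_2)-2x_2^{a_2+1}(1+x_1)(1+x_1x_2)-2(x_1x_2)^{a_3+1}(1+x_1)(1+x_2)+4x_1^{a_1+1}(x_1x_2)^{\min(a_2,a_3)+1}(1+x_2)+4x_2^{a_2+1}(x_1x_2)^{\min(a_1,a_3)+1}(1+x_1)+4x_1^{\max(a_1,a_3)+1}x_2^{\max(a_2,a_3)+1}(1+x_1x_2)-8x_1^{\min(a_2,a_3)+a_1+2}x_2^{\min(a_1,a_3)+a_2+2}$. *)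

theory Defs
  imports "Jordan_Normal_Form.Char_Poly"
begin

section \<open>Weights of A2: lambda = l1 alpha1 + l2 alpha2 is encoded as (l1, l2)\<close>

type_synonym wt = "real \<times> real"

definition wadd :: "wt \<Rightarrow> wt \<Rightarrow> wt" where
  "wadd x y = (fst x + fst y, snd x + snd y)"

definition wsub :: "wt \<Rightarrow> wt \<Rightarrow> wt" where
  "wsub x y = (fst x - fst y, snd x - snd y)"

definition wscale :: "real \<Rightarrow> wt \<Rightarrow> wt" where
  "wscale c x = (c * fst x, c * snd x)"

text \<open>Invariant form: (a1,a1) = (a2,a2) = 2, (a1,a2) = -1.\<close>
definition ip :: "wt \<Rightarrow> wt \<Rightarrow> real" where
  "ip x y = 2 * fst x * fst y + 2 * snd x * snd y - fst x * snd y - snd x * fst y"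

definition pos_root :: "nat \<Rightarrow> wt" where
  "pos_root k = (if k = 1 then (1, 0) else if k = 2 then (0, 1) else (1, 1))"

definition rho :: wt where "rho = (1, 1)"

definition vanishing_line :: "nat \<Rightarrow> nat \<Rightarrow> wt set" where
  "vanishing_line n k = {l. ip (pos_root k) (wadd l rho) = real n}"

text \<open>A word [i1,...,ik] (entries 1 or 2) stands for the vector
  E_{-alpha_i1} ... E_{-alpha_ik} |lambda>; its weight is lambda - word_wt.\<close>
definition word_wt :: "nat list \<Rightarrow> wt" where
  "word_wt v = (real (count_list v 1), real (count_list v 2))"

text \<open>Action of E_{alpha_i} on a word vector, as a linear combination of words:
  E_i F_j F_v|l> = delta_ij (alpha_i, l - wt v) F_v|l> + F_j E_i F_v|l>,
  using [E_i,F_j] = delta_ij H_i, H_i acting on weight mu by (alpha_i, mu), E_i|l> = 0.\<close>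
fun Eact :: "wt \<Rightarrow> nat \<Rightarrow> nat list \<Rightarrow> (real \<times> nat list) list" where
  "Eact l i [] = []"
| "Eact l i (j # v) =
     (if i = j then [(ip (pos_root i) (wsub l (word_wt v)), v)] else [])
     @ map (\<lambda>(c, u). (c, j # u)) (Eact l i v)"

text \<open>Shapovalov form on word vectors: <l|l> = 1, <F_i u, v> = <u, E_i v>
  (since F_i^dagger = E_i), and <l, F_v l> = 0 for nonempty v (weight reasons).\<close>
fun shap_word :: "wt \<Rightarrow> nat list \<Rightarrow> nat list \<Rightarrow> real" where
  "shap_word l [] v = (if v = [] then 1 else 0)"
| "shap_word l (i # w) v = (\<Sum>(c, u) \<leftarrow> Eact l i v. c * shap_word l w u)"

type_synonym lcomb = "(real \<times> nat list) list"

definition shap :: "wt \<Rightarrow> lcomb \<Rightarrow> lcomb \<Rightarrow> real" where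
  "shap l x y = (\<Sum>(c, u) \<leftarrow> x. \<Sum>(d, v) \<leftarrow> y. c * d * shap_word l u v)"

definition lc_mult :: "lcomb \<Rightarrow> lcomb \<Rightarrow> lcomb" where
  "lc_mult x y = [(fst p * fst q, snd p @ snd q). p \<leftarrow> x, q \<leftarrow> y]"

definition lc_pow :: "lcomb \<Rightarrow> nat \<Rightarrow> lcomb" where
  "lc_pow x n = ((lc_mult x) ^^ n) [(1, [])]"

definition F1 :: lcomb where "F1 = [(1, [1])]"
definition F2 :: lcomb where "F2 = [(1, [2])]"
definition F3 :: lcomb where
  "F3 = lc_mult F1 F2 @ map (\<lambda>(c, u). (- c, u)) (lc_mult F2 F1)"

definition pbw :: "nat \<Rightarrow> nat \<Rightarrow> nat \<Rightarrow> lcomb" where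
  "pbw a b c = lc_mult (lc_pow F1 a) (lc_mult (lc_pow F3 b) (lc_pow F2 c))"

text \<open>Gram matrix M_(m1,m2)(lambda) on the weight space of weight lambda - m1 a1 - m2 a2,
  w.r.t. the PBW basis F1^(m1-b) F3^b F2^(m2-b) |lambda>, b = 0..min m1 m2.\<close>
definition gram :: "wt \<Rightarrow> nat \<Rightarrow> nat \<Rightarrow> real mat" where
  "gram l m1 m2 = mat (min m1 m2 + 1) (min m1 m2 + 1)
     (\<lambda>(i, j). shap l (pbw (m1 - i) i (m2 - i)) (pbw (m1 - j) j (m2 - j)))"

definition sig :: "real mat \<Rightarrow> int" where
  "sig A = (\<Sum>r \<in> {r. poly (char_poly A) r = 0 \<and> r > 0}. int (order r (char_poly A)))
         - (\<Sum>r \<in> {r. poly (char_poly A) r = 0 \<and> r < 0}. int (order r (char_poly A)))"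

section \<open>Formal power series in x1, x2 with integer coefficients\<close>

type_synonym bps = "nat \<Rightarrow> nat \<Rightarrow> int"

definition bmon :: "int \<Rightarrow> nat \<Rightarrow> nat \<Rightarrow> bps" where
  "bmon c i j = (\<lambda>m n. if m = i \<and> n = j then c else 0)"

definition badd :: "bps \<Rightarrow> bps \<Rightarrow> bps" where
  "badd f g = (\<lambda>m n. f m n + g m n)"

definition bmul :: "bps \<Rightarrow> bps \<Rightarrow> bps" where
  "bmul f g = (\<lambda>m n. \<Sum>i\<le>m. \<Sum>j\<le>n. f i j * g (m - i) (n - j))"

definition bsum :: "bps list \<Rightarrow> bps" where
  "bsum fs = foldr badd fs (\<lambda>m n. 0)"

definition bprod :: "bps list \<Rightarrow> bps" where
  "bprod fs = foldr bmul fs (bmon 1 0 0)"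

definition sigma :: "wt \<Rightarrow> bps" where
  "sigma l = (\<lambda>m1 m2. sig (gram l m1 m2))"

definition a_of :: "wt \<Rightarrow> nat \<Rightarrow> nat" where
  "a_of mu k = nat \<lfloor>ip (pos_root k) (wadd mu rho)\<rfloor>"

definition tilde_f :: "nat \<Rightarrow> nat \<Rightarrow> nat \<Rightarrow> bps" where
  "tilde_f a1 a2 a3 =
    (let one_x1 = badd (bmon 1 0 0) (bmon 1 1 0);
         one_x2 = badd (bmon 1 0 0) (bmon 1 0 1);
         one_x12 = badd (bmon 1 0 0) (bmon 1 1 1)
     in bsum
      [ bprod [one_x1, one_x2, one_x12],
        bprod [bmon (-2) (a1 + 1) 0, one_x2, one_x12],
        bprod [bmon (-2) 0 (a2 + 1), one_x1, one_x12],
        bprod [bmon (-2) (a3 + 1) (a3 + 1), one_x1, one_x2],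
        bprod [bmon 4 (a1 + 1 + (min a2 a3 + 1)) (min a2 a3 + 1), one_x2],
        bprod [bmon 4 (min a1 a3 + 1) (a2 + 1 + (min a1 a3 + 1)), one_x1],
        bprod [bmon 4 (max a1 a3 + 1) (max a2 a3 + 1), one_x12],
        bmon (-8) (min a2 a3 + a1 + 2) (min a1 a3 + a2 + 2) ])"

definition tilde_f_at :: "wt \<Rightarrow> bps" where
  "tilde_f_at mu = tilde_f (a_of mu 1) (a_of mu 2) (a_of mu 3)"

definition denom :: bps where
  "denom = bprod [bmon 2 0 0, badd (bmon 1 0 0) (bmon (-1) 2 0),
                  badd (bmon 1 0 0) (bmon (-1) 0 2), badd (bmon 1 0 0) (bmon (-1) 2 2)]"

end

theory Submission
  imports Defs "HOL-Library.Function_Algebras" "HOL-Computational_Algebra.Formal_Power_Series"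
begin

text \<open>
  Write \<open>c\<^sub>k = (\<alpha>\<^sub>k, \<lambda> + \<rho>)\<close>, so \<open>c\<^sub>3 = c\<^sub>1 + c\<^sub>2\<close>.  The Verma module is realised by explicit operators on the
  PBW basis, and each weight space gets an orthogonal basis obtained by restricting the module to an
  \<open>sl\<^sub>2\<close>: the highest weight vectors for the \<open>sl\<^sub>2\<close> of \<open>\<alpha>\<^sub>3\<close> (which exist as long as \<open>c\<^sub>3\<close> is not a positive
  integer) or for the \<open>sl\<^sub>2\<close> of \<open>\<alpha>\<^sub>1\<close> (as long as \<open>c\<^sub>1\<close> is not an integer), together with their images under
  powers of the lowering operator.  The norms are products of linear factors \<open>c\<^sub>k - n\<close>, so by Sylvester's
  law of inertia the signature is a sum of products of the signs of \<open>c\<^sub>k - n\<close>.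

  On a wall \<open>c\<^sub>k = n\<^sub>0\<close> each of these products contains the falling product of the signs of
  \<open>c\<^sub>k - 1, c\<^sub>k - 2, \<dots>\<close> exactly once, and \<open>sgn 0 = 0\<close> makes that product the average of its values on the two
  sides.  The basis for \<open>\<alpha>\<^sub>3\<close> serves
  the walls of \<open>\<alpha>\<^sub>1\<close> and \<open>\<alpha>\<^sub>2\<close>, the one for \<open>\<alpha>\<^sub>1\<close> serves the walls of \<open>\<alpha>\<^sub>3\<close>: on
  exactly one vanishing line the required nonintegrality is automatic.  Off the walls, the basis for \<open>\<alpha>\<^sub>3\<close>
  expresses the signatures through the three floors alone, and dividing the claimed rational function by
  \<open>(1 - x\<^sub>1\<^sup>2)(1 - x\<^sub>2\<^sup>2)\<close> gives a series that is constant up to alternating signs on a few rectangular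
  blocks; it agrees with \<open>sig(m, n) - sig(m - 2, n - 2)\<close> block by block.
\<close>

section \<open>Inertia of real symmetric matrices\<close>

text \<open>A complex eigenvector z = x + iy for a + ib gives A x = a x - b y and A y = b x + a y.
  Symmetry equates y . A x with A y . x, hence b (x . x + y . y) = 0, so b = 0 and whichever of x, y
  is nonzero is a real eigenvector.\<close>

lemma symmetric_eigenvector_exists:
  fixes A :: "real mat"
  assumes A: "A \<in> carrier_mat n n" and sym: "A\<^sup>T = A" and n: "0 < n"
  shows "\<exists>v k. v \<in> carrier_vec n \<and> v \<noteq> 0\<^sub>v n \<and> A *\<^sub>v v = k \<cdot>\<^sub>v v"
proof -
  define C where "C = map_mat complex_of_real A"
  have C: "C \<in> carrier_mat n n" using A by (simp add: C_def)
  obtain as where as: "char_poly C = (\<Prod>a\<leftarrow>as. [:- a, 1:])" "length as = n"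
    using char_poly_factorized[OF C] by blast
  have "poly (char_poly C) (hd as) = 0"
    using as n by (cases as) auto
  then obtain z where z: "z \<in> carrier_vec n" "z \<noteq> 0\<^sub>v n" "C *\<^sub>v z = hd as \<cdot>\<^sub>v z"
    using eigenvalue_root_char_poly[OF C] C unfolding eigenvalue_def eigenvector_def by auto
  define x y where "x = map_vec Re z" and "y = map_vec Im z"
  have xy: "x \<in> carrier_vec n" "y \<in> carrier_vec n" using z by (auto simp: x_def y_def)
  obtain a b where ab: "hd as = Complex a b" by (cases "hd as") auto
  have comp: "(\<Sum>j<n. complex_of_real (A $$ (i, j)) * z $ j) = Complex a b * z $ i" if "i < n" for i
  proof -
    have "(C *\<^sub>v z) $ i = (hd as \<cdot>\<^sub>v z) $ i" using z by simp
    thus ?thesis using that z A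
      by (simp add: C_def ab scalar_prod_def lessThan_atLeast0 row_def)
  qed
  have Ax: "A *\<^sub>v x = a \<cdot>\<^sub>v x - b \<cdot>\<^sub>v y"
  proof (rule eq_vecI)
    fix i assume "i < dim_vec (a \<cdot>\<^sub>v x - b \<cdot>\<^sub>v y)"
    hence i: "i < n" using xy by simp
    show "(A *\<^sub>v x) $ i = (a \<cdot>\<^sub>v x - b \<cdot>\<^sub>v y) $ i"
      using arg_cong[OF comp[OF i], of Re] i z A
      by (simp add: scalar_prod_def lessThan_atLeast0 x_def y_def row_def)
  qed (use A xy in auto)
  have Ay: "A *\<^sub>v y = b \<cdot>\<^sub>v x + a \<cdot>\<^sub>v y"
  proof (rule eq_vecI)
    fix i assume "i < dim_vec (b \<cdot>\<^sub>v x + a \<cdot>\<^sub>v y)"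
    hence i: "i < n" using xy by simp
    show "(A *\<^sub>v y) $ i = (b \<cdot>\<^sub>v x + a \<cdot>\<^sub>v y) $ i"
      using arg_cong[OF comp[OF i], of Im] i z A
      by (simp add: scalar_prod_def lessThan_atLeast0 x_def y_def row_def)
  qed (use A xy in auto)
  have "y \<bullet> (A *\<^sub>v x) = (A *\<^sub>v y) \<bullet> x"
    using transpose_vec_mult_scalar[OF A xy] sym by simp
  hence "b * (x \<bullet> x + y \<bullet> y) = 0"
    using xy by (simp add: Ax Ay scalar_prod_minus_distrib[of _ n] add_scalar_prod_distrib[of _ n]
        comm_scalar_prod[of y n x] algebra_simps)
  moreover have "x \<noteq> 0\<^sub>v n \<or> y \<noteq> 0\<^sub>v n"
  proof (rule ccontr)
    assume "\<not> ?thesis"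
    hence "x $ i = 0 \<and> y $ i = 0" if "i < n" for i using that by simp
    hence "z $ i = 0" if "i < n" for i
      using that z by (simp add: x_def y_def complex_eq_iff)
    hence "z = 0\<^sub>v n" using z by (intro eq_vecI) auto
    thus False using z by simp
  qed
  moreover from this have "x \<bullet> x + y \<bullet> y \<noteq> 0"
    using conjugate_square_eq_0_vec[OF xy(1)] conjugate_square_eq_0_vec[OF xy(2)]
      conjugate_square_ge_0_vec[of x] conjugate_square_ge_0_vec[of y]
    by (auto simp: add_nonneg_eq_0_iff)
  ultimately have b: "b = 0" by simp
  have "A *\<^sub>v x = a \<cdot>\<^sub>v x" "A *\<^sub>v y = a \<cdot>\<^sub>v y"
    using xy by (auto simp: Ax Ay b intro!: eq_vecI)
  thus ?thesis using xy \<open>x \<noteq> 0\<^sub>v n \<or> y \<noteq> 0\<^sub>v n\<close> by blast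
qed

text \<open>The Householder reflection along v - e_0 swaps the unit vectors v and e_0; for v = e_0
  the identity serves.\<close>

lemma symmetric_involution_with_first_column:
  fixes v :: "real vec"
  assumes v: "v \<in> carrier_vec n" and n: "0 < n" and unit: "v \<bullet> v = 1"
  shows "\<exists>H \<in> carrier_mat n n. H * H = 1\<^sub>m n \<and> H\<^sup>T = H \<and> col H 0 = v"
proof (cases "v = unit_vec n 0")
  case True
  thus ?thesis using n by (intro bexI[of _ "1\<^sub>m n"]) auto
next
  case False
  define w where "w i = v $ i - (if i = 0 then 1 else 0)" for i
  have vv: "(\<Sum>i<n. v $ i * v $ i) = 1" using unit v by (simp add: scalar_prod_def lessThan_atLeast0)
  have "(\<Sum>i<n. w i * w i) = (\<Sum>i<n. v $ i * v $ i) - 2 * v $ 0 + 1"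
    unfolding w_def using n
    by (simp add: algebra_simps sum.distrib sum_subtractf if_distrib[where f="\<lambda>x. _ * x"]
        if_distrib[where f="\<lambda>x. x * _"] sum.delta cong: if_cong)
  hence ww: "(\<Sum>i<n. w i * w i) = 2 - 2 * v $ 0" using vv by simp
  have "v $ 0 \<noteq> 1"
  proof
    assume "v $ 0 = 1"
    hence "(\<Sum>i<n. w i * w i) = 0" using ww by simp
    hence "w i = 0" if "i < n" for i using that by (simp add: sum_nonneg_eq_0_iff)
    hence "v = unit_vec n 0" using v n by (intro eq_vecI) (auto simp: w_def split: if_splits)
    thus False using False by simp
  qed
  \<comment> \<open>This is 2 / (w . w), the constant that makes I - c w w^T the reflection along
    w.\<close>
  define c where "c = 2 / (2 - 2 * v $ 0)"
  have cw: "c * (2 - 2 * v $ 0) = 2" using \<open>v $ 0 \<noteq> 1\<close> nonzero_divide_eq_eq[of "2 - 2 * v $ 0" 2 c]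
      by (simp add: c_def del: right_diff_distrib_numeral)
  define H where "H = mat n n (\<lambda>(i, j). (if i = j then 1 else 0) - c * w i * w j)"
  have "H * H = 1\<^sub>m n"
  proof (rule eq_matI)
    fix i j assume "i < dim_row (1\<^sub>m n :: real mat)" "j < dim_col (1\<^sub>m n :: real mat)"
    hence ij: "i < n" "j < n" by auto
    have "(H * H) $$ (i, j) = (\<Sum>k<n. ((if i = k then 1 else 0) - c * w i * w k) *
        ((if k = j then 1 else 0) - c * w k * w j))"
      using ij by (simp add: H_def scalar_prod_def lessThan_atLeast0)
    also have "\<dots> = (if i = j then 1 else 0) - 2 * c * w i * w j + (\<Sum>k<n. w k * w k) * c * c * w i * w j"
      using ij by (simp add: algebra_simps sum.distrib sum_subtractf sum_distrib_left
        if_distrib[where f="\<lambda>x. _ * x"] if_distrib[where f="\<lambda>x. x * _"] sum.delta sum.delta' cong: if_cong)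
    also have "\<dots> = (if i = j then 1 else 0) - 2 * c * w i * w j + (c * (2 - 2 * v $ 0)) * c * w i * w j"
      unfolding ww by (simp add: algebra_simps)
    finally show "(H * H) $$ (i, j) = 1\<^sub>m n $$ (i, j)" using ij by (simp add: cw)
  qed (auto simp: H_def)
  moreover have "H\<^sup>T = H" by (rule eq_matI) (auto simp: H_def)
  moreover have "col H 0 = v"
  proof (rule eq_vecI)
    fix i assume "i < dim_vec v"
    hence i: "i < n" using v by simp
    have "c * w i * w 0 = (c * (2 - 2 * v $ 0)) * w i * (- 1 / 2)" by (simp add: w_def algebra_simps)
    hence "c * w i * w 0 = - w i" by (simp add: cw)
    thus "col H 0 $ i = v $ i" using i n by (simp add: H_def w_def)
  qed (use v in \<open>simp add: H_def\<close>)
  ultimately show ?thesis by (intro bexI[of _ H]) (auto simp: H_def)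
qed

text \<open>Deflation: conjugating by the reflection that carries e_0 to a unit eigenvector turns
  the first column into a multiple of e_0, symmetry does the same for the first row, and the
  induction hypothesis diagonalises the remaining block.\<close>

lemma spectral_theorem_real_symmetric:
  fixes A :: "real mat"
  assumes "A \<in> carrier_mat n n" and "A\<^sup>T = A"
  shows "\<exists>U \<in> carrier_mat n n. \<exists>d. U\<^sup>T * U = 1\<^sub>m n \<and> U\<^sup>T * A * U = mat_diag n d"
  using assms
proof (induction n arbitrary: A)
  case 0
  thus ?case by (intro bexI[of _ "1\<^sub>m 0"] exI) (auto intro!: eq_matI simp: mat_diag_def)
next
  case (Suc n)
  note A = Suc.prems(1) and sym = Suc.prems(2)
  obtain u k where u: "u \<in> carrier_vec (Suc n)" "u \<noteq> 0\<^sub>v (Suc n)" "A *\<^sub>v u = k \<cdot>\<^sub>v u"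
    using symmetric_eigenvector_exists[OF A sym] by auto
  have uu: "u \<bullet> u > 0" using conjugate_square_greater_0_vec[OF u(1)] u(2) by simp
  define v where "v = (1 / sqrt (u \<bullet> u)) \<cdot>\<^sub>v u"
  have v: "v \<in> carrier_vec (Suc n)" using u by (simp add: v_def)
  have "v \<bullet> v = 1" using uu u by (simp add: v_def real_sqrt_mult_self field_simps)
  then obtain H where H: "H \<in> carrier_mat (Suc n) (Suc n)" "H * H = 1\<^sub>m (Suc n)" "H\<^sup>T = H" "col H 0 = v"
    using symmetric_involution_with_first_column[OF v] by auto
  have Av: "A *\<^sub>v v = k \<cdot>\<^sub>v v" using u A
    by (simp add: v_def mult_mat_vec smult_smult_assoc mult.commute)
  define B where "B = H * A * H"
  have B: "B \<in> carrier_mat (Suc n) (Suc n)" using H A by (simp add: B_def)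
  have symB: "B\<^sup>T = B" using H A sym
    by (simp add: B_def transpose_mult[of _ "Suc n" "Suc n" _ "Suc n"] assoc_mult_mat[of _ "Suc n"
        "Suc n" _ "Suc n" _ "Suc n"])
  have AH: "A * H \<in> carrier_mat (Suc n) (Suc n)" using A H(1) by simp
  have "B = H * (A * H)" unfolding B_def by (rule assoc_mult_mat[OF H(1) A H(1)])
  hence "col B 0 = H *\<^sub>v col (A * H) 0" using col_mult2[OF H(1) AH, of 0] by simp
  also have "col (A * H) 0 = A *\<^sub>v col H 0" by (rule col_mult2[OF A H(1)]) simp
  also have "H *\<^sub>v (A *\<^sub>v col H 0) = k \<cdot>\<^sub>v (H *\<^sub>v col H 0)" using H(1,4) v Av by (simp add: mult_mat_vec)
  also have "H *\<^sub>v col H 0 = unit_vec (Suc n) 0"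
    using H(1,2) by (simp flip: col_mult2[of _ "Suc n" "Suc n" _ "Suc n"])
  finally have col0: "col B 0 = k \<cdot>\<^sub>v unit_vec (Suc n) 0" .
  have B_col: "B $$ (i, 0) = (if i = 0 then k else 0)" if "i < Suc n" for i
    using arg_cong[OF col0, of "\<lambda>x. x $ i"] that B by (auto simp: unit_vec_def)
  have B_row: "B $$ (0, i) = (if i = 0 then k else 0)" if "i < Suc n" for i
    using B_col[OF that] arg_cong[OF symB, of "\<lambda>M. M $$ (0, i)"] that B by auto
  define C where "C = mat n n (\<lambda>(i, j). B $$ (Suc i, Suc j))"
  have C: "C \<in> carrier_mat n n" by (simp add: C_def)
  have "B $$ (j, i) = B $$ (i, j)" if "i < Suc n" "j < Suc n" for i j
    using arg_cong[OF symB, of "\<lambda>M. M $$ (i, j)"] that B by auto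
  hence "C\<^sup>T = C" by (intro eq_matI) (auto simp: C_def)
  from Suc.IH[OF C this] obtain W d where W: "W \<in> carrier_mat n n" "W\<^sup>T * W = 1\<^sub>m n"
      "W\<^sup>T * C * W = mat_diag n d"
    by blast
  define K where "K = mat 1 1 (\<lambda>_. k)"
  have K: "K \<in> carrier_mat 1 1" by (simp add: K_def)
  define O1 where "O1 = (0\<^sub>m 1 n :: real mat)"
  define O2 where "O2 = (0\<^sub>m n 1 :: real mat)"
  have O: "O1 \<in> carrier_mat 1 n" "O2 \<in> carrier_mat n 1" by (auto simp: O1_def O2_def)
  have BC: "B = four_block_mat K O1 O2 C"
    using B by (intro eq_matI) (auto simp: K_def C_def O1_def O2_def B_col B_row)
  define V where "V = four_block_mat (1\<^sub>m 1) O1 O2 W"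
  have V: "V \<in> carrier_mat (Suc n) (Suc n)"
    using W(1) four_block_carrier_mat[of "1\<^sub>m 1" 1 1 W n n O1 O2] by (simp add: V_def)
  have VT: "V\<^sup>T = four_block_mat (1\<^sub>m 1) O1 O2 W\<^sup>T"
    unfolding V_def using W(1) O by (simp add: transpose_four_block_mat[of _ 1 1 _ n _ n] O1_def O2_def)
  have WT: "W\<^sup>T \<in> carrier_mat n n" using W by simp
  have VTV: "V\<^sup>T * V = 1\<^sub>m (Suc n)"
    unfolding VT unfolding V_def
    using W(1) WT O mult_four_block_mat[OF _ O WT _ O W(1), of "1\<^sub>m 1" "1\<^sub>m 1"] W(2)
    by (auto simp: O1_def O2_def intro!: eq_matI)
  have "V\<^sup>T * B = four_block_mat K O1 O2 (W\<^sup>T * C)"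
    unfolding VT BC using mult_four_block_mat[OF _ O WT _ O C, of "1\<^sub>m 1" K] K C WT
    by (simp add: O1_def O2_def)
  hence "V\<^sup>T * B * V = four_block_mat K O1 O2 (W\<^sup>T * C * W)"
    unfolding V_def using mult_four_block_mat[OF _ O _ _ O W(1), of K "W\<^sup>T * C" "1\<^sub>m 1"] K C WT W(1)
    by (simp add: O1_def O2_def)
  also have "\<dots> = mat_diag (Suc n) (\<lambda>i. if i = 0 then k else d (i - 1))"
    unfolding W(3) by (rule eq_matI) (auto simp: K_def O1_def O2_def mat_diag_def)
  finally have VBV: "V\<^sup>T * B * V = mat_diag (Suc n) (\<lambda>i. if i = 0 then k else d (i - 1))" .
  note asc = assoc_mult_mat[of _ "Suc n" "Suc n" _ "Suc n" _ "Suc n"]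
  have VT': "V\<^sup>T \<in> carrier_mat (Suc n) (Suc n)" using V by simp
  have HH: "H * (H * X) = X" if "X \<in> carrier_mat (Suc n) (Suc n)" for X
    using that H(1,2) by (simp flip: asc)
  have "(H * V)\<^sup>T * (H * V) = V\<^sup>T * V"
    using H(1,3) V VT' by (simp add: transpose_mult[of _ "Suc n" "Suc n" _ "Suc n"] asc HH)
  moreover have "(H * V)\<^sup>T * A * (H * V) = V\<^sup>T * B * V"
    using H(1,3) A V VT' by (simp add: transpose_mult[of _ "Suc n" "Suc n" _ "Suc n"] asc B_def)
  ultimately show ?case using VTV VBV H(1) V
    by (intro bexI[of _ "H * V"] exI[of _ "\<lambda>i. if i = 0 then k else d (i - 1)"]) auto
qed

text \<open>Padding the rows with zeros gives a square matrix whose last row is zero, so its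
  determinant vanishes and it has a nonzero kernel vector.\<close>

lemma common_orthogonal_vector_exists:
  fixes rs :: "real vec list"
  assumes rs: "set rs \<subseteq> carrier_vec n" and len: "length rs < n"
  shows "\<exists>x \<in> carrier_vec n. x \<noteq> 0\<^sub>v n \<and> (\<forall>r \<in> set rs. r \<bullet> x = 0)"
proof -
  define M where "M = mat_of_rows n (rs @ replicate (n - length rs) (0\<^sub>v n))"
  have M: "M \<in> carrier_mat n n" using len by (simp add: M_def mat_of_rows_def)
  have row: "row M i = (if i < length rs then rs ! i else 0\<^sub>v n)" if "i < n" for i
    using that rs len unfolding M_def
    by (subst mat_of_rows_row) (auto simp: nth_append dest: nth_mem)
  have "M\<^sup>T *\<^sub>v unit_vec n (n - 1) = 0\<^sub>v n"
  proof (rule eq_vecI)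
    fix i assume "i < dim_vec (0\<^sub>v n :: real vec)"
    hence i: "i < n" by simp
    have "(M\<^sup>T *\<^sub>v unit_vec n (n - 1)) $ i = row M (n - 1) $ i"
      using i M len by simp
    thus "(M\<^sup>T *\<^sub>v unit_vec n (n - 1)) $ i = 0\<^sub>v n $ i" using row[of "n - 1"] len i by simp
  qed (use M in simp)
  moreover have "unit_vec n (n - 1) \<noteq> (0\<^sub>v n :: real vec)" using len by simp
  ultimately have "det M\<^sup>T = 0"
    using det_0_iff_vec_prod_zero[OF transpose_carrier_mat[THEN iffD2, OF M]] unit_vec_carrier by blast
  hence "det M = 0" using det_transpose[OF M] by simp
  then obtain x where x: "x \<in> carrier_vec n" "x \<noteq> 0\<^sub>v n" "M *\<^sub>v x = 0\<^sub>v n"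
    using det_0_iff_vec_prod_zero[OF M] by auto
  have "r \<bullet> x = 0" if r: "r \<in> set rs" for r
  proof -
    obtain i where i: "i < length rs" "rs ! i = r" using r by (auto simp: in_set_conv_nth)
    have "(M *\<^sub>v x) $ i = row M i \<bullet> x" using i len M by simp
    thus ?thesis using row[of i] i len x by simp
  qed
  thus ?thesis using x by blast
qed

text \<open>If d had more positive entries than e, asking that the P-coordinates with
  \<open>d i \<le> 0\<close> and the Q-coordinates with \<open>e i > 0\<close> vanish would be fewer
  than n equations. A nonzero solution would make the quadratic form positive by the first
  diagonalisation and nonpositive by the second.\<close>

lemma congruent_diagonal_positive_count_le:
  fixes G P Q :: "real mat"
  assumes G: "G \<in> carrier_mat n n"
    and P: "P \<in> carrier_mat n n" "det P \<noteq> 0" "P\<^sup>T * G * P = mat_diag n d"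
    and Q: "Q \<in> carrier_mat n n" "det Q \<noteq> 0" "Q\<^sup>T * G * Q = mat_diag n e"
  shows "card {i. i < n \<and> d i > 0} \<le> card {i. i < n \<and> e i > 0}"
proof (rule ccontr)
  assume neg: "\<not> ?thesis"
  have inv: "\<exists>R \<in> carrier_mat n n. R * X = 1\<^sub>m n \<and> X * R = 1\<^sub>m n"
    if "X \<in> carrier_mat n n" "det X \<noteq> 0" for X :: "real mat"
    using det_non_zero_imp_unit[OF that] unfolding Units_def ring_mat_def by auto
  obtain P' where P': "P' \<in> carrier_mat n n" "P' * P = 1\<^sub>m n" "P * P' = 1\<^sub>m n" using inv[OF P(1,2)] by blast
  obtain Q' where Q': "Q' \<in> carrier_mat n n" "Q' * Q = 1\<^sub>m n" "Q * Q' = 1\<^sub>m n" using inv[OF Q(1,2)] by blast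
  define I where "I = filter (\<lambda>i. \<not> d i > 0) [0..<n]"
  define J where "J = filter (\<lambda>i. e i > 0) [0..<n]"
  have "length I = card {i. i < n \<and> \<not> d i > 0}"
    unfolding I_def by (subst distinct_card[symmetric]) (auto intro!: arg_cong[where f=card])
  moreover have "length J = card {i. i < n \<and> e i > 0}"
    unfolding J_def by (subst distinct_card[symmetric]) (auto intro!: arg_cong[where f=card])
  moreover have "card {i. i < n \<and> \<not> d i > 0} + card {i. i < n \<and> d i > 0} = n"
  proof -
    have "{i. i < n \<and> \<not> d i > 0} \<union> {i. i < n \<and> d i > 0} = {..<n}" by auto
    thus ?thesis by (subst card_Un_disjoint[symmetric]) auto
  qed
  ultimately have "length (map (row P') I @ map (row Q') J) < n" using neg by simp
  moreover have "set (map (row P') I @ map (row Q') J) \<subseteq> carrier_vec n"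
    using P'(1) Q'(1) by auto
  ultimately obtain x where x: "x \<in> carrier_vec n" "x \<noteq> 0\<^sub>v n"
    and orth: "\<forall>r \<in> set (map (row P') I @ map (row Q') J). r \<bullet> x = 0"
    using common_orthogonal_vector_exists by blast
  have form: "x \<bullet> (G *\<^sub>v x) = (\<Sum>i<n. f i * (X' *\<^sub>v x) $ i ^ 2)"
    if X: "X \<in> carrier_mat n n" "X\<^sup>T * G * X = mat_diag n f"
      and X': "X' \<in> carrier_mat n n" "X * X' = 1\<^sub>m n" for X X' f
  proof -
    define y where "y = X' *\<^sub>v x"
    have y: "y \<in> carrier_vec n" using X' x by (simp add: y_def)
    have xy: "x = X *\<^sub>v y" using X X' x by (simp add: y_def flip: assoc_mult_mat_vec[of _ n n _ n])
    have "y \<bullet> ((X\<^sup>T * G * X) *\<^sub>v y) = y \<bullet> (X\<^sup>T *\<^sub>v (G *\<^sub>v (X *\<^sub>v y)))"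
      using X(1) G y by (simp add: assoc_mult_mat_vec[of _ n n _ n])
    also have "\<dots> = (X *\<^sub>v y) \<bullet> (G *\<^sub>v (X *\<^sub>v y))"
      using transpose_vec_mult_scalar[of "X\<^sup>T" n n "G *\<^sub>v (X *\<^sub>v y)" y] X G y by simp
    finally have "x \<bullet> (G *\<^sub>v x) = y \<bullet> (mat_diag n f *\<^sub>v y)" using X(2) xy by simp
    also have "mat_diag n f *\<^sub>v y = vec n (\<lambda>i. f i * y $ i)"
      using y by (intro eq_vecI) (auto simp: mat_diag_def scalar_prod_def
        if_distrib[where f="\<lambda>x. x * _"] sum.delta cong: if_cong)
    finally show ?thesis using y
      by (simp add: scalar_prod_def y_def lessThan_atLeast0 power2_eq_square mult_ac)
  qed
  have y0: "(P' *\<^sub>v x) $ i = 0" if "i < n" "\<not> d i > 0" for i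
    using that orth P'(1) by (auto simp: I_def)
  have z0: "(Q' *\<^sub>v x) $ i = 0" if "i < n" "e i > 0" for i
    using that orth Q'(1) by (auto simp: J_def)
  have "x \<bullet> (G *\<^sub>v x) \<le> 0"
    unfolding form[OF Q(1,3) Q'(1,3)] using z0
    by (intro sum_nonpos) (metis lessThan_iff mult_nonpos_nonneg mult_zero_right not_le_imp_less zero_le_power2 zero_power2)
  moreover have "x \<bullet> (G *\<^sub>v x) > 0"
  proof -
    have "x = P *\<^sub>v (P' *\<^sub>v x)" using P(1) P' x by (simp flip: assoc_mult_mat_vec[of _ n n _ n])
    hence "P' *\<^sub>v x \<noteq> 0\<^sub>v n" using x P(1) by auto
    then obtain i where i: "i < n" "(P' *\<^sub>v x) $ i \<noteq> 0"
        using P'(1) by (metis carrier_matD(1) dim_mult_mat_vec eq_vecI index_zero_vec)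
    show ?thesis unfolding form[OF P(1,3) P'(1,3)]
    proof (rule sum_pos2[of _ i])
      show "0 < d i * (P' *\<^sub>v x) $ i ^ 2" using i y0 by (metis mult_pos_pos zero_less_power2)
      show "0 \<le> d j * (P' *\<^sub>v x) $ j ^ 2" if "j \<in> {..<n}" for j
        using y0[of j] that by (cases "d j > 0") auto
    qed (use i in auto)
  qed
  ultimately show False by simp
qed

text \<open>The predicate R lets one lemma count both the positive and the negative roots in
  \<open>sig\<close>. The order of r is the size of the fibre of f over r, and the fibres are
  summed.\<close>

lemma sum_order_prod_linear:
  fixes f :: "nat \<Rightarrow> real"
  shows "(\<Sum>r \<in> {r. poly (\<Prod>i<n. [:- f i, 1:]) r = 0 \<and> R r}. int (order r (\<Prod>i<n. [:- f i, 1:])))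
    = int (card {i. i < n \<and> R (f i)})"
proof -
  let ?p = "\<Prod>i<n. [:- f i, 1:]"
  have ord: "order r (\<Prod>i<k. [:- f i, 1:]) = card {i. i < k \<and> f i = r}" for r k
  proof (induction k)
    case (Suc k)
    have "order r (\<Prod>i<Suc k. [:- f i, 1:]) = order r (\<Prod>i<k. [:- f i, 1:]) + order r [:- f k, 1:]"
    proof -
      have "(\<Prod>i<k. [:- f i, 1:]) \<noteq> 0" by (simp add: prod_zero_iff)
      hence "(\<Prod>i<k. [:- f i, 1:]) * [:- f k, 1:] \<noteq> 0" by (intro no_zero_divisors) auto
      thus ?thesis unfolding prod.lessThan_Suc by (rule order_mult)
    qed
    also have "order r [:- f k, 1:] = (if f k = r then 1 else 0)"
      using order_linear_power[of r "f k" 1] by (auto simp: order_0I)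
    also have "order r (\<Prod>i<k. [:- f i, 1:]) = card {i. i < k \<and> f i = r}" by (rule Suc.IH)
    also have "card {i. i < k \<and> f i = r} + (if f k = r then 1 else 0) = card {i. i < Suc k \<and> f i = r}"
    proof -
      have "{i. i < Suc k \<and> f i = r} = (if f k = r then insert k {i. i < k \<and> f i = r} else {i. i < k \<and> f i
          = r})"
        by (auto simp: less_Suc_eq)
      thus ?thesis by simp
    qed
    finally show ?case .
  qed auto
  have "{r. poly ?p r = 0 \<and> R r} = f ` {i. i < n \<and> R (f i)}"
    by (auto simp: poly_prod prod_zero_iff)
  moreover have "order r ?p = card {i. i < n \<and> R (f i) \<and> f i = r}" if "R r" for r
    unfolding ord using that by (intro arg_cong[where f=card]) auto
  ultimately have "(\<Sum>r \<in> {r. poly ?p r = 0 \<and> R r}. int (order r ?p))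
      = int (\<Sum>r \<in> f ` {i. i < n \<and> R (f i)}. card {i. i < n \<and> R (f i) \<and> f i = r})"
    by (auto intro!: sum.cong)
  also have "(\<Sum>r \<in> f ` {i. i < n \<and> R (f i)}. card {i. i < n \<and> R (f i) \<and> f i = r})
      = (\<Sum>r \<in> f ` {i. i < n \<and> R (f i)}. \<Sum>i \<in> {i \<in> {i. i < n \<and> R (f i)}. f i = r}. 1)"
    by (simp add: conj_assoc)
  also have "\<dots> = card {i. i < n \<and> R (f i)}" by (subst sum.image_gen[symmetric]) auto
  finally show ?thesis .
qed

text \<open>An orthogonal U is at once a similarity, which reads \<open>sig G\<close> off the
  eigenvalues e, and a congruence, so that e and d have equally many positive entries. The negative
  ones are compared through -G. G may be singular: zero entries contribute sgn 0 = 0.\<close>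

theorem sylvester_inertia:
  fixes G P :: "real mat"
  assumes G: "G \<in> carrier_mat n n" "G\<^sup>T = G"
    and P: "P \<in> carrier_mat n n" "det P \<noteq> 0" "P\<^sup>T * G * P = mat_diag n d"
  shows "real_of_int (sig G) = (\<Sum>i<n. sgn (d i))"
proof -
  obtain U e where U: "U \<in> carrier_mat n n" "U\<^sup>T * U = 1\<^sub>m n" "U\<^sup>T * G * U = mat_diag n e"
    using spectral_theorem_real_symmetric[OF G] by blast
  have "det U\<^sup>T * det U = 1" using U by (metis det_mult det_one transpose_carrier_mat)
  hence detU: "det U \<noteq> 0" by auto
  have UUT: "U * U\<^sup>T = 1\<^sub>m n" using mat_mult_left_right_inverse[of "U\<^sup>T" n U] U by simp
  have "similar_mat (mat_diag n e) G"
    unfolding similar_mat_def similar_mat_wit_def 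
    by (rule exI[of _ "U\<^sup>T"], rule exI[of _ U]) (use U UUT G in \<open>auto simp: Let_def mat_diag_def\<close>)
  hence "char_poly G = char_poly (mat_diag n e)" using char_poly_similar by metis
  also have "\<dots> = (\<Prod>a \<leftarrow> diag_mat (mat_diag n e). [:- a, 1:])"
    by (rule char_poly_upper_triangular[of _ n]) (auto simp: mat_diag_def)
  also have "\<dots> = (\<Prod>i<n. [:- e i, 1:])"
    by (auto simp: diag_mat_def mat_diag_def prod.list_conv_set_nth lessThan_atLeast0 intro!: prod.cong)
  finally have cp: "char_poly G = (\<Prod>i<n. [:- e i, 1:])" .
  have sigG: "sig G = int (card {i. i < n \<and> e i > 0}) - int (card {i. i < n \<and> e i < 0})"
    unfolding sig_def cp using sum_order_prod_linear[of e n "\<lambda>r. r > 0"]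
        sum_order_prod_linear[of e n "\<lambda>r. r < 0"]
    by simp
  have nP: "P\<^sup>T * (- G) * P = mat_diag n (\<lambda>i. - d i)"
  proof -
    have "P\<^sup>T * (- G) * P = - (P\<^sup>T * G * P)" using P(1) G(1) by simp
    thus ?thesis using P(3) by (auto simp: mat_diag_def intro!: eq_matI)
  qed
  have nU: "U\<^sup>T * (- G) * U = mat_diag n (\<lambda>i. - e i)"
  proof -
    have "U\<^sup>T * (- G) * U = - (U\<^sup>T * G * U)" using U(1) G(1) by simp
    thus ?thesis using U(3) by (auto simp: mat_diag_def intro!: eq_matI)
  qed
  have nG: "- G \<in> carrier_mat n n" using G by simp
  have "card {i. i < n \<and> d i > 0} = card {i. i < n \<and> e i > 0}"
    using congruent_diagonal_positive_count_le[OF G(1) P U(1) detU U(3)]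
      congruent_diagonal_positive_count_le[OF G(1) U(1) detU U(3) P] by simp
  moreover have "card {i. i < n \<and> d i < 0} = card {i. i < n \<and> e i < 0}"
    using congruent_diagonal_positive_count_le[OF nG P(1,2) nP U(1) detU nU]
      congruent_diagonal_positive_count_le[OF nG U(1) detU nU P(1,2) nP] by simp
  moreover have "(\<Sum>i<n. sgn (d i)) = real (card {i. i < n \<and> d i > 0}) - real (card {i. i < n \<and> d i < 0})"
  proof -
    have "(\<Sum>i<n. sgn (d i)) = (\<Sum>i<n. (if d i > 0 then 1 else 0) - (if d i < 0 then 1 else 0))"
      by (intro sum.cong) (auto simp: sgn_if)
    also have "\<dots> = real (card ({..<n} \<inter> {i. d i > 0})) - real (card ({..<n} \<inter> {i. d i < 0}))"
      by (simp add: sum_subtractf sum.If_cases)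
    finally show ?thesis by (simp add: Int_def)
  qed
  ultimately show ?thesis using sigG by simp
qed

section \<open>The Verma module in PBW coordinates\<close>

text \<open>
  A vector is the function of its coordinates in the basis \<open>F\<^sub>1\<^sup>a F\<^sub>3\<^sup>b F\<^sub>2\<^sup>c|\<lambda>\<rangle>\<close>, where \<open>F\<^sub>3 = [F\<^sub>1, F\<^sub>2]\<close>.  No
  finiteness of the support is needed: each coordinate of an image depends on finitely many coordinates.
\<close>
type_synonym vvec = "nat \<Rightarrow> nat \<Rightarrow> nat \<Rightarrow> real"

definition vscale :: "real \<Rightarrow> vvec \<Rightarrow> vvec" where
  "vscale k f = (\<lambda>a b c. k * f a b c)"

definition vF1 :: "vvec \<Rightarrow> vvec" where
  "vF1 f = (\<lambda>a b c. if a = 0 then 0 else f (a - 1) b c)"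

text \<open>As F2 F1 = F1 F2 - F3 and F3 commutes with F1 and F2, one has F2 F1^a = F1^a F2 - a
  F1^(a-1) F3; the formula is this identity read on coordinates.\<close>

definition vF2 :: "vvec \<Rightarrow> vvec" where
  "vF2 f = (\<lambda>a b c. (if c = 0 then 0 else f a b (c - 1))
     - (if b = 0 then 0 else (real a + 1) * f (a + 1) (b - 1) c))"

definition vF3 :: "vvec \<Rightarrow> vvec" where
  "vF3 f = (\<lambda>a b c. if b = 0 then 0 else f a (b - 1) c)"

text \<open>Comes from [E1, F1] = H1, [E1, F3] = F2 and [E1, F2] = 0. The first coefficient is the
  sl2 value of E1 F1^(a+1) on a vector of H1-weight (alpha_1, lambda) - b + c.\<close>

definition vE1 :: "wt \<Rightarrow> vvec \<Rightarrow> vvec" where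
  "vE1 l f = (\<lambda>a b c. (real a + 1) * (ip (pos_root 1) l - a - b + c) * f (a + 1) b c
     + (if c = 0 then 0 else (real b + 1) * f a (b + 1) (c - 1)))"

text \<open>Comes from [E2, F2] = H2, [E2, F3] = -F1 and [E2, F1] = 0.\<close>

definition vE2 :: "wt \<Rightarrow> vvec \<Rightarrow> vvec" where
  "vE2 l f = (\<lambda>a b c. (real c + 1) * (ip (pos_root 2) l - c) * f a b (c + 1)
     - (if a = 0 then 0 else (real b + 1) * f (a - 1) (b + 1) c))"

text \<open>The bracket is [E2, E1], the image of F3 = [F1, F2] under the order-reversing
  dagger.\<close>

definition vE3 :: "wt \<Rightarrow> vvec \<Rightarrow> vvec" where
  "vE3 l f = vE2 l (vE1 l f) - vE1 l (vE2 l f)"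

definition basis_vec :: "nat \<Rightarrow> nat \<Rightarrow> nat \<Rightarrow> vvec" where
  "basis_vec a b c = (\<lambda>a' b' c'. if a' = a \<and> b' = b \<and> c' = c then 1 else 0)"

definition has_weight :: "nat \<Rightarrow> nat \<Rightarrow> vvec \<Rightarrow> bool" where
  "has_weight m n f \<longleftrightarrow> (\<forall>a b c. f a b c \<noteq> 0 \<longrightarrow> a + b = m \<and> b + c = n)"

lemmas vop_defs = vF1_def vF2_def vF3_def vE1_def vE2_def vscale_def

definition vlinear :: "(vvec \<Rightarrow> vvec) \<Rightarrow> bool" where
  "vlinear X \<longleftrightarrow> (\<forall>f g. X (f + g) = X f + X g) \<and> (\<forall>k f. X (vscale k f) = vscale k (X f))"

lemma vlinearD:
  assumes "vlinear X"
  shows "X (f + g) = X f + X g" "X (vscale k f) = vscale k (X f)" "X 0 = 0" "X (f - g) = X f - X g"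
proof -
  show 1: "X (f + g) = X f + X g" for f g using assms by (simp add: vlinear_def)
  show 2: "X (vscale k f) = vscale k (X f)" for k f using assms by (simp add: vlinear_def)
  have "X (vscale 0 0) = vscale 0 (X 0)" by (rule 2)
  thus "X 0 = 0" by (simp add: vscale_def zero_fun_def)
  have 3: "f - g = f + vscale (-1) g" for f g by (intro ext) (simp add: vscale_def)
  show "X (f - g) = X f - X g" unfolding 3 1 2 ..
qed

lemma vlinear_ops: "vlinear vF1" "vlinear vF2" "vlinear vF3" "vlinear (vE1 l)" "vlinear (vE2 l)"
    "vlinear (vE3 l)"
proof -
  show 12: "vlinear vF1" "vlinear vF2" "vlinear vF3" "vlinear (vE1 l)" "vlinear (vE2 l)"
    by (auto simp: vlinear_def vop_defs algebra_simps intro!: ext)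
  show "vlinear (vE3 l)"
    unfolding vlinear_def vE3_def
    by (simp add: vlinearD[OF 12(4)] vlinearD[OF 12(5)], auto simp: vscale_def algebra_simps intro!: ext)
qed

lemma vlinear_funpow: "vlinear X \<Longrightarrow> vlinear (X ^^ n)"
  by (induction n) (auto simp: vlinear_def)

lemmas vop_linear = vlinear_ops[THEN vlinearD(1)] vlinear_ops[THEN vlinearD(2)]
  vlinear_ops[THEN vlinearD(3)] vlinear_ops[THEN vlinearD(4)]

text \<open>H1 is diagonal in the PBW basis, with eigenvalue (alpha_1, lambda - (a+b) alpha_1 -
  (b+c) alpha_2) at (a, b, c), so the identity holds for every coordinate function, of one weight or
  not.\<close>

lemma vE1_vF1: "vE1 l (vF1 f) = (\<lambda>a b c. vF1 (vE1 l f) a b c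
    + (ip (pos_root 1) l - 2 * (a + b) + (b + c)) * f a b c)"
  by (intro ext, rename_tac a b c, case_tac a; case_tac b; case_tac c;
      (simp add: vop_defs)?; (intro conjI impI)?; (simp add: algebra_simps)?)

lemma vE2_vF2: "vE2 l (vF2 f) = (\<lambda>a b c. vF2 (vE2 l f) a b c
    + (ip (pos_root 2) l - 2 * (b + c) + (a + b)) * f a b c)"
  by (intro ext, rename_tac a b c, case_tac a; case_tac b; case_tac c;
      (simp add: vop_defs)?; (intro conjI impI)?; (simp add: algebra_simps)?)

lemma vE1_vF2: "vE1 l (vF2 f) = vF2 (vE1 l f)"
  by (intro ext, rename_tac a b c, case_tac a; case_tac b; case_tac c;
      (simp add: vop_defs)?; (intro conjI impI)?; (simp add: algebra_simps)?)

lemma vE2_vF1: "vE2 l (vF1 f) = vF1 (vE2 l f)"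
  by (intro ext, rename_tac a b c, case_tac a; case_tac b; case_tac c;
      (simp add: vop_defs)?; (intro conjI impI)?; (simp add: algebra_simps)?)

lemma vF3_commutator: "vF3 f = vF1 (vF2 f) - vF2 (vF1 f)"
  by (intro ext, rename_tac a b c, case_tac a; case_tac b; case_tac c;
      (simp add: vop_defs)?; (intro conjI impI)?; (simp add: algebra_simps)?)

lemma vF1_vF3: "vF1 (vF3 f) = vF3 (vF1 f)"
  by (intro ext) (auto simp: vop_defs)

lemma vF2_vF3: "vF2 (vF3 f) = vF3 (vF2 f)"
  by (intro ext) (auto simp: vop_defs)

lemma vE3_explicit: "vE3 l f = (\<lambda>a b c. (real b + 1) * (ip (pos_root 1) l + ip (pos_root 2) l - a - b
    - c) * f a (b + 1) c
     + (real a + 1) * (real c + 1) * (ip (pos_root 2) l - c) * f (a + 1) b (c + 1))"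
proof (intro ext)
  fix a b c
  show "vE3 l f a b c = (real b + 1) * (ip (pos_root 1) l + ip (pos_root 2) l - a - b - c) * f a (b + 1) c
     + (real a + 1) * (real c + 1) * (ip (pos_root 2) l - c) * f (a + 1) b (c + 1)"
    unfolding vE3_def vE1_def vE2_def
    by (cases a; cases c; simp; simp add: algebra_simps)
qed

lemma vE1_vF3: "vE1 l (vF3 f) = vF3 (vE1 l f) + vF2 f"
  by (intro ext, rename_tac a b c, case_tac a; case_tac b; case_tac c;
      (simp add: vop_defs)?; (intro conjI impI)?; (simp add: algebra_simps)?)

lemma vE2_vF3: "vE2 l (vF3 f) = vF3 (vE2 l f) - vF1 f"
  by (intro ext, rename_tac a b c, case_tac a; case_tac b; case_tac c;
      (simp add: vop_defs)?; (intro conjI impI)?; (simp add: algebra_simps)?)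

lemma vE3_vE1: "vE3 l (vE1 l f) = vE1 l (vE3 l f)"
  by (intro ext, rename_tac a b c, case_tac a; case_tac b; case_tac c;
      (simp add: vop_defs vE3_explicit)?; (intro conjI impI)?; (simp add: algebra_simps)?)

lemma vE3_vF1: "vE3 l (vF1 f) = vF1 (vE3 l f) + vE2 l f"
  by (intro ext, rename_tac a b c, case_tac a; case_tac b; case_tac c;
      (simp add: vop_defs vE3_explicit)?; (intro conjI impI)?; (simp add: algebra_simps)?)

lemma vE3_vF3: "vE3 l (vF3 f) = (\<lambda>a b c. vF3 (vE3 l f) a b c
    + (ip (pos_root 1) l + ip (pos_root 2) l - (a + b) - (b + c)) * f a b c)"
  by (intro ext, rename_tac a b c, case_tac a; case_tac b; case_tac c;
      (simp add: vop_defs vE3_explicit)?; (intro conjI impI)?; (simp add: algebra_simps)?)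

lemma has_weight_iff: "has_weight m n f \<longleftrightarrow> (\<forall>a b c. a + b \<noteq> m \<or> b + c \<noteq> n \<longrightarrow> f a b c = 0)"
  unfolding has_weight_def by blast

lemma has_weight_ops:
  assumes "has_weight m n f"
  shows "has_weight (Suc m) n (vF1 f)" "has_weight m (Suc n) (vF2 f)" "has_weight (Suc m) (Suc n) (vF3 f)"
    "has_weight m n (vscale k f)"
    "has_weight m n g \<Longrightarrow> has_weight m n (f + g)"
proof -
  show "has_weight (Suc m) n (vF1 f)"
    unfolding has_weight_iff vop_defs using assms[unfolded has_weight_iff]
    by (intro allI impI, rename_tac a b c, case_tac a; case_tac b; case_tac c; auto)
  show "has_weight m (Suc n) (vF2 f)"
    unfolding has_weight_iff vop_defs using assms[unfolded has_weight_iff]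
    by (intro allI impI, rename_tac a b c, case_tac a; case_tac b; case_tac c; auto)
  show "has_weight (Suc m) (Suc n) (vF3 f)"
    unfolding has_weight_iff vop_defs using assms[unfolded has_weight_iff]
    by (intro allI impI, rename_tac a b c, case_tac a; case_tac b; case_tac c; auto)
  show "has_weight m n (vscale k f)" "has_weight m n g \<Longrightarrow> has_weight m n (f + g)"
    using assms by (auto simp: has_weight_iff vscale_def)
qed

lemma has_weight_basis_vec: "has_weight (a + b) (b + c) (basis_vec a b c)"
  by (auto simp: has_weight_def basis_vec_def)

lemma vF_basis_vec:
  "vF1 (basis_vec a b c) = basis_vec (Suc a) b c"
  "vF3 (basis_vec a b c) = basis_vec a (Suc b) c"
  "vF2 (basis_vec 0 0 c) = basis_vec 0 0 (Suc c)"
  by (intro ext; auto simp: vop_defs basis_vec_def)+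

section \<open>Words in the generators and the Shapovalov form in PBW coordinates\<close>

definition Eop :: "wt \<Rightarrow> nat \<Rightarrow> vvec \<Rightarrow> vvec" where
  "Eop l i = (if i = 1 then vE1 l else vE2 l)"

definition Fop :: "nat \<Rightarrow> vvec \<Rightarrow> vvec" where
  "Fop i = (if i = 1 then vF1 else vF2)"

fun Fword :: "nat list \<Rightarrow> vvec \<Rightarrow> vvec" where
  "Fword [] f = f"
| "Fword (i # v) f = Fop i (Fword v f)"

text \<open>The adjoint of \<open>Fword v\<close>: dagger reverses products, so the first letter
  acts first.\<close>

fun Eword :: "wt \<Rightarrow> nat list \<Rightarrow> vvec \<Rightarrow> vvec" where
  "Eword l [] f = f"
| "Eword l (i # v) f = Eword l v (Eop l i f)"

primrec lsum :: "(nat list \<Rightarrow> vvec) \<Rightarrow> lcomb \<Rightarrow> vvec" where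
  "lsum g [] = 0"
| "lsum g (p # x) = vscale (fst p) (g (snd p)) + lsum g x"

lemma vlinear_Eop: "vlinear (Eop l i)" and vlinear_Fop: "vlinear (Fop i)"
  by (simp_all add: Eop_def Fop_def vlinear_ops)

lemma vlinear_Fword: "vlinear (Fword u)"
  by (induction u) (simp_all add: vlinear_def vlinearD[OF vlinear_Fop])

lemma vlinear_Eword: "vlinear (Eword l u)"
  by (induction u) (simp_all add: vlinear_def vlinearD[OF vlinear_Eop])

lemma vlinear_lsum:
  assumes "vlinear X"
  shows "X (lsum g x) = lsum (\<lambda>u. X (g u)) x"
  by (induction x) (simp_all only: lsum.simps vlinearD[OF assms])

lemma vscale_simps: "vscale k (f + g) = vscale k f + vscale k g" "vscale k (vscale j f) = vscale (k * j) f"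
    "vscale 1 f = f" "vscale k 0 = 0"
  by (auto simp: vscale_def algebra_simps intro!: ext)

lemma lsum_append: "lsum g (x @ y) = lsum g x + lsum g y"
  by (induction x) (simp_all add: add.assoc)

lemma lsum_map: "lsum g (map (\<lambda>(c, u). (k * c, h u)) x) = vscale k (lsum (\<lambda>u. g (h u)) x)"
  by (induction x) (auto simp: vscale_def algebra_simps intro!: ext)

lemma lsum_apply: "lsum g x a b c' = (\<Sum>(c, u)\<leftarrow>x. c * g u a b c')"
  by (induction x) (auto simp: vscale_def)

lemma word_has_weight:
  assumes "set v \<subseteq> {1, 2}"
  shows "has_weight (count_list v 1) (count_list v 2) (Fword v (basis_vec 0 0 0))"
  using assms
proof (induction v)
  case Nil
  show ?case using has_weight_basis_vec[of 0 0 0] by simp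
next
  case (Cons i v)
  hence IH: "has_weight (count_list v 1) (count_list v 2) (Fword v (basis_vec 0 0 0))"
    and i: "i = 1 \<or> i = 2" by auto
  from i show ?case using has_weight_ops(1,2)[OF IH] by (auto simp: Fop_def)
qed

lemma Eop_Fop_diff:
  assumes "i \<in> {1, 2}" "j \<in> {1, 2}" "i \<noteq> j"
  shows "Eop l i (Fop j f) = Fop j (Eop l i f)"
  using assms by (auto simp: Eop_def Fop_def vE1_vF2 vE2_vF1)

text \<open>All nonzero coordinates of f have the weight of v, so the diagonal H-term of
  \<open>vE1_vF1\<close> and \<open>vE2_vF2\<close> becomes one scalar.\<close>

lemma Eop_Fop_same:
  assumes i: "i \<in> {1, 2}" and v: "set v \<subseteq> {1, 2}"
  defines "f \<equiv> Fword v (basis_vec 0 0 0)"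
  shows "Eop l i (Fop i f) = Fop i (Eop l i f) + vscale (ip (pos_root i) (wsub l (word_wt v))) f"
proof -
  have w: "has_weight (count_list v 1) (count_list v 2) f" unfolding f_def by (rule word_has_weight[OF v])
  show ?thesis
  proof (intro ext)
    fix a b c
    show "Eop l i (Fop i f) a b c = (Fop i (Eop l i f) + vscale (ip (pos_root i) (wsub l (word_wt v))) f) a b c"
    proof (cases "f a b c = 0")
      case True
      thus ?thesis using i by (auto simp: Eop_def Fop_def vE1_vF1 vE2_vF2 vscale_def)
    next
      case False
      hence "real (count_list v 1) = a + b" "real (count_list v 2) = b + c"
        using w by (auto simp: has_weight_def)
      thus ?thesis using i
        by (auto simp: Eop_def Fop_def vE1_vF1 vE2_vF2 vscale_def ip_def pos_root_def wsub_def word_wt_def algebra_simps)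
    qed
  qed
qed

text \<open>Both sides obey the same recursion on the first letter: commuting E_i past F_j leaves an
  H_i term only for i = j, and E_i kills the highest weight vector.\<close>

lemma Eact_word:
  assumes i: "i \<in> {1, 2}" and v: "set v \<subseteq> {1, 2}"
  shows "lsum (\<lambda>u. Fword u (basis_vec 0 0 0)) (Eact l i v) = Eop l i (Fword v (basis_vec 0 0 0))"
  using v
proof (induction v)
  case Nil
  have "vE1 l (basis_vec 0 0 0) = 0" "vE2 l (basis_vec 0 0 0) = 0"
    by (auto simp: vop_defs basis_vec_def intro!: ext)
  thus ?case by (simp add: Eop_def)
next
  case (Cons j v)
  let ?W = "\<lambda>u. Fword u (basis_vec 0 0 0)"
  have j: "j \<in> {1, 2}" and v: "set v \<subseteq> {1, 2}" using Cons.prems by auto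
  have "lsum ?W (map (\<lambda>(c, u). (c, j # u)) (Eact l i v)) = lsum (\<lambda>u. Fop j (?W u)) (Eact l i v)"
    using lsum_map[of ?W 1 "\<lambda>u. j # u" "Eact l i v"] by (simp add: vscale_simps)
  also have "\<dots> = Fop j (Eop l i (?W v))"
    unfolding Cons.IH[OF v, symmetric] by (rule vlinear_lsum[OF vlinear_Fop, symmetric])
  finally show ?case
    using Eop_Fop_diff[OF i j] Eop_Fop_same[OF i v, of l] by (intro ext) (auto simp: lsum_append)
qed

lemma set_Eact: "(c, u) \<in> set (Eact l i v) \<Longrightarrow> mset v = add_mset i (mset u)"
  by (induction v arbitrary: c u) (auto split: if_splits)

lemma Eact_letters: "(c, u) \<in> set (Eact l i v) \<Longrightarrow> set v \<subseteq> X \<Longrightarrow> set u \<subseteq> X"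
  using set_Eact[of c u l i v] by (metis insert_subset set_mset_add_mset_insert set_mset_mset)

text \<open>Peeling off the letters of w by contravariance leaves a pairing with |lambda>, which is
  the coordinate at (0, 0, 0); this coordinate vanishes on nonempty words for weight
  reasons.\<close>

lemma shap_word_eq_Eword:
  assumes "set w \<subseteq> {1, 2}" "set v \<subseteq> {1, 2}"
  shows "shap_word l w v = Eword l w (Fword v (basis_vec 0 0 0)) 0 0 0"
  using assms
proof (induction w arbitrary: v)
  case Nil
  show ?case
  proof (cases v)
    case (Cons i v')
    hence "count_list v 1 \<noteq> 0 \<or> count_list v 2 \<noteq> 0" using Nil(2) by auto
    hence "Fword v (basis_vec 0 0 0) 0 0 0 = 0"
      using word_has_weight[OF Nil(2)] by (auto simp: has_weight_iff)
    thus ?thesis using Cons by simp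
  qed (simp add: basis_vec_def)
next
  case (Cons i w)
  have i: "i \<in> {1, 2}" and w: "set w \<subseteq> {1, 2}" using Cons.prems by auto
  have "shap_word l (i # w) v = (\<Sum>(c, u)\<leftarrow>Eact l i v. c * shap_word l w u)" by simp
  also have "\<dots> = (\<Sum>(c, u)\<leftarrow>Eact l i v. c * Eword l w (Fword u (basis_vec 0 0 0)) 0 0 0)"
    by (rule arg_cong[where f=sum_list], rule map_cong[OF refl])
      (use Cons.IH[OF w] Eact_letters[of _ _ l i v, OF _ Cons.prems(2)] in auto)
  also have "\<dots> = Eword l w (Eop l i (Fword v (basis_vec 0 0 0))) 0 0 0"
    using arg_cong[OF vlinear_lsum[OF vlinear_Eword, of l w "\<lambda>u. Fword u (basis_vec 0 0 0)" "Eact l i v"],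
        of "\<lambda>f. f 0 0 0"] Eact_word[OF i Cons.prems(2)]
    by (simp add: lsum_apply)
  finally show ?case by simp
qed

lemma Fword_append: "Fword (u @ v) f = Fword u (Fword v f)"
  by (induction u) simp_all

lemma Eword_append: "Eword l (u @ v) f = Eword l v (Eword l u f)"
  by (induction u arbitrary: f) simp_all

lemma lc_mult_Cons: "lc_mult (p # x) y = map (\<lambda>(c, u). (fst p * c, snd p @ u)) y @ lc_mult x y"
  by (simp add: lc_mult_def case_prod_unfold)

lemma lc_mult_Nil: "lc_mult [] y = []"
  by (simp add: lc_mult_def)

lemma lsum_Fword_mult:
  "lsum (\<lambda>u. Fword u f) (lc_mult x y) = lsum (\<lambda>u. Fword u (lsum (\<lambda>u. Fword u f) y)) x"
proof (induction x)
  case (Cons p x)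
  show ?case
    unfolding lc_mult_Cons lsum_append lsum_map lsum.simps Cons.IH Fword_append
      vlinear_lsum[OF vlinear_Fword] ..
qed (simp only: lc_mult_Nil lsum.simps)

lemma lsum_linear:
  "lsum (\<lambda>u. g u + h u) x = lsum g x + lsum h x"
  "lsum (\<lambda>u. vscale k (g u)) x = vscale k (lsum g x)"
  "lsum (\<lambda>u. 0) x = 0"
proof -
  have "lsum (\<lambda>u. g u + h u) x a b c = lsum g x a b c + lsum h x a b c" for a b c
    by (induction x) (simp_all add: vscale_def algebra_simps)
  thus "lsum (\<lambda>u. g u + h u) x = lsum g x + lsum h x" by (intro ext) simp
  have "lsum (\<lambda>u. vscale k (g u)) x a b c = k * lsum g x a b c" for a b c
    by (induction x) (simp_all add: vscale_def algebra_simps)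
  thus "lsum (\<lambda>u. vscale k (g u)) x = vscale k (lsum g x)" by (intro ext) (simp add: vscale_def)
  show "lsum (\<lambda>u. 0) x = 0" by (induction x) (simp_all only: lsum.simps vscale_simps add_0)
qed

text \<open>As \<open>Eword\<close> reverses products, x acts before y, in contrast to
  \<open>lsum_Fword_mult\<close>.\<close>

lemma lsum_Eword_mult:
  "lsum (\<lambda>u. Eword l u f) (lc_mult x y) = lsum (\<lambda>u. Eword l u (lsum (\<lambda>u. Eword l u f) x)) y"
proof (induction x)
  case Nil
  show ?case by (simp only: lc_mult_Nil lsum.simps vlinearD[OF vlinear_Eword] lsum_linear)
next
  case (Cons p x)
  show ?case
    unfolding lc_mult_Cons lsum_append lsum_map lsum.simps Cons.IH Eword_append
      vlinearD[OF vlinear_Eword] lsum_linear ..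
qed

lemma lsum_lc_pow:
  assumes "\<And>f. lsum (\<lambda>u. Fword u f) x = X f"
  shows "lsum (\<lambda>u. Fword u f) (lc_pow x n) = (X ^^ n) f"
proof (induction n)
  case (Suc n)
  have "lc_pow x (Suc n) = lc_mult x (lc_pow x n)" by (simp add: lc_pow_def)
  thus ?case using Suc by (simp add: lsum_Fword_mult assms)
qed (auto simp: lc_pow_def vscale_def intro!: ext)

lemma lsum_lc_pow_dual:
  assumes "\<And>f. lsum (\<lambda>u. Eword l u f) x = X f"
  shows "lsum (\<lambda>u. Eword l u f) (lc_pow x n) = (X ^^ n) f"
proof (induction n arbitrary: f)
  case (Suc n)
  have "lc_pow x (Suc n) = lc_mult x (lc_pow x n)" by (simp add: lc_pow_def)
  thus ?case using Suc by (simp add: lsum_Eword_mult assms funpow_swap1)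
qed (auto simp: lc_pow_def vscale_def intro!: ext)

lemma generators_act:
  "lsum (\<lambda>u. Fword u f) F1 = vF1 f" "lsum (\<lambda>u. Fword u f) F2 = vF2 f" "lsum (\<lambda>u. Fword u f) F3 = vF3 f"
  "lsum (\<lambda>u. Eword l u f) F1 = vE1 l f" "lsum (\<lambda>u. Eword l u f) F2 = vE2 l f"
  "lsum (\<lambda>u. Eword l u f) F3 = vE3 l f"
  by (intro ext; simp add: F1_def F2_def F3_def lc_mult_def Fop_def Eop_def vscale_def vF3_commutator vE3_def)+

text \<open>Applying F2^c, then F3^b, then F1^a to |lambda> never leaves the basis vectors, which
  identifies the coordinates with the basis used in \<open>gram\<close>.\<close>

lemma pbw_basis_vec: "lsum (\<lambda>u. Fword u (basis_vec 0 0 0)) (pbw a b c) = basis_vec a b c"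
proof -
  have c: "(vF2 ^^ c) (basis_vec 0 0 0) = basis_vec 0 0 c"
    by (induction c) (simp_all add: vF_basis_vec)
  have b: "(vF3 ^^ b) (basis_vec 0 0 c) = basis_vec 0 b c"
    by (induction b) (simp_all add: vF_basis_vec)
  have "(vF1 ^^ a) (basis_vec 0 b c) = basis_vec a b c"
    by (induction a) (simp_all add: vF_basis_vec)
  thus ?thesis
    unfolding pbw_def lsum_Fword_mult
    by (simp only: lsum_lc_pow[OF generators_act(1)] lsum_lc_pow[OF generators_act(2)]
        lsum_lc_pow[OF generators_act(3)] b c)
qed

text \<open>The pairing of F1^a F3^b F2^c|lambda> with f: the adjoints act in the order E1, E3, E2,
  and the coordinate of |lambda> is read off.\<close>

definition bracket :: "wt \<Rightarrow> nat \<Rightarrow> nat \<Rightarrow> nat \<Rightarrow> vvec \<Rightarrow> real" where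
  "bracket l a b c f = (vE2 l ^^ c) ((vE3 l ^^ b) ((vE1 l ^^ a) f)) 0 0 0"

lemma pbw_bracket: "lsum (\<lambda>u. Eword l u f) (pbw a b c) 0 0 0 = bracket l a b c f"
  unfolding pbw_def lsum_Eword_mult bracket_def
  by (simp only: lsum_lc_pow_dual[OF generators_act(4)] lsum_lc_pow_dual[OF generators_act(5)]
        lsum_lc_pow_dual[OF generators_act(6)])

definition over_letters :: "lcomb \<Rightarrow> bool" where
  "over_letters x \<longleftrightarrow> (\<forall>(c, u) \<in> set x. set u \<subseteq> {1, 2})"

lemma over_letters_mult: "over_letters x \<Longrightarrow> over_letters y \<Longrightarrow> over_letters (lc_mult x y)"
  by (fastforce simp: over_letters_def lc_mult_def)

lemma over_letters_pbw: "over_letters (pbw a b c)"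
proof -
  have pow: "over_letters (lc_pow x n)" if "over_letters x" for x n
  proof (induction n)
    case (Suc n)
    have "lc_pow x (Suc n) = lc_mult x (lc_pow x n)" by (simp add: lc_pow_def)
    thus ?case using Suc that by (simp add: over_letters_mult)
  qed (simp add: lc_pow_def over_letters_def)
  have "over_letters F1" "over_letters F2" "over_letters F3"
    by (auto simp: over_letters_def F1_def F2_def F3_def lc_mult_def)
  thus ?thesis unfolding pbw_def by (intro over_letters_mult pow)
qed

lemma shap_pbw: "shap l (pbw a b c) (pbw a' b' c') = bracket l a b c (basis_vec a' b' c')"
proof -
  let ?W = "\<lambda>u. Fword u (basis_vec 0 0 0)"
  have inner: "(\<Sum>(d, v)\<leftarrow>y. c * d * shap_word l u v) = c * Eword l u (lsum ?W y) 0 0 0"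
    if "over_letters y" "set u \<subseteq> {1, 2}" for c u y
  proof -
    have "(\<Sum>(d, v)\<leftarrow>y. c * d * shap_word l u v) = (\<Sum>(d, v)\<leftarrow>y. c * (d * Eword l u (?W v) 0 0 0))"
      using that by (intro arg_cong[where f=sum_list] map_cong[OF refl])
        (auto simp: over_letters_def shap_word_eq_Eword)
    also have "\<dots> = c * (\<Sum>(d, v)\<leftarrow>y. d * Eword l u (?W v) 0 0 0)"
      by (simp add: case_prod_unfold sum_list_const_mult)
    finally show ?thesis by (simp add: vlinear_lsum[OF vlinear_Eword] lsum_apply)
  qed
  have "shap l x y = lsum (\<lambda>u. Eword l u (lsum ?W y)) x 0 0 0"
    if "over_letters x" "over_letters y" for x y
    unfolding shap_def lsum_apply[where x = x]
    using that inner[OF that(2)] by (intro arg_cong[where f=sum_list] map_cong[OF refl])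
        (auto simp: over_letters_def)
  thus ?thesis by (simp add: over_letters_pbw pbw_basis_vec pbw_bracket)
qed

text \<open>Each step of the recursion removes from v one letter equal to the one peeled off w, so
  words of different weight are orthogonal.\<close>

lemma shap_word_mset: "shap_word l w v \<noteq> 0 \<Longrightarrow> mset w = mset v"
proof (induction w arbitrary: v)
  case (Cons i w)
  have "\<exists>(c, u) \<in> set (Eact l i v). shap_word l w u \<noteq> 0"
  proof (rule ccontr)
    assume "\<not> ?thesis"
    hence "map (\<lambda>(c, u). c * shap_word l w u) (Eact l i v) = map (\<lambda>_. 0) (Eact l i v)" by auto
    hence "shap_word l (i # w) v = (\<Sum>_\<leftarrow>Eact l i v. 0)" by (simp only: shap_word.simps)
    thus False using Cons.prems by simp
  qed
  thus ?case using Cons.IH set_Eact[of _ _ l i v] by force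
qed (auto split: if_splits)

text \<open>
  Moving \<open>E_i\<close> and \<open>F_j\<close> past each other in either argument produces an \<open>H_i\<close> term; the two terms agree
  since only words of equal weight pair nontrivially.
\<close>
lemma shap_word_right:
  "shap_word l w (j # v) = (\<Sum>(c, u)\<leftarrow>Eact l j w. c * shap_word l u v)"
proof (induction w arbitrary: v)
  case (Cons i w)
  let ?h = "\<lambda>u. ip (pos_root i) (wsub l (word_wt u))"
  have wt: "?h v * shap_word l w v = ?h w * shap_word l w v"
  proof (cases "shap_word l w v = 0")
    case False
    hence "mset w = mset v" by (rule shap_word_mset)
    hence "word_wt w = word_wt v" by (simp add: word_wt_def flip: count_mset)
    thus ?thesis by simp
  qed simp
  have swap: "(\<Sum>(c, u)\<leftarrow>xs. c * (\<Sum>(d, t)\<leftarrow>ys. d * g t u)) = (\<Sum>(d, t)\<leftarrow>ys. d * (\<Sum>(c, u)\<leftarrow>xs. c * g t u))"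
    for xs ys :: lcomb and g
  proof (induction xs)
    case (Cons p xs)
    have "(\<Sum>(d, t)\<leftarrow>ys. d * (\<Sum>(c, u)\<leftarrow>p # xs. c * g t u))
        = (\<Sum>(d, t)\<leftarrow>ys. fst p * (d * g t (snd p)) + d * (\<Sum>(c, u)\<leftarrow>xs. c * g t u))"
      by (simp add: case_prod_unfold algebra_simps)
    thus ?case using Cons by (simp add: case_prod_unfold sum_list_addf sum_list_const_mult)
  qed (simp add: case_prod_unfold)
  have "(\<Sum>(c, u)\<leftarrow>map (\<lambda>(c, u). (c, j # u)) (Eact l i v). c * shap_word l w u)
      = (\<Sum>(c, u)\<leftarrow>Eact l i v. c * (\<Sum>(d, t)\<leftarrow>Eact l j w. d * shap_word l t u))"
    by (simp add: comp_def case_prod_unfold Cons.IH)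
  also have "\<dots> = (\<Sum>(d, t)\<leftarrow>Eact l j w. d * shap_word l (i # t) v)"
    by (subst swap) simp
  also have "\<dots> = (\<Sum>(c, u)\<leftarrow>map (\<lambda>(c, u). (c, i # u)) (Eact l j w). c * shap_word l u v)"
    by (simp add: comp_def case_prod_unfold)
  finally show ?case using wt by simp
qed auto

text \<open>\<open>shap_word_right\<close> is the defining recursion with the arguments exchanged,
  so symmetry follows by induction on the second word.\<close>

lemma shap_word_sym: "shap_word l w v = shap_word l v w"
proof (induction v arbitrary: w)
  case Nil
  show ?case by (cases w) auto
next
  case (Cons j v)
  show ?case unfolding shap_word_right by (simp add: Cons.IH)
qed

lemma shap_sym: "shap l x y = shap l y x"
proof -
  have "(\<Sum>(c, u)\<leftarrow>x. \<Sum>(d, v)\<leftarrow>y. c * d * shap_word l u v)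
      = (\<Sum>(d, v)\<leftarrow>y. \<Sum>(c, u)\<leftarrow>x. d * c * shap_word l v u)"
  proof (induction x)
    case (Cons p x)
    thus ?case by (simp add: case_prod_unfold sum_list_addf shap_word_sym[of l "snd p"]
        mult.commute[of "fst p"])
  qed (simp add: case_prod_unfold)
  thus ?thesis by (simp add: shap_def)
qed

section \<open>The contravariant form on a weight space\<close>

text \<open>Only the coordinates of f in the weight space (m1, m2) enter, which keeps the sum finite
  for functions of any support.\<close>

definition form :: "wt \<Rightarrow> nat \<Rightarrow> nat \<Rightarrow> vvec \<Rightarrow> vvec \<Rightarrow> real" where
  "form l m1 m2 f g = (\<Sum>i\<le>min m1 m2. f (m1 - i) i (m2 - i) * bracket l (m1 - i) i (m2 - i) g)"

lemma vlinear_bracket_op: "vlinear (\<lambda>f. (vE2 l ^^ c) ((vE3 l ^^ b) ((vE1 l ^^ a) f)))"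
  unfolding vlinear_def
  by (simp only: vlinearD[OF vlinear_funpow[OF vlinear_ops(4)]] vlinearD[OF vlinear_funpow[OF vlinear_ops(5)]]
      vlinearD[OF vlinear_funpow[OF vlinear_ops(6)]] simp_thms)

lemma bracket_linear:
  "bracket l a b c (f + g) = bracket l a b c f + bracket l a b c g"
  "bracket l a b c (vscale k f) = k * bracket l a b c f"
  "bracket l a b c 0 = 0"
  unfolding bracket_def vlinearD[OF vlinear_bracket_op] by (simp_all add: vscale_def)

lemma form_linear:
  "form l m1 m2 f (vscale k g) = k * form l m1 m2 f g" "form l m1 m2 f 0 = 0"
  by (simp_all add: form_def bracket_linear sum_distrib_left mult_ac)

text \<open>A function of unrestricted support need not be a finite sum of basis vectors, but a
  weight vector is: \<open>part n\<close> collects the coordinates with F3-exponent below n and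
  grows by one basis vector at a time, so that linearity applies.\<close>

lemma bracket_expand:
  assumes "has_weight m1 m2 g"
  shows "bracket l a b c g = (\<Sum>j\<le>min m1 m2. g (m1 - j) j (m2 - j) * bracket l a b c (basis_vec (m1
      - j) j (m2 - j)))"
proof -
  define part where "part n = (\<lambda>a b c. if b < n then g a b c else 0)" for n
  have step: "part (Suc n) = part n + vscale (g (m1 - n) n (m2 - n)) (basis_vec (m1 - n) n (m2 - n))"
    if "n \<le> min m1 m2" for n
  proof (intro ext)
    fix a b c
    have "g a b c = 0" if "b = n" "a \<noteq> m1 - n \<or> c \<noteq> m2 - n"
      using assms[unfolded has_weight_def, rule_format, of a b c] that by (cases "g a b c = 0") auto
    thus "part (Suc n) a b c = (part n + vscale (g (m1 - n) n (m2 - n)) (basis_vec (m1 - n) n (m2 - n))) a b c"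
      by (auto simp: part_def vscale_def basis_vec_def less_Suc_eq)
  qed
  have "bracket l a b c (part n) = (\<Sum>j<n. g (m1 - j) j (m2 - j) * bracket l a b c (basis_vec (m1 - j) j (m2
      - j)))"
    if "n \<le> Suc (min m1 m2)" for n
    using that
  proof (induction n)
    case 0
    have "part 0 = 0" by (intro ext) (simp add: part_def)
    thus ?case by (simp only: bracket_linear lessThan_0 sum.empty)
  next
    case (Suc n)
    hence n: "n \<le> min m1 m2" and IH: "bracket l a b c (part n)
        = (\<Sum>j<n. g (m1 - j) j (m2 - j) * bracket l a b c (basis_vec (m1 - j) j (m2 - j)))"
      by simp_all
    show ?case unfolding step[OF n] bracket_linear IH sum.lessThan_Suc ..
  qed
  from this[of "Suc (min m1 m2)"]
  have "bracket l a b c (part (Suc (min m1 m2)))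
      = (\<Sum>j\<le>min m1 m2. g (m1 - j) j (m2 - j) * bracket l a b c (basis_vec (m1 - j) j (m2 - j)))"
    by (simp add: lessThan_Suc_atMost)
  moreover have "part (Suc (min m1 m2)) = g"
  proof (intro ext)
    fix a b c
    show "part (Suc (min m1 m2)) a b c = g a b c"
      using assms[unfolded has_weight_def, rule_format, of a b c] by (cases "g a b c = 0") (auto simp: part_def)
  qed
  ultimately show ?thesis by simp
qed

lemma gram_eq: "gram l m1 m2 = mat (min m1 m2 + 1) (min m1 m2 + 1)
    (\<lambda>(i, j). bracket l (m1 - i) i (m2 - i) (basis_vec (m1 - j) j (m2 - j)))"
  by (simp add: gram_def shap_pbw)

lemma bracket_sym: "bracket l a b c (basis_vec a' b' c') = bracket l a' b' c' (basis_vec a b c)"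
  using shap_sym by (simp flip: shap_pbw)

lemma form_sym:
  assumes "has_weight m1 m2 f" "has_weight m1 m2 g"
  shows "form l m1 m2 f g = form l m1 m2 g f"
proof -
  have "form l m1 m2 f g = (\<Sum>i\<le>min m1 m2. \<Sum>j\<le>min m1 m2. f (m1 - i) i (m2 - i) * (g (m1 - j) j (m2 - j) *
      bracket l (m1 - i) i (m2 - i) (basis_vec (m1 - j) j (m2 - j))))"
    by (simp add: form_def bracket_expand[OF assms(2)] sum_distrib_left)
  also have "\<dots> = (\<Sum>j\<le>min m1 m2. \<Sum>i\<le>min m1 m2. g (m1 - j) j (m2 - j) * (f (m1 - i) i (m2 - i) *
      bracket l (m1 - j) j (m2 - j) (basis_vec (m1 - i) i (m2 - i))))"
    by (subst sum.swap, subst bracket_sym) (simp add: mult_ac)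
  also have "\<dots> = form l m1 m2 g f"
    by (simp add: form_def bracket_expand[OF assms(1)] sum_distrib_left)
  finally show ?thesis .
qed

text \<open>The columns of P are the coordinates of the \<open>u k\<close>, so P^T G P holds their
  pairings and is diagonal by orthogonality and symmetry. The norms may vanish, as happens on a
  wall.\<close>

lemma sig_gram_eq_sum_sgn:
  defines "coord u \<equiv> (\<lambda>m1 m2. mat (min m1 m2 + 1) (min m1 m2 + 1) (\<lambda>(i, k). u k (m1 - i) i (m2 - i)))"
  assumes wt: "\<And>k. k \<le> min m1 m2 \<Longrightarrow> has_weight m1 m2 (u k)"
    and orth: "\<And>k k'. k' < k \<Longrightarrow> k \<le> min m1 m2 \<Longrightarrow> form l m1 m2 (u k) (u k') = 0"
    and det: "det (coord u m1 m2) \<noteq> 0"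
  shows "real_of_int (sig (gram l m1 m2)) = (\<Sum>k\<le>min m1 m2. sgn (form l m1 m2 (u k) (u k)))"
proof -
  define N where "N = Suc (min m1 m2)"
  define P where "P = coord u m1 m2"
  define G where "G = gram l m1 m2"
  have P: "P \<in> carrier_mat N N" "\<And>i k. i < N \<Longrightarrow> k < N \<Longrightarrow> P $$ (i, k) = u k (m1 - i) i (m2 - i)"
    by (auto simp: P_def coord_def N_def)
  have G: "G \<in> carrier_mat N N" "\<And>i j. i < N \<Longrightarrow> j < N
      \<Longrightarrow> G $$ (i, j) = bracket l (m1 - i) i (m2 - i) (basis_vec (m1 - j) j (m2 - j))"
    by (auto simp: G_def gram_eq N_def)
  have "G\<^sup>T = G"
    using G bracket_sym[of l] by (intro eq_matI) auto
  have entry: "(P\<^sup>T * G * P) $$ (k, k') = form l m1 m2 (u k) (u k')" if k: "k < N" "k' < N" for k k'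
  proof -
    have "(G * P) $$ (i, k') = bracket l (m1 - i) i (m2 - i) (u k')" if i: "i < N" for i
    proof -
      have "has_weight m1 m2 (u k')" using wt k by (metis N_def less_Suc_eq_le)
      have "(G * P) $$ (i, k') = (\<Sum>j<N. G $$ (i, j) * P $$ (j, k'))"
        using P(1) G(1) i k by (simp add: scalar_prod_def atLeast0LessThan)
      also have "\<dots> = (\<Sum>j<N. u k' (m1 - j) j (m2 - j) * bracket l (m1 - i) i (m2 - i) (basis_vec (m1
          - j) j (m2 - j)))"
        using P(2) G(2) i k by (intro sum.cong) (auto simp: mult.commute)
      also have "\<dots> = bracket l (m1 - i) i (m2 - i) (u k')"
        unfolding bracket_expand[OF \<open>has_weight m1 m2 (u k')\<close>] N_def lessThan_Suc_atMost ..
      finally show ?thesis .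
    qed
    moreover have "(P\<^sup>T * (G * P)) $$ (k, k') = (\<Sum>i<N. P $$ (i, k) * (G * P) $$ (i, k'))"
      using P G k by (simp add: scalar_prod_def atLeast0LessThan)
    moreover have "P\<^sup>T * G * P = P\<^sup>T * (G * P)"
      using P(1) G(1) by (simp add: assoc_mult_mat[of _ N N _ N _ N])
    ultimately have "(P\<^sup>T * G * P) $$ (k, k') = (\<Sum>i<N. u k (m1 - i) i (m2 - i) * bracket l (m1 - i) i (m2
        - i) (u k'))"
      using P(2) k by simp
    thus ?thesis unfolding form_def N_def lessThan_Suc_atMost .
  qed
  have "P\<^sup>T * G * P = mat_diag N (\<lambda>k. form l m1 m2 (u k) (u k))"
  proof (rule eq_matI)
    fix k k' assume "k < dim_row (mat_diag N (\<lambda>k. form l m1 m2 (u k) (u k)))"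
      "k' < dim_col (mat_diag N (\<lambda>k. form l m1 m2 (u k) (u k)))"
    hence k: "k < N" "k' < N" by (auto simp: mat_diag_def)
    have "form l m1 m2 (u k) (u k') = 0" if "k \<noteq> k'"
    proof (cases "k' < k")
      case True
      thus ?thesis using orth k by (metis N_def less_Suc_eq_le)
    next
      case False
      hence "form l m1 m2 (u k') (u k) = 0" using orth[of k k'] k that
          by (metis N_def less_Suc_eq_le linorder_neqE_nat)
      thus ?thesis using form_sym wt k by (metis N_def less_Suc_eq_le)
    qed
    thus "(P\<^sup>T * G * P) $$ (k, k') = mat_diag N (\<lambda>k. form l m1 m2 (u k) (u k)) $$ (k, k')"
      using entry[OF k] k by (auto simp: mat_diag_def)
  qed (use P G in \<open>auto simp: mat_diag_def\<close>)
  from sylvester_inertia[OF G(1) \<open>G\<^sup>T = G\<close> P(1) _ this] det show ?thesis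
    by (simp add: P_def G_def N_def lessThan_Suc_atMost)
qed

lemma funpow_commute: "(\<And>f. X (Y f) = Y (X f)) \<Longrightarrow> (X ^^ n) (Y f) = Y ((X ^^ n) f)"
  by (induction n) simp_all

text \<open>F1 is the leftmost factor of a PBW monomial, so \<open>vF1\<close> only shifts an index
  and \<open>bracket\<close> absorbs one more E1 as its innermost operator. The index i = m1 + 1, if
  present, has F1-exponent 0, where \<open>vF1 f\<close> vanishes.\<close>

lemma form_vF1: "form l (Suc m1) m2 (vF1 f) g = form l m1 m2 f (vE1 l g)"
proof -
  have "form l (Suc m1) m2 (vF1 f) g = (\<Sum>i\<le>min m1 m2. vF1 f (Suc m1 - i) i (m2 - i) * bracket l (Suc m1
      - i) i (m2 - i) g)"
    unfolding form_def
    by (rule sum.mono_neutral_right) (auto simp: vF1_def)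
  also have "\<dots> = form l m1 m2 f (vE1 l g)"
    unfolding form_def
    by (rule sum.cong) (auto simp: vF1_def bracket_def Suc_diff_le funpow_swap1)
  finally show ?thesis .
qed

text \<open>Here the shifted index is the middle one, so the new E3 must move past the powers of E1,
  with which it commutes.\<close>

lemma form_vF3: "form l (Suc m1) (Suc m2) (vF3 f) g = form l m1 m2 f (vE3 l g)"
proof -
  have "(vE1 l ^^ a) (vE3 l g) = vE3 l ((vE1 l ^^ a) g)" for a
    by (rule funpow_commute) (simp add: vE3_vE1)
  thus ?thesis
    unfolding form_def min_Suc_Suc sum.atMost_Suc_shift
    by (simp add: vF3_def bracket_def funpow_swap1)
qed

lemma form_vF1_funpow: "form l (m1 + k) m2 ((vF1 ^^ k) f) g = form l m1 m2 f ((vE1 l ^^ k) g)"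
  by (induction k arbitrary: g) (simp_all add: form_vF1 funpow_swap1[of "vE1 l"])

lemma form_vF3_funpow: "form l (m1 + k) (m2 + k) ((vF3 ^^ k) f) g = form l m1 m2 f ((vE3 l ^^ k) g)"
  by (induction k arbitrary: g) (simp_all add: form_vF3 funpow_swap1[of "vE3 l"])

lemma has_weight_funpow:
  assumes "has_weight m n f"
  shows "has_weight (m + k) n ((vF1 ^^ k) f)" "has_weight (m + k) (n + k) ((vF3 ^^ k) f)"
  by (induction k) (simp_all add: assms has_weight_ops)

lemma vF_funpow_apply:
  "(vF1 ^^ k) f a b c = (if a < k then 0 else f (a - k) b c)"
  "(vF3 ^^ k) f a b c = (if b < k then 0 else f a (b - k) c)"
  by (induction k arbitrary: a b) (auto simp: vF1_def vF3_def)

definition shifted :: "wt \<Rightarrow> nat \<Rightarrow> real" where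
  "shifted l k = ip (pos_root k) (wadd l rho)"

lemma shifted_simps: "ip (pos_root (Suc 0)) l = shifted l 1 - 1" "ip (pos_root 2) l = shifted l 2 - 1"
    "shifted l 3 = shifted l 1 + shifted l 2"
  by (auto simp: shifted_def ip_def pos_root_def wadd_def rho_def)

section \<open>Orthogonal bases adapted to the roots \<open>\<alpha>\<^sub>3\<close> and \<open>\<alpha>\<^sub>1\<close>\<close>

text \<open>On one weight space the H-terms are scalars; the constants 1 and 2 are (alpha_1, rho)
  and (alpha_3, rho).\<close>

lemma weight_commutators:
  assumes "has_weight m n f"
  shows "vE1 l (vF1 f) = vF1 (vE1 l f) + vscale (shifted l 1 - 1 - 2 * m + n) f"
    "vE3 l (vF3 f) = vF3 (vE3 l f) + vscale (shifted l 3 - 2 - m - n) f"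
proof -
  have w: "a + b = m \<and> b + c = n \<or> f a b c = 0" for a b c
    using assms[unfolded has_weight_def, rule_format, of a b c] by auto
  show "vE1 l (vF1 f) = vF1 (vE1 l f) + vscale (shifted l 1 - 1 - 2 * m + n) f"
  proof (intro ext)
    fix a b c
    show "vE1 l (vF1 f) a b c = (vF1 (vE1 l f) + vscale (shifted l 1 - 1 - 2 * m + n) f) a b c"
      using w[of a b c] by (auto simp: vE1_vF1 vscale_def shifted_simps)
  qed
  show "vE3 l (vF3 f) = vF3 (vE3 l f) + vscale (shifted l 3 - 2 - m - n) f"
  proof (intro ext)
    fix a b c
    show "vE3 l (vF3 f) a b c = (vF3 (vE3 l f) + vscale (shifted l 3 - 2 - m - n) f) a b c"
      using w[of a b c] by (auto simp: vE3_vF3 vscale_def shifted_simps)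
  qed
qed

lemma E_basis_vec:
  "vE1 l (basis_vec a 0 0) = vscale (a * (shifted l 1 - a)) (basis_vec (a - 1) 0 0)"
  "vE2 l (basis_vec 0 0 c) = vscale (c * (shifted l 2 - c)) (basis_vec 0 0 (c - 1))"
  "vE1 l (basis_vec 0 0 c) = 0"
  "vE3 l (basis_vec 0 0 c) = 0"
  by (intro ext, rename_tac x y z, case_tac a; case_tac c;
      auto simp: vE1_def vE2_def vE3_explicit vscale_def basis_vec_def shifted_simps algebra_simps split: nat.splits)+

text \<open>The usual computation for a highest weight vector f of weight h, kept abstract so that
  it serves both alpha_3 and alpha_1. The last claim is the source of orthogonality between vectors
  with different numbers of lowering steps.\<close>

lemma sl2_ladder:
  assumes X: "vlinear X" and Y: "vlinear Y" and zero: "X f = 0"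
    and comm: "\<And>k. X (Y ((Y ^^ k) f)) = Y (X ((Y ^^ k) f)) + vscale (h - 2 * real k) ((Y ^^ k) f)"
  shows "X ((Y ^^ Suc k) f) = vscale (real (Suc k) * (h - k)) ((Y ^^ k) f)"
    and "(X ^^ k) ((Y ^^ k) f) = vscale (\<Prod>i<k. real (Suc i) * (h - i)) f"
    and "k < k' \<Longrightarrow> (X ^^ k') ((Y ^^ k) f) = 0"
proof -
  show 1: "X ((Y ^^ Suc k) f) = vscale (real (Suc k) * (h - k)) ((Y ^^ k) f)" for k
  proof (induction k)
    case 0
    show ?case using comm[of 0] by (simp add: zero vlinearD[OF Y])
  next
    case (Suc k)
    have "X ((Y ^^ Suc (Suc k)) f) = Y (X ((Y ^^ Suc k) f)) + vscale (h - 2 * real (Suc k)) ((Y ^^ Suc k) f)"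
      using comm[of "Suc k"] by simp
    also have "\<dots> = vscale (real (Suc k) * (h - k)) ((Y ^^ Suc k) f) + vscale (h
        - 2 * real (Suc k)) ((Y ^^ Suc k) f)"
      unfolding Suc.IH vlinearD[OF Y] by simp
    also have "\<dots> = vscale (real (Suc (Suc k)) * (h - Suc k)) ((Y ^^ Suc k) f)"
      by (intro ext) (simp add: vscale_def algebra_simps)
    finally show ?case .
  qed
  show 2: "(X ^^ k) ((Y ^^ k) f) = vscale (\<Prod>i<k. real (Suc i) * (h - i)) f" for k
  proof (induction k)
    case 0
    show ?case by (intro ext) (simp add: vscale_def)
  next
    case (Suc k)
    have "(X ^^ Suc k) ((Y ^^ Suc k) f) = (X ^^ k) (X ((Y ^^ Suc k) f))"
      by (simp add: funpow_swap1[of X])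
    also have "\<dots> = vscale (real (Suc k) * (h - k)) (vscale (\<Prod>i<k. real (Suc i) * (h - i)) f)"
      unfolding 1 vlinearD[OF vlinear_funpow[OF X]] Suc.IH ..
    finally show ?case by (simp add: vscale_simps mult_ac)
  qed
  show "(X ^^ k') ((Y ^^ k) f) = 0" if lt: "k < k'" for k k'
  proof -
    obtain j where "k' = Suc (k + j)" using less_imp_Suc_add[OF lt] by auto
    hence j: "k' = Suc j + k" by simp
    have zero': "(X ^^ Suc j) f = 0"
    proof -
      have "(X ^^ Suc j) f = (X ^^ j) (X f)" by (simp add: funpow_swap1[of X])
      thus ?thesis unfolding zero vlinearD[OF vlinear_funpow[OF X]] .
    qed
    have "(X ^^ k') ((Y ^^ k) f) = (X ^^ Suc j) ((X ^^ k) ((Y ^^ k) f))"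
      by (simp only: j funpow_add comp_apply)
    also have "\<dots> = vscale (\<Prod>i<k. real (Suc i) * (h - i)) ((X ^^ Suc j) f)"
      by (simp only: 2 vlinearD[OF vlinear_funpow[OF X]])
    finally show ?thesis by (simp only: zero' vscale_simps)
  qed
qed

lemma vF1_ladder:
  assumes "has_weight m n f" "vE1 l f = 0"
  defines "h \<equiv> shifted l 1 - 1 - 2 * m + n"
  shows "(vE1 l ^^ k) ((vF1 ^^ k) f) = vscale (\<Prod>i<k. real (Suc i) * (h - i)) f"
    and "k < k' \<Longrightarrow> (vE1 l ^^ k') ((vF1 ^^ k) f) = 0"
proof -
  have "vE1 l (vF1 ((vF1 ^^ k) f)) = vF1 (vE1 l ((vF1 ^^ k) f)) + vscale (h - 2 * real k) ((vF1 ^^ k) f)" for k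
    using weight_commutators(1)[OF has_weight_funpow(1)[OF assms(1)], of l k] by (simp add: h_def algebra_simps)
  note * = sl2_ladder[OF vlinear_ops(4) vlinear_ops(1) assms(2) this]
  show "(vE1 l ^^ k) ((vF1 ^^ k) f) = vscale (\<Prod>i<k. real (Suc i) * (h - i)) f" by (rule *)
  show "k < k' \<Longrightarrow> (vE1 l ^^ k') ((vF1 ^^ k) f) = 0" by (rule *)
qed

lemma vF3_ladder:
  assumes "has_weight m n f" "vE3 l f = 0"
  defines "h \<equiv> shifted l 3 - 2 - m - n"
  shows "(vE3 l ^^ k) ((vF3 ^^ k) f) = vscale (\<Prod>i<k. real (Suc i) * (h - i)) f"
    and "k < k' \<Longrightarrow> (vE3 l ^^ k') ((vF3 ^^ k) f) = 0"
proof -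
  have "vE3 l (vF3 ((vF3 ^^ k) f)) = vF3 (vE3 l ((vF3 ^^ k) f)) + vscale (h - 2 * real k) ((vF3 ^^ k) f)" for k
    using weight_commutators(2)[OF has_weight_funpow(2)[OF assms(1)], of l k] by (simp add: h_def algebra_simps)
  note * = sl2_ladder[OF vlinear_ops(6) vlinear_ops(3) assms(2) this]
  show "(vE3 l ^^ k) ((vF3 ^^ k) f) = vscale (\<Prod>i<k. real (Suc i) * (h - i)) f" by (rule *)
  show "k < k' \<Longrightarrow> (vE3 l ^^ k') ((vF3 ^^ k) f) = 0" by (rule *)
qed

lemma E_power_basis_vec:
  "(vE1 l ^^ p) (basis_vec p 0 0) = vscale (\<Prod>i<p. real (Suc i) * (shifted l 1 - Suc i)) (basis_vec 0 0 0)"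
  "(vE2 l ^^ p) (basis_vec 0 0 p) = vscale (\<Prod>i<p. real (Suc i) * (shifted l 2 - Suc i)) (basis_vec 0 0 0)"
proof -
  show "(vE1 l ^^ p) (basis_vec p 0 0) = vscale (\<Prod>i<p. real (Suc i) * (shifted l 1 - Suc i)) (basis_vec 0 0 0)"
  proof (induction p)
    case (Suc p)
    have "(vE1 l ^^ Suc p) (basis_vec (Suc p) 0 0) = (vE1 l ^^ p) (vE1 l (basis_vec (Suc p) 0 0))"
      by (simp add: funpow_swap1)
    thus ?case unfolding E_basis_vec vlinearD[OF vlinear_funpow[OF vlinear_ops(4)]]
      by (simp add: Suc.IH vscale_simps mult_ac)
  qed (auto simp: vscale_def intro!: ext)
  show "(vE2 l ^^ p) (basis_vec 0 0 p) = vscale (\<Prod>i<p. real (Suc i) * (shifted l 2 - Suc i)) (basis_vec 0 0 0)"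
  proof (induction p)
    case (Suc p)
    have "(vE2 l ^^ Suc p) (basis_vec 0 0 (Suc p)) = (vE2 l ^^ p) (vE2 l (basis_vec 0 0 (Suc p)))"
      by (simp add: funpow_swap1)
    thus ?case unfolding E_basis_vec vlinearD[OF vlinear_funpow[OF vlinear_ops(5)]]
      by (simp add: Suc.IH vscale_simps mult_ac)
  qed (auto simp: vscale_def intro!: ext)
qed

section \<open>The basis adapted to alpha_3\<close>

text \<open>
  \<open>vecA l p q\<close> is the vector \<open>F\<^sub>1\<^sup>p F\<^sub>2\<^sup>q|\<lambda>\<rangle> + F\<^sub>3(\<dots>)\<close> killed
      by \<open>E\<^sub>3\<close>.  Such vectors are stable under \<open>E\<^sub>2\<close>, and
  \<open>betA\<close> is the resulting scalar; the coefficient in the recursion is then forced by \<open>E\<^sub>3 v = 0\<close>.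
  For \<open>q = 0\<close> the factor \<open>betA\<close> vanishes, which makes the truncated \<open>q - 1\<close> harmless.
\<close>
definition betA :: "wt \<Rightarrow> nat \<Rightarrow> nat \<Rightarrow> real" where
  "betA l p q = q * (shifted l 2 - q) * (shifted l 3 - q) / (shifted l 3 - p - q)"

fun vecA :: "wt \<Rightarrow> nat \<Rightarrow> nat \<Rightarrow> vvec" where
  "vecA l 0 q = basis_vec 0 0 q"
| "vecA l (Suc p) q = vF1 (vecA l p q) + vscale (- betA l p q / (shifted l 3 - 1 - p - q)) (vF3 (vecA l p (q
    - 1)))"

lemma betA_0: "betA l p 0 = 0" by (simp add: betA_def)

lemma vscale_0: "vscale 0 f = 0" by (intro ext) (simp add: vscale_def)

lemma has_weight_0: "has_weight m n 0" by (simp add: has_weight_def)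

lemma vecA_weight: "has_weight p q (vecA l p q)"
proof (induction p arbitrary: q)
  case 0
  show ?case using has_weight_basis_vec[of 0 0 q] by simp
next
  case (Suc p)
  have "has_weight (Suc p) q (vscale (- betA l p q / (shifted l 3 - 1 - p - q)) (vF3 (vecA l p (q - 1))))"
  proof (cases q)
    case 0
    thus ?thesis by (simp add: betA_0 vscale_0 has_weight_0)
  next
    case (Suc r)
    thus ?thesis using has_weight_ops(3)[OF Suc.IH, of r] by (simp add: has_weight_ops(4))
  qed
  thus ?case unfolding vecA.simps by (intro has_weight_ops(5) has_weight_ops(1) Suc.IH)
qed

lemma vecA_leading: "vecA l p q p 0 q = 1"
  by (induction p) (simp_all add: basis_vec_def vF1_def vF3_def vscale_def)

text \<open>The two relations are proved together: as [E3, F1] = E2, vanishing under E3 at p + 1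
  uses the E2-scalar at p. The hypothesis on c3 keeps the denominators nonzero.\<close>

lemma vecA_relations:
  assumes c3: "\<And>n. shifted l 3 \<noteq> real (Suc n)"
  shows "vE3 l (vecA l p q) = 0 \<and> vE2 l (vecA l p q) = vscale (betA l p q) (vecA l p (q - 1))"
proof (induction p arbitrary: q)
  case 0
  have "betA l 0 q = q * (shifted l 2 - q)"
    using c3[of "q - 1"] by (cases q) (auto simp: betA_def)
  thus ?case by (simp add: E_basis_vec)
next
  case (Suc p)
  define k where "k q = - betA l p q / (shifted l 3 - 1 - p - q)" for q
  have rec: "vecA l (Suc p) q = vF1 (vecA l p q) + vscale (k q) (vF3 (vecA l p (q - 1)))" for q
    by (simp add: k_def)
  have E3: "vE3 l (vecA l p q) = 0" and E2: "vE2 l (vecA l p q) = vscale (betA l p q) (vecA l p (q - 1))" for q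
    using Suc.IH[of q] by (blast, blast)
  have d: "shifted l 3 - 1 - p - q \<noteq> 0" using c3[of "p + q"] by (auto simp: algebra_simps)
  show ?case
  proof (cases q)
    case 0
    hence "k q = 0" by (simp add: k_def betA_0)
    thus ?thesis using 0 E3[of 0] E2[of 0]
      by (simp only: rec vscale_0 add_0_right vE3_vF1 vE2_vF1 betA_0 vop_linear simp_thms)
  next
    case (Suc r)
    \<comment> \<open>The F1-term contributes E2 and the F3-term the scalar of H3; the recursion
      coefficient is chosen to make them cancel.\<close>
    have "vE3 l (vecA l (Suc p) q) = vscale (betA l p q) (vecA l p r) + vscale (k q) (vscale (shifted l 3
        - 2 - p - r) (vecA l p r))"
      unfolding rec vop_linear vE3_vF1 E3 E2 weight_commutators(2)[OF vecA_weight] by (simp add: Suc)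
    also have "\<dots> = 0"
      using d by (intro ext) (simp add: vscale_def k_def Suc field_simps)
    finally have 1: "vE3 l (vecA l (Suc p) q) = 0" .
    have d': "shifted l 3 - p - q \<noteq> 0" using c3[of "p + r"] Suc by (auto simp: algebra_simps)
    have "betA l p q * (shifted l 3 - p - q) = q * (shifted l 2 - q) * (shifted l 3 - q)"
      using d' by (simp add: betA_def)
    moreover have "shifted l 3 - Suc p - q = shifted l 3 - 1 - p - q" by simp
    ultimately have bS: "betA l (Suc p) q = betA l p q * (shifted l 3 - p - q) / (shifted l 3 - 1 - p - q)"
      by (simp only: betA_def)
    \<comment> \<open>With r = q - 1, \<open>b\<close> and \<open>kk\<close> match the coefficients
      of F1 \<open>vecA l p r\<close> and of F3 \<open>vecA l p (r - 1)\<close> with the recursion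
      for \<open>vecA l (Suc p) r\<close>.\<close>
    have b: "betA l (Suc p) q = betA l p q - k q"
      using d unfolding bS k_def by (simp add: field_simps)
    have e: "shifted l 3 - 1 - p - r = shifted l 3 - p - q" using Suc by simp
    have kk: "betA l (Suc p) q * k r = k q * betA l p r"
      unfolding bS k_def e using d' by simp
    have "vE2 l (vecA l (Suc p) q) = vF1 (vscale (betA l p q) (vecA l p r))
        + vscale (k q) (vF3 (vscale (betA l p r) (vecA l p (r - 1))) - vF1 (vecA l p r))"
      unfolding rec vop_linear vE2_vF1 vE2_vF3 E2 by (simp add: Suc vop_linear)
    also have "\<dots> = vscale (betA l (Suc p) q) (vecA l (Suc p) r)"
      unfolding rec vop_linear vscale_simps kk unfolding b
      by (intro ext) (simp add: vscale_def algebra_simps)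
    finally show ?thesis using 1 unfolding Suc diff_Suc_1 by blast
  qed
qed

text \<open>Because E3 = [E2, E1], the operators E1 and E2 commute on the kernel of E3, and this
  kernel is stable under E1 since E3 commutes with E1.\<close>

lemma vE1_funpow_kernel:
  assumes "vE3 l f = 0"
  shows "vE3 l ((vE1 l ^^ a) f) = 0" "vE2 l ((vE1 l ^^ a) f) = (vE1 l ^^ a) (vE2 l f)"
proof -
  show 1: "vE3 l ((vE1 l ^^ a) f) = 0" for a
    by (induction a) (simp_all only: funpow.simps comp_apply id_apply assms vE3_vE1 vop_linear)
  have comm: "vE2 l (vE1 l g) = vE1 l (vE2 l g)" if "vE3 l g = 0" for g
    using that unfolding vE3_def by simp
  show "vE2 l ((vE1 l ^^ a) f) = (vE1 l ^^ a) (vE2 l f)"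
    by (induction a) (simp_all add: comm[OF 1])
qed

lemma bracket_kernel:
  assumes "vE3 l f = 0" "b > 0"
  shows "bracket l a b c f = 0"
proof -
  obtain b' where "b = Suc b'" using assms by (cases b) auto
  hence "(vE3 l ^^ b) ((vE1 l ^^ a) f) = (vE3 l ^^ b') (vE3 l ((vE1 l ^^ a) f))" by (simp add: funpow_swap1)
  also have "\<dots> = 0" unfolding vE1_funpow_kernel[OF assms(1)] vlinearD[OF vlinear_funpow[OF vlinear_ops(6)]] ..
  finally show ?thesis unfolding bracket_def
    by (simp only: vlinearD[OF vlinear_funpow[OF vlinear_ops(5)]] zero_fun_apply)
qed

lemma vecA_0_right: "vecA l p 0 = basis_vec p 0 0"
  by (induction p) (simp_all add: betA_0 vscale_0 vF_basis_vec)

text \<open>E3 kills the vector, so only the summand with F3-exponent 0 survives, where its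
  coordinate is 1. Then E2 passes E1^p, each E2 contributes a \<open>betA\<close> and lowers q, and
  F1^p|lambda> remains.\<close>

lemma form_vecA:
  assumes c3: "\<And>n. shifted l 3 \<noteq> real (Suc n)"
  shows "form l p q (vecA l p q) (vecA l p q)
    = (\<Prod>j<q. betA l p (Suc j)) * (\<Prod>i<p. real (Suc i) * (shifted l 1 - Suc i))"
proof -
  note rel = vecA_relations[OF c3]
  have "form l p q (vecA l p q) (vecA l p q) = (\<Sum>i\<in>{0}. vecA l p q (p - i) i (q - i) * bracket l (p
      - i) i (q - i) (vecA l p q))"
    unfolding form_def
    by (rule sum.mono_neutral_right) (use rel in \<open>auto simp: bracket_kernel\<close>)
  also have "\<dots> = (vE2 l ^^ q) ((vE1 l ^^ p) (vecA l p q)) 0 0 0"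
    by (simp add: vecA_leading bracket_def)
  also have "(vE2 l ^^ q) ((vE1 l ^^ p) (vecA l p q))
      = vscale (\<Prod>j<q. betA l p (Suc j)) ((vE1 l ^^ p) (vecA l p 0))" for q
  proof (induction q)
    case 0
    show ?case by (intro ext) (simp add: vscale_def)
  next
    case (Suc q)
    have r: "vE3 l (vecA l p (Suc q)) = 0" "vE2 l (vecA l p (Suc q)) = vscale (betA l p (Suc q)) (vecA l p q)"
      using rel[of p "Suc q"] by simp_all
    have "(vE2 l ^^ Suc q) ((vE1 l ^^ p) (vecA l p (Suc q)))
        = (vE2 l ^^ q) (vE2 l ((vE1 l ^^ p) (vecA l p (Suc q))))"
      by (simp add: funpow_swap1)
    also have "\<dots> = vscale (betA l p (Suc q)) ((vE2 l ^^ q) ((vE1 l ^^ p) (vecA l p q)))"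
      unfolding vE1_funpow_kernel[OF r(1)] r(2) vlinearD[OF vlinear_funpow[OF vlinear_ops(4)]]
        vlinearD[OF vlinear_funpow[OF vlinear_ops(5)]] ..
    finally show ?case by (simp add: Suc.IH vscale_simps mult_ac)
  qed
  finally show ?thesis
    by (simp only: vecA_0_right E_power_basis_vec vscale_simps) (simp add: vscale_def basis_vec_def)
qed

text \<open>The sign of the norm of F3^k \<open>vecA l p q\<close>. The third sign in the middle
  product is the denominator of \<open>betA\<close>; the last product is the ladder factor of
  alpha_3.\<close>

definition signA :: "real \<Rightarrow> real \<Rightarrow> real \<Rightarrow> nat \<Rightarrow> nat \<Rightarrow> nat \<Rightarrow> real" where
  "signA c1 c2 c3 p q k = (\<Prod>i<p. sgn (c1 - real (Suc i)))
     * (\<Prod>j<q. sgn (c2 - real (Suc j)) * sgn (c3 - real (Suc j)) * sgn (c3 - real p - real (Suc j)))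
     * (\<Prod>i<k. sgn (c3 - 2 - real p - real q - real i))"

lemma sgn_prod: "sgn (\<Prod>i\<in>A. f i) = (\<Prod>i\<in>A. sgn (f i :: real))"
  by (induction A rule: infinite_finite_induct) (simp_all add: sgn_mult)

lemma sgn_divide_mult: "sgn (a / b) = sgn a * sgn (b::real)"
  by (auto simp: sgn_if zero_less_divide_iff divide_less_0_iff)

text \<open>The basis consists of F3^k \<open>vecA l (m1 - k) (m2 - k)\<close>. Orthogonality comes
  from the ladder, and the coordinate matrix is lower triangular with unit diagonal because F3^k
  raises the F3-exponent by k.\<close>

theorem sig_gram_A:
  assumes c3: "\<And>n. shifted l 3 \<noteq> real (Suc n)"
  shows "real_of_int (sig (gram l m1 m2))
    = (\<Sum>k\<le>min m1 m2. signA (shifted l 1) (shifted l 2) (shifted l 3) (m1 - k) (m2 - k) k)"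
proof -
  define u where "u k = (vF3 ^^ k) (vecA l (m1 - k) (m2 - k))" for k
  have E3: "vE3 l (vecA l p q) = 0" for p q using vecA_relations[OF c3] by blast
  note lad = vF3_ladder[OF vecA_weight E3]
  have wt: "has_weight m1 m2 (u k)" if "k \<le> min m1 m2" for k
    using has_weight_funpow(2)[OF vecA_weight[of "m1 - k" "m2 - k" l], of k] that by (simp add: u_def)
  have form: "form l m1 m2 (u k) g = form l (m1 - k) (m2 - k) (vecA l (m1 - k) (m2 - k)) ((vE3 l ^^ k) g)"
    if "k \<le> min m1 m2" for k g
    using form_vF3_funpow[of l "m1 - k" k "m2 - k" "vecA l (m1 - k) (m2 - k)" g] that by (simp add: u_def)
  have orth: "form l m1 m2 (u k) (u k') = 0" if "k' < k" "k \<le> min m1 m2" for k k'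
    unfolding form[OF that(2)] unfolding u_def[of k'] lad(2)[OF that(1)] form_linear ..
  define P where "P = mat (min m1 m2 + 1) (min m1 m2 + 1) (\<lambda>(i, k). u k (m1 - i) i (m2 - i))"
  have P: "P $$ (i, k) = (if i < k then 0 else vecA l (m1 - k) (m2 - k) (m1 - i) (i - k) (m2 - i))"
    if "i < min m1 m2 + 1" "k < min m1 m2 + 1" for i k
    using that by (simp add: P_def u_def vF_funpow_apply)
  have "det P = prod_list (diag_mat P)"
    by (rule det_lower_triangular[of "min m1 m2 + 1"]) (auto simp: P, simp add: P_def)
  also have "diag_mat P = replicate (min m1 m2 + 1) 1"
  proof (rule nth_equalityI)
    have dim: "dim_row P = min m1 m2 + 1" by (simp add: P_def)
    show "length (diag_mat P) = length (replicate (min m1 m2 + 1) (1::real))" by (simp add: diag_mat_def dim)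
    fix i assume "i < length (diag_mat P)"
    hence i: "i < min m1 m2 + 1" by (simp add: diag_mat_def dim)
    show "diag_mat P ! i = replicate (min m1 m2 + 1) 1 ! i"
      unfolding nth_replicate[OF i] using P[OF i i] i by (simp add: diag_mat_def dim vecA_leading del: upt_Suc)
  qed
  finally have "det P \<noteq> 0" by simp
  hence "real_of_int (sig (gram l m1 m2)) = (\<Sum>k\<le>min m1 m2. sgn (form l m1 m2 (u k) (u k)))"
    unfolding P_def by (intro sig_gram_eq_sum_sgn wt orth)
  also have "\<dots> = (\<Sum>k\<le>min m1 m2. signA (shifted l 1) (shifted l 2) (shifted l 3) (m1 - k) (m2 - k) k)"
  proof (rule sum.cong[OF refl])
    fix k assume "k \<in> {..min m1 m2}"
    hence k: "k \<le> min m1 m2" by simp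
    show "sgn (form l m1 m2 (u k) (u k)) = signA (shifted l 1) (shifted l 2) (shifted l 3) (m1 - k) (m2 - k) k"
      unfolding form[OF k] unfolding u_def lad(1) form_linear form_vecA[OF c3]
      by (simp only: signA_def sgn_mult sgn_prod betA_def sgn_divide_mult prod.distrib mult_ac)
        (simp add: prod.distrib mult_ac)
  qed
  finally show ?thesis .
qed

section \<open>The basis adapted to alpha_1\<close>

text \<open>
  \<open>vecB l p q\<close> is the vector \<open>F\<^sub>3\<^sup>q F\<^sub>2\<^sup>p|\<lambda>\<rangle> + F\<^sub>1(\<dots>)\<close> killed by \<open>E\<^sub>1\<close>.  These vectors are stable under \<open>F\<^sub>2\<close>
  (scalar \<open>gamB\<close>), while \<open>E\<^sub>2\<close> leaves a component in the image of \<open>F\<^sub>1\<close> (coefficient \<open>bB\<close>).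
\<close>
definition gamB :: "wt \<Rightarrow> nat \<Rightarrow> nat \<Rightarrow> real" where
  "gamB l p q = (shifted l 1 + p + 1) / (shifted l 1 + p - q + 1)"

definition bB :: "wt \<Rightarrow> nat \<Rightarrow> nat \<Rightarrow> real" where
  "bB l p q = - (q * (shifted l 3 - q) * (shifted l 1 - q) / ((shifted l 1 + p - q) * (shifted l 1 + p
      - q + 1)))"

fun vecB :: "wt \<Rightarrow> nat \<Rightarrow> nat \<Rightarrow> vvec" where
  "vecB l p 0 = basis_vec 0 0 p"
| "vecB l p (Suc q) = vF3 (vecB l p q) + vscale (- gamB l p q / (shifted l 1 + p - q)) (vF1 (vecB l (Suc p) q))"

lemma vecB_weight: "has_weight q (p + q) (vecB l p q)"
proof (induction q arbitrary: p)
  case 0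
  show ?case using has_weight_basis_vec[of 0 0 p] by simp
next
  case (Suc q)
  show ?case unfolding vecB.simps
    using has_weight_ops(1,3)[OF Suc.IH, of p] has_weight_ops(1)[OF Suc.IH, of "Suc p"]
    by (intro has_weight_ops(4,5)) simp_all
qed

lemma vecB_leading: "vecB l p q 0 q p = 1"
  by (induction q arbitrary: p) (simp_all add: basis_vec_def vF1_def vF3_def vscale_def)

lemma vF2_vF1: "vF2 (vF1 f) = vF1 (vF2 f) - vF3 f"
  by (intro ext) (simp add: vF3_commutator)

text \<open>All three relations go through one induction on q: as [E1, F3] = F2, vanishing under E1
  uses the F2-scalar. The denominators are c1 plus integers of either sign, hence the nonintegrality
  of c1.\<close>

lemma vecB_relations:
  assumes c1: "\<And>n. shifted l 1 \<noteq> of_int n"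
  shows "vE1 l (vecB l p q) = 0 \<and> vF2 (vecB l p q) = vscale (gamB l p q) (vecB l (Suc p) q)
    \<and> vE2 l (vecB l p q) = vscale (p * (shifted l 2 - p)) (vecB l (p
        - 1) q) + vscale (bB l p q) (vF1 (vecB l p (q - 1)))"
proof (induction q arbitrary: p)
  case 0
  have "gamB l p 0 = 1" using c1[of "- int p - 1"] by (simp add: gamB_def)
  moreover have "bB l p 0 = 0" by (simp add: bB_def)
  ultimately show ?case by (simp only: vecB.simps E_basis_vec vF_basis_vec vscale_simps vscale_0 add_0_right simp_thms)
next
  case (Suc q)
  define k where "k p q = - gamB l p q / (shifted l 1 + p - q)" for p q
  have rec: "vecB l p (Suc q) = vF3 (vecB l p q) + vscale (k p q) (vF1 (vecB l (Suc p) q))" for p q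
    by (simp add: k_def)
  have E1: "vE1 l (vecB l p q) = 0" and F2: "vF2 (vecB l p q) = vscale (gamB l p q) (vecB l (Suc p) q)"
    and E2: "vE2 l (vecB l p q) = vscale (p * (shifted l 2 - p)) (vecB l (p
        - 1) q) + vscale (bB l p q) (vF1 (vecB l p (q - 1)))" for p
    using Suc.IH[of p] by (blast, blast, blast)
  have d: "shifted l 1 + real p - real q \<noteq> 0" for p q
    using c1[of "int q - int p"] by (auto simp: algebra_simps)
  have d1: "shifted l 1 + real p - real q + 1 \<noteq> 0" for p q
    using c1[of "int q - int p - 1"] by (auto simp: algebra_simps)
  have 1: "vE1 l (vecB l p (Suc q)) = 0"
  proof -
    have "vE1 l (vecB l p (Suc q)) = vscale (gamB l p q) (vecB l (Suc p) q)
        + vscale (k p q) (vscale (shifted l 1 - 1 - 2 * real q + real (Suc p + q)) (vecB l (Suc p) q))"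
      unfolding rec vop_linear vE1_vF3 E1 F2 weight_commutators(1)[OF vecB_weight] by simp
    also have "\<dots> = 0"
      using d[of p q] by (intro ext) (simp add: vscale_def k_def field_simps)
    finally show ?thesis .
  qed
  \<comment> \<open>\<open>g\<close> and \<open>gk\<close> are the coefficient conditions under
    which F2 \<open>vecB l p (Suc q)\<close> is a multiple of
    \<open>vecB l (Suc p) (Suc q)\<close>.\<close>
  have g: "gamB l p (Suc q) = gamB l p q - k p q" for p
  proof -
    have "gamB l p q - k p q = gamB l p q * (shifted l 1 + p - q + 1) / (shifted l 1 + p - q)"
      using d[of p q] by (simp add: k_def field_simps)
    also have "gamB l p q * (shifted l 1 + p - q + 1) = shifted l 1 + p + 1"
      using d1[of p q] by (simp add: gamB_def)
    finally show ?thesis by (simp add: gamB_def algebra_simps)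
  qed
  have gk: "k p q * gamB l (Suc p) q = gamB l p (Suc q) * k (Suc p) q" for p
  proof -
    have gS: "gamB l p (Suc q) = gamB l p q * (shifted l 1 + p - q + 1) / (shifted l 1 + p - q)"
      unfolding g using d[of p q] by (simp add: k_def field_simps)
    have e: "shifted l 1 + Suc p - q = shifted l 1 + p - q + 1" by simp
    show ?thesis unfolding gS k_def e using d1[of p q] by simp
  qed
  have 2: "vF2 (vecB l p (Suc q)) = vscale (gamB l p (Suc q)) (vecB l (Suc p) (Suc q))"
  proof -
    have "vF2 (vecB l p (Suc q)) = vF3 (vscale (gamB l p q) (vecB l (Suc p) q))
        + vscale (k p q) (vF1 (vscale (gamB l (Suc p) q) (vecB l (Suc (Suc p)) q)) - vF3 (vecB l (Suc p) q))"
      unfolding rec vop_linear vF2_vF3 vF2_vF1 F2 ..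
    also have "\<dots> = vscale (gamB l p (Suc q)) (vecB l (Suc p) (Suc q))"
      unfolding rec vop_linear vscale_simps gk[symmetric] unfolding g
      by (intro ext) (simp add: vscale_def algebra_simps)
    finally show ?thesis .
  qed
  have 3: "vE2 l (vecB l p (Suc q)) = vscale (p * (shifted l 2 - p)) (vecB l (p - 1) (Suc q))
      + vscale (bB l p (Suc q)) (vF1 (vecB l p q))"
  proof -
    have E: "vE2 l (vecB l p (Suc q)) = vF3 (vscale (p * (shifted l 2 - p)) (vecB l (p
        - 1) q) + vscale (bB l p q) (vF1 (vecB l p (q - 1))))
        - vF1 (vecB l p q)
        + vscale (k p q) (vF1 (vscale (Suc p * (shifted l 2
            - Suc p)) (vecB l p q) + vscale (bB l (Suc p) q) (vF1 (vecB l (Suc p) (q - 1)))))"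
      unfolding rec vop_linear vE2_vF3 vE2_vF1 E2 by simp
    \<comment> \<open>The recursion trades F3 \<open>vecB l (p - 1) q\<close> for
      \<open>vecB l (p - 1) (Suc q)\<close> and an F1-term; at p = 0 the factor p hides the
      truncated p - 1.\<close>
    have P: "vscale (p * (shifted l 2 - p)) (vF3 (vecB l (p - 1) q))
      = vscale (p * (shifted l 2 - p)) (vecB l (p - 1) (Suc q)) - vscale (p * (shifted l 2 - p) * k (p
          - 1) q) (vF1 (vecB l p q))"
    proof (cases p)
      case 0
      thus ?thesis by (intro ext) (simp add: vscale_def)
    next
      case (Suc p')
      show ?thesis unfolding rec Suc by (intro ext) (simp add: vscale_def algebra_simps)
    qed
    \<comment> \<open>The same exchange one step lower in q merges two terms into a multiple of F1
      \<open>vecB l p q\<close>; at q = 0 both \<open>bB\<close> factors vanish.\<close>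
    have Q: "vscale (bB l p q) (vF3 (vF1 (vecB l p (q
        - 1)))) + vscale (k p q * bB l (Suc p) q) (vF1 (vF1 (vecB l (Suc p) (q - 1))))
      = vscale (bB l p q) (vF1 (vecB l p q))"
    proof (cases q)
      case 0
      thus ?thesis by (intro ext) (simp add: vscale_def bB_def)
    next
      case (Suc r)
      have "bB l p q * k p r = k p q * bB l (Suc p) q"
      proof -
        define x where "x = shifted l 1 + p - q"
        have nz: "x \<noteq> 0" "x + 1 \<noteq> 0" "x + 2 \<noteq> 0"
          using d[of p q] d1[of p q] d1[of "Suc p" q] by (simp_all add: x_def algebra_simps)
        have e: "shifted l 1 + p - r = x + 1" "shifted l 1 + Suc p - q = x + 1" by (simp_all add: x_def Suc)
        have "x + 1 + 1 = x + 2" by simp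
        thus ?thesis unfolding bB_def k_def gamB_def e unfolding x_def[symmetric] using nz
          by (simp add: divide_simps)
      qed
      thus ?thesis unfolding Suc rec[of p r] diff_Suc_1 vop_linear vF1_vF3
        by (intro ext) (simp add: vscale_def algebra_simps)
    qed
    \<comment> \<open>After \<open>P\<close> and \<open>Q\<close> only the coefficients of F1
      \<open>vecB l p q\<close> remain to be compared.\<close>
    have coef: "bB l p (Suc q) = bB l p q - 1 + k p q * (Suc p * (shifted l 2 - Suc p)) - p * (shifted l 2
        - p) * k (p - 1) q"
    proof -
      define x where "x = shifted l 1 + p - q"
      have nz: "x \<noteq> 0" "x + 1 \<noteq> 0" "x - 1 \<noteq> 0"
        using d[of p q] d1[of p q] d[of p "Suc q"] by (simp_all add: x_def algebra_simps)
      have "p * (shifted l 2 - p) * k (p - 1) q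
          = - real p * (shifted l 2 - p) * (shifted l 1 + p) / (x * (x - 1))"
      proof (cases p)
        case (Suc p')
        have e: "shifted l 1 + p' - q = x - 1" "shifted l 1 + p' + 1 = shifted l 1 + p"
            by (simp_all add: x_def Suc)
        have "k (p - 1) q = - ((shifted l 1 + p) / (x - 1 + 1)) / (x - 1)"
          unfolding Suc diff_Suc_1 k_def gamB_def e using Suc by simp
        thus ?thesis using nz by simp
      qed simp
      moreover have "k p q * (Suc p * (shifted l 2 - Suc p))
          = - (shifted l 1 + p + 1) * (p + 1) * (shifted l 2 - p - 1) / ((x + 1) * x)"
      proof -
        have e: "shifted l 2 - Suc p = shifted l 2 - p - 1" "Suc p = p + 1" by simp_all
        have "- (A / B) / x * (C * D) = - A * C * D / (B * x)" for A B C D :: real by simp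
        thus ?thesis unfolding k_def gamB_def x_def[symmetric] e(1) unfolding e(2) .
      qed
      moreover have "bB l p (Suc q) = - ((q + 1) * (shifted l 3 - q - 1) * (shifted l 1 - q - 1) / ((x
          - 1) * x))"
      proof -
        have e: "shifted l 1 + p - Suc q = x - 1" by (simp add: x_def)
        show ?thesis unfolding bB_def e by (simp add: algebra_simps)
      qed
      moreover have "bB l p q = - (q * (shifted l 3 - q) * (shifted l 1 - q) / (x * (x + 1)))"
        unfolding bB_def x_def[symmetric] ..
      moreover have "- ((q + 1) * (shifted l 3 - q - 1) * (shifted l 1 - q - 1) / ((x - 1) * x))
        = - (q * (shifted l 3 - q) * (shifted l 1 - q) / (x * (x + 1))) - 1
          + - (shifted l 1 + p + 1) * (p + 1) * (shifted l 2 - p - 1) / ((x + 1) * x)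
          - - real p * (shifted l 2 - p) * (shifted l 1 + p) / (x * (x - 1))"
      proof -
        \<comment> \<open>Clearing denominators leaves a polynomial identity in x, P, Q, y, which
          rests on c3 = c1 + c2.\<close>
        define P Q y where "P = real p" and "Q = real q" and "y = shifted l 2"
        have c: "shifted l 1 = x - P + Q" "shifted l 3 = x - P + Q + y"
            by (simp_all add: x_def P_def Q_def y_def shifted_simps)
        have "(Q + 1) * (shifted l 3 - Q - 1) * (shifted l 1 - Q - 1) * (x + 1)
          = Q * (shifted l 3 - Q) * (shifted l 1 - Q) * (x - 1) + x * (x + 1) * (x - 1)
            + (shifted l 1 + P + 1) * (P + 1) * (y - P - 1) * (x - 1)
            - P * (y - P) * (shifted l 1 + P) * (x + 1)"
          unfolding c by (simp add: algebra_simps)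
        thus ?thesis using nz unfolding of_nat_add of_nat_1 P_def[symmetric] Q_def[symmetric] y_def[symmetric]
          by (simp add: divide_simps) (simp add: algebra_simps)
      qed
      ultimately show ?thesis by simp
    qed
    have R: "vE2 l (vecB l p (Suc q)) = vscale (p * (shifted l 2 - p)) (vF3 (vecB l (p - 1) q))
        + (vscale (bB l p q) (vF3 (vF1 (vecB l p (q
            - 1)))) + vscale (k p q * bB l (Suc p) q) (vF1 (vF1 (vecB l (Suc p) (q - 1)))))
        + vscale (k p q * (Suc p * (shifted l 2 - Suc p)) - 1) (vF1 (vecB l p q))"
      unfolding E vop_linear by (intro ext) (simp add: vscale_def algebra_simps)
    show ?thesis unfolding R P Q coef by (intro ext) (simp add: vscale_def algebra_simps del: vecB.simps)
  qed
  show ?case using 1 2 3 unfolding diff_Suc_1 by blast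
qed

text \<open>E1 kills the vector, so of E3 = E2 E1 - E1 E2 only the second term acts. There E1 kills
  the first component of the E2-image and turns the F1-component into a scalar of H1, which cancels
  one denominator of \<open>bB\<close>.\<close>

lemma vE3_vecB:
  assumes c1: "\<And>n. shifted l 1 \<noteq> of_int n"
  shows "vE3 l (vecB l p (Suc q)) = vscale (Suc q * (shifted l 3 - Suc q) * (shifted l 1
      - Suc q) / (shifted l 1 + p - q)) (vecB l p q)"
proof -
  have E1: "vE1 l (vecB l p q) = 0"
    and E2: "vE2 l (vecB l p q) = vscale (p * (shifted l 2 - p)) (vecB l (p
        - 1) q) + vscale (bB l p q) (vF1 (vecB l p (q - 1)))" for p q
    using vecB_relations[OF c1, of p q] by blast+
  have "vE3 l (vecB l p (Suc q)) = vE2 l 0 - vE1 l (vscale (p * (shifted l 2 - p)) (vecB l (p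
      - 1) (Suc q)) + vscale (bB l p (Suc q)) (vF1 (vecB l p q)))"
    unfolding vE3_def E1 E2 by simp
  also have "\<dots> = vscale (- bB l p (Suc q) * (shifted l 1 - 1 - 2 * real q + real (p + q))) (vecB l p q)"
    unfolding vop_linear weight_commutators(1)[OF vecB_weight] E1 by (intro ext) (simp add: vscale_def)
  also have "- bB l p (Suc q) * (shifted l 1 - 1 - 2 * real q + real (p + q))
      = Suc q * (shifted l 3 - Suc q) * (shifted l 1 - Suc q) / (shifted l 1 + p - q)"
  proof -
    have nz: "shifted l 1 + real p - real q - 1 \<noteq> 0"
      using c1[of "int q - int p + 1"] by (auto simp: algebra_simps)
    have e: "shifted l 1 + p - Suc q = shifted l 1 + p - q - 1"
        "shifted l 1 - 1 - 2 * real q + real (p + q) = shifted l 1 + p - q - 1"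
      "shifted l 1 + p - q - 1 + 1 = shifted l 1 + p - q" by simp_all
    show ?thesis unfolding bB_def e using nz by simp
  qed
  finally show ?thesis .
qed

text \<open>E1 kills the vector, so only the summand with F1-exponent 0 survives; E3 then lowers q
  step by step until F2^p|lambda> remains.\<close>

lemma form_vecB:
  assumes c1: "\<And>n. shifted l 1 \<noteq> of_int n"
  shows "form l q (p + q) (vecB l p q) (vecB l p q)
    = (\<Prod>j<q. Suc j * (shifted l 3 - Suc j) * (shifted l 1 - Suc j) / (shifted l 1 + p
        - j)) * (\<Prod>i<p. real (Suc i) * (shifted l 2 - Suc i))"
proof -
  have E1: "vE1 l (vecB l p q) = 0" for q using vecB_relations[OF c1, of p q] by blast
  have zero: "bracket l a b c (vecB l p q) = 0" if a: "a > 0" for a b c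
  proof -
    obtain a' where "a = Suc a'" using a by (cases a) auto
    hence "(vE1 l ^^ a) (vecB l p q) = (vE1 l ^^ a') (vE1 l (vecB l p q))" by (simp add: funpow_swap1)
    also have "\<dots> = 0" unfolding E1 vlinearD[OF vlinear_funpow[OF vlinear_ops(4)]] ..
    finally show ?thesis unfolding bracket_def
      by (simp only: vlinearD[OF vlinear_funpow[OF vlinear_ops(5)]]
          vlinearD[OF vlinear_funpow[OF vlinear_ops(6)]] zero_fun_apply)
  qed
  have "form l q (p + q) (vecB l p q) (vecB l p q)
    = (\<Sum>i\<in>{q}. vecB l p q (q - i) i (p + q - i) * bracket l (q - i) i (p + q - i) (vecB l p q))"
    unfolding form_def
    by (rule sum.mono_neutral_right) (use zero in auto)
  also have "\<dots> = (vE2 l ^^ p) ((vE3 l ^^ q) (vecB l p q)) 0 0 0"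
    by (simp add: vecB_leading bracket_def)
  also have "(vE3 l ^^ q) (vecB l p q) = vscale (\<Prod>j<q. Suc j * (shifted l 3 - Suc j) * (shifted l 1
      - Suc j) / (shifted l 1 + p - j)) (vecB l p 0)" for q
  proof (induction q)
    case 0
    show ?case by (intro ext) (simp add: vscale_def)
  next
    case (Suc q)
    have "(vE3 l ^^ Suc q) (vecB l p (Suc q)) = (vE3 l ^^ q) (vE3 l (vecB l p (Suc q)))"
      by (simp add: funpow_swap1)
    thus ?case unfolding vE3_vecB[OF c1] vlinearD[OF vlinear_funpow[OF vlinear_ops(6)]]
        Suc.IH vscale_simps prod.lessThan_Suc
      by (simp only: mult.commute)
  qed
  finally show ?thesis
    by (simp only: vecB.simps vlinearD[OF vlinear_funpow[OF vlinear_ops(5)]] E_power_basis_vec vscale_simps)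
      (simp add: vscale_def basis_vec_def)
qed

text \<open>The sign of the norm of F1^k \<open>vecB l p q\<close>, with the denominators c1 + p - j
  counted as factors.\<close>

definition signB :: "real \<Rightarrow> real \<Rightarrow> real \<Rightarrow> nat \<Rightarrow> nat \<Rightarrow> nat \<Rightarrow> real" where
  "signB c1 c2 c3 p q k = (\<Prod>i<k. sgn (c1 - 1 + real p - real q - real i))
     * (\<Prod>j<q. sgn (c3 - real (Suc j)) * sgn (c1 - real (Suc j)) * sgn (c1 + real p - real j))
     * (\<Prod>i<p. sgn (c2 - real (Suc i)))"

text \<open>The basis consists of F1^(m1 - q) \<open>vecB l (m2 - q) q\<close>; its coordinate
  matrix is upper triangular with unit diagonal.\<close>

theorem sig_gram_B:
  assumes c1: "\<And>n. shifted l 1 \<noteq> of_int n"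
  shows "real_of_int (sig (gram l m1 m2))
    = (\<Sum>q\<le>min m1 m2. signB (shifted l 1) (shifted l 2) (shifted l 3) (m2 - q) q (m1 - q))"
proof -
  define u where "u q = (vF1 ^^ (m1 - q)) (vecB l (m2 - q) q)" for q
  have E1: "vE1 l (vecB l p q) = 0" for p q using vecB_relations[OF c1, of p q] by blast
  note lad = vF1_ladder[OF vecB_weight E1]
  have wt: "has_weight m1 m2 (u q)" if "q \<le> min m1 m2" for q
    using has_weight_funpow(1)[OF vecB_weight[of q "m2 - q" l], of "m1 - q"] that by (simp add: u_def)
  have form: "form l m1 m2 (u q) g = form l q (m2 - q + q) (vecB l (m2 - q) q) ((vE1 l ^^ (m1 - q)) g)"
    if "q \<le> min m1 m2" for q g
    using form_vF1_funpow[of l q "m1 - q" m2 "vecB l (m2 - q) q" g] that by (simp add: u_def)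
  have orth: "form l m1 m2 (u k) (u k') = 0" if "k' < k" "k \<le> min m1 m2" for k k'
  proof -
    have "k \<le> m1" using that by simp
    hence k': "k' \<le> min m1 m2" "m1 - k < m1 - k'" using that by (simp, linarith)
    \<comment> \<open>A smaller index means a higher power of F1, so the arguments are exchanged to
      let the larger power of E1 annihilate.\<close>
    have "form l m1 m2 (u k) (u k') = form l m1 m2 (u k') (u k)"
      by (intro form_sym wt that k')
    also have "\<dots> = 0"
      unfolding form[OF k'(1)] unfolding u_def[of k] lad(2)[OF k'(2)] form_linear ..
    finally show ?thesis .
  qed
  define P where "P = mat (min m1 m2 + 1) (min m1 m2 + 1) (\<lambda>(i, k). u k (m1 - i) i (m2 - i))"
  have dim: "dim_row P = min m1 m2 + 1" by (simp add: P_def)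
  have P: "P $$ (i, k) = (if k < i then 0 else vecB l (m2 - k) k (k - i) i (m2 - i))"
    if "i < min m1 m2 + 1" "k < min m1 m2 + 1" for i k
    using that by (auto simp: P_def u_def vF_funpow_apply)
  have "det P = prod_list (diag_mat P)"
    by (rule det_upper_triangular[of _ "min m1 m2 + 1"]) (auto simp: P dim, simp add: P_def)
  also have "diag_mat P = replicate (min m1 m2 + 1) 1"
  proof (rule nth_equalityI)
    show "length (diag_mat P) = length (replicate (min m1 m2 + 1) (1::real))" by (simp add: diag_mat_def dim)
    fix i assume "i < length (diag_mat P)"
    hence i: "i < min m1 m2 + 1" by (simp add: diag_mat_def dim)
    show "diag_mat P ! i = replicate (min m1 m2 + 1) 1 ! i"
      unfolding nth_replicate[OF i] using P[OF i i] i by (simp add: diag_mat_def dim vecB_leading del: upt_Suc)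
  qed
  finally have "det P \<noteq> 0" by simp
  hence "real_of_int (sig (gram l m1 m2)) = (\<Sum>k\<le>min m1 m2. sgn (form l m1 m2 (u k) (u k)))"
    unfolding P_def by (intro sig_gram_eq_sum_sgn wt orth)
  also have "\<dots> = (\<Sum>q\<le>min m1 m2. signB (shifted l 1) (shifted l 2) (shifted l 3) (m2 - q) q (m1 - q))"
  proof (rule sum.cong[OF refl])
    fix q assume "q \<in> {..min m1 m2}"
    hence q: "q \<le> min m1 m2" by simp
    have e: "shifted l 1 - 1 - real (2 * q) + real (m2 - q + q) - real i
        = shifted l 1 - 1 + real (m2 - q) - real q - real i" for i
      by simp
    show "sgn (form l m1 m2 (u q) (u q)) = signB (shifted l 1) (shifted l 2) (shifted l 3) (m2 - q) q (m1 - q)"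
      unfolding form[OF q] unfolding u_def lad(1) form_linear form_vecB[OF c1] e
        signB_def sgn_mult sgn_prod sgn_divide_mult
      by (simp only: of_nat_0_less_iff sgn_1_pos sgn_pos zero_less_Suc mult_1_left mult.assoc)
  qed
  finally show ?thesis .
qed

section \<open>The generating function of the signs\<close>

definition eps :: "nat \<Rightarrow> int" where "eps n = (-1) ^ n"

definition chi :: "nat \<Rightarrow> nat \<Rightarrow> int" where
  "chi a n = (if n \<le> a then 1 else eps n * eps a)"

lemma eps_simps: "eps (m + n) = eps m * eps n" "eps (Suc n) = - eps n" "eps 0 = 1"
  "eps n * eps n = 1" "eps n * (eps n * x) = x"
proof -
  show sq: "eps n * eps n = 1" by (simp add: eps_def flip: power_add)
  thus "eps n * (eps n * x) = x" by (metis mult.assoc mult_1)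
qed (simp_all add: eps_def power_add)

lemma chi_le: "n \<le> a \<Longrightarrow> chi a n = 1" and chi_ge: "a \<le> n \<Longrightarrow> chi a n = eps n * eps a"
  by (auto simp: chi_def eps_simps)

lemma chi_square: "chi a n * chi a n = 1" "chi a n * (chi a n * x) = x"
  by (auto simp: chi_def eps_simps mult_ac)

lemma eps_diff: "n \<le> b \<Longrightarrow> eps (b - n) = eps b * eps n"
  by (metis eps_simps(1,5) le_add_diff_inverse2 mult.commute)

text \<open>The left side is that of \<open>sigH_interior\<close> with \<open>psi\<close> unfolded.
  The cases are the positions of (m, n) relative to the antidiagonal m + n = b + 1 and to the lines
  m = a1, n = a2, m = b, n = b.\<close>

lemma sigH_summands_dominant:
  assumes b: "a1 + a2 \<le> b" "b \<le> a1 + a2 + 1" and mn: "1 \<le> m" "1 \<le> n"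
  shows "chi a1 m * chi b m * (chi a2 n * chi b n) * chi b (m + n)
      + chi a1 (m - 1) * chi b (m - 1) * (chi a2 (n - 1) * chi b (n - 1)) * (chi b (m + n
          - 2) * chi b (m + n - 1) * chi b (m + n))
      + (if b + 2 \<le> m + n \<and> m \<le> b \<and> n \<le> b then - 2 * (chi a1 (b - n) * chi b (b - n) * (chi a2 (b
          - m) * chi b (b - m))) else 0)
    = (if m \<le> a1 \<and> n \<le> a2 then 2 else if m \<le> a1 \<or> n \<le> a2 then 0
       else if b < m \<and> b < n then 0 else - 2 * (chi (a1 + a2 + 1) m * chi (a1 + a2 + 1) n))"
proof -
  obtain p where m: "m = Suc p" using mn by (cases m) auto
  obtain q where n: "n = Suc q" using mn by (cases n) auto
  \<comment> \<open>As b is a1 + a2 or a1 + a2 + 1, b - n is at least a1 for n <= a2 and at most a1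
    otherwise.\<close>
  have d1: "chi a1 (b - n) = (if n \<le> a2 then eps b * eps n * eps a1 else 1)" if "n \<le> b"
  proof (cases "n \<le> a2")
    case True
    hence "chi a1 (b - n) = eps (b - n) * eps a1" using b that by (intro chi_ge) simp
    moreover have "eps b = eps (b - n) * eps n" using that by (simp flip: eps_simps)
    ultimately show ?thesis using True by (simp add: eps_simps mult_ac)
  qed (use b that in \<open>simp add: chi_le\<close>)
  have d2: "chi a2 (b - m) = (if m \<le> a1 then eps b * eps m * eps a2 else 1)" if "m \<le> b"
  proof (cases "m \<le> a1")
    case True
    hence "chi a2 (b - m) = eps (b - m) * eps a2" using b that by (intro chi_ge) simp
    moreover have "eps b = eps (b - m) * eps m" using that by (simp flip: eps_simps)
    ultimately show ?thesis using True by (simp add: eps_simps mult_ac)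
  qed (use b that in \<open>simp add: chi_le\<close>)
  have d3: "chi b (b - k) = 1" for k by (simp add: chi_le)
  consider "m + n \<le> b" | "m + n = b + 1" | "b + 2 \<le> m + n" by linarith
  thus ?thesis
  proof cases
    case 1
    thus ?thesis using b 
      by (cases "m \<le> a1"; cases "n \<le> a2"; simp add: m n chi_le chi_ge eps_simps d3 mult_ac)
  next
    case 2
    show ?thesis
    proof (cases "m \<le> a1 \<or> n \<le> a2")
      case True
      thus ?thesis using b 2
        by (cases "m \<le> a1"; cases "n \<le> a2"; simp add: m n chi_le chi_ge eps_simps d3 mult_ac)
    next
      case False
      \<comment> \<open>On the antidiagonal and outside both strips only the corner (a1 + 1, a2 + 1)
        is possible, and only for the larger value of b.\<close>
      hence "p = a1" "q = a2" "b = a1 + a2 + 1" using b 2 m n by auto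
      thus ?thesis by (simp add: m n chi_le chi_ge eps_simps d3 mult_ac)
    qed
  next
    case 3
    thus ?thesis using b 
      by (cases "m \<le> a1"; cases "n \<le> a2"; cases "m \<le> b"; cases "n \<le> b"; simp add: m n chi_le chi_ge eps_simps d1[unfolded n] d2[unfolded m] d3 eps_diff mult_ac)
  qed
qed

text \<open>The counterpart for chambers with c1 negative; those with c2 negative follow by
  exchanging the simple roots.\<close>

lemma sigH_summands_mixed:
  assumes b: "b \<le> a2" and mn: "1 \<le> m" "1 \<le> n"
  shows "chi 0 m * chi b m * (chi a2 n * chi b n) * chi b (m + n)
      + chi 0 (m - 1) * chi b (m - 1) * (chi a2 (n - 1) * chi b (n - 1)) * (chi b (m + n - 2) * chi b (m + n
          - 1) * chi b (m + n))
      + (if b + 2 \<le> m + n \<and> m \<le> b \<and> n \<le> b then - 2 * (chi 0 (b - n) * chi b (b - n) * (chi a2 (b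
          - m) * chi b (b - m))) else 0)
    = (if m \<le> b then (if n \<le> a2 then 0 else 2 * chi a2 n) else if n \<le> b \<or> a2 < n then 0 else 2 * chi b m)"
proof -
  obtain p where m: "m = Suc p" using mn by (cases m) auto
  obtain q where n: "n = Suc q" using mn by (cases n) auto
  have d3: "chi b (b - k) = 1" "chi a2 (b - k) = 1" for k using b by (auto simp: chi_le)
  consider "m + n \<le> b" | "m + n = b + 1" | "b + 2 \<le> m + n" by linarith
  thus ?thesis
  proof cases
    case 1
    thus ?thesis using b by (simp add: m n chi_le chi_ge eps_simps mult_ac)
  next
    case 2
    thus ?thesis using b by (simp add: m n chi_le chi_ge eps_simps mult_ac)
  next
    case 3
    thus ?thesis using b
      by (cases "m \<le> b"; cases "n \<le> b"; cases "n \<le> a2"; simp add: m n chi_le chi_ge eps_simps eps_diff d3 mult_ac)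
  qed
qed

text \<open>
  \<open>sigT\<close> sums the signs of the norms of the basis for \<open>\<alpha>\<^sub>3\<close>, with \<open>chi a n\<close> the sign of
  \<open>(c - 1)\<dots>(c - n)\<close> when \<open>a = max(0, \<lfloor>c\<rfloor>)\<close>; \<open>sigH\<close> is \<open>(1 - x\<^sub>1\<^sup>2 x\<^sub>2\<^sup>2) sigT\<close>.
\<close>
definition psi :: "nat \<Rightarrow> nat \<Rightarrow> nat \<Rightarrow> nat \<Rightarrow> nat \<Rightarrow> int" where
  "psi a1 a2 b p q = chi a1 p * chi b p * (chi a2 q * chi b q)"

definition sigT :: "nat \<Rightarrow> nat \<Rightarrow> nat \<Rightarrow> nat \<Rightarrow> nat \<Rightarrow> int" where
  "sigT a1 a2 b m n = (\<Sum>k\<le>min m n. psi a1 a2 b (m - k) (n - k) *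
     (chi b (m - k + (n - k)) * chi b (m - k + (n - k) + 1) * chi b (m - k + (n - k) + k + 1)))"

definition sigH :: "nat \<Rightarrow> nat \<Rightarrow> nat \<Rightarrow> nat \<Rightarrow> nat \<Rightarrow> int" where
  "sigH a1 a2 b m n = sigT a1 a2 b m n - (if 2 \<le> m \<and> 2 \<le> n then sigT a1 a2 b (m - 2) (n - 2) else 0)"

text \<open>Two steps flip the sign twice beyond b and never before it; only from b - 1 to b + 1 is
  there a single flip.\<close>

lemma chi_step2: "chi b (N + 2) = chi b N + (if N + 1 = b then - 2 else 0)"
proof -
  consider "N + 2 \<le> b" | "N + 1 = b" | "b \<le> N" by linarith
  thus ?thesis by cases (auto simp: chi_le chi_ge eps_simps)
qed

lemma sigH_boundary: "sigH a1 a2 b 0 n = chi a2 n" "sigH a1 a2 b m 0 = chi a1 m"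
  by (simp_all add: sigH_def sigT_def psi_def chi_square chi_le mult_ac)

text \<open>Term k + 2 of \<open>sigT\<close> at (m, n) and term k at (m - 2, n - 2) have the same p
  and q and differ only in the last \<open>chi\<close>, whose argument is shifted by 2. By
  \<open>chi_step2\<close> they cancel except at k = m + n - b - 2; the terms k = 0 and k = 1 have
  no partner.\<close>

lemma sigH_interior:
  assumes mn: "1 \<le> m" "1 \<le> n"
  shows "sigH a1 a2 b m n = psi a1 a2 b m n * chi b (m + n)
      + psi a1 a2 b (m - 1) (n - 1) * (chi b (m + n - 2) * chi b (m + n - 1) * chi b (m + n))
      + (if b + 2 \<le> m + n \<and> m \<le> b \<and> n \<le> b then - 2 * psi a1 a2 b (b - n) (b - m) else 0)"
proof -
  define F where "F k = psi a1 a2 b (m - k) (n - k) *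
     (chi b (m - k + (n - k)) * chi b (m - k + (n - k) + 1) * chi b (m - k + (n - k) + k + 1))" for k
  have F0: "F 0 = psi a1 a2 b m n * chi b (m + n)"
    by (simp add: F_def chi_square)
  have F1: "F (Suc 0) = psi a1 a2 b (m - 1) (n - 1) * (chi b (m + n - 2) * chi b (m + n - 1) * chi b (m + n))"
  proof -
    have "m - 1 + (n - 1) = m + n - 2" "m + n - 2 + 1 = m + n - 1" "m + n - 2 + 1 + 1 = m + n" using mn by auto
    thus ?thesis by (simp only: F_def flip: One_nat_def)
  qed
  show ?thesis
  proof (cases "2 \<le> m \<and> 2 \<le> n")
    case False
    hence "min m n = Suc 0" using mn by auto
    hence "sigT a1 a2 b m n = F 0 + F (Suc 0)" unfolding sigT_def F_def[symmetric] by simp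
    moreover have "sigH a1 a2 b m n = sigT a1 a2 b m n" using False by (auto simp: sigH_def)
    moreover have "\<not> (b + 2 \<le> m + n \<and> m \<le> b \<and> n \<le> b)" using False mn by auto
    ultimately show ?thesis by (simp only: F0 F1 if_False add_0_right)
  next
    case True
    define r where "r = min m n - 2"
    have r: "min m n = Suc (Suc r)" "min (m - 2) (n - 2) = r" using True by (auto simp: r_def)
    have F2: "F (Suc (Suc k)) = psi a1 a2 b (m - 2 - k) (n - 2 - k) *
       (chi b (m - 2 - k + (n - 2 - k)) * chi b (m - 2 - k + (n - 2 - k) + 1) * chi b (m - 2 - k + (n - 2
           - k) + k + 1))
      + (if k = m + n - b - 2 then (if b + 2 \<le> m + n then - 2 * psi a1 a2 b (b - n) (b - m) else 0) else 0)"
      if k: "k \<le> r" for k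
    proof -
      have e: "m - Suc (Suc k) = m - 2 - k" "n - Suc (Suc k) = n - 2 - k" by auto
      define N where "N = m - 2 - k + (n - 2 - k) + k + 1"
      have N: "m - 2 - k + (n - 2 - k) + Suc (Suc k) + 1 = N + 2" by (simp add: N_def)
      have iff: "N + 1 = b \<longleftrightarrow> k = m + n - b - 2 \<and> b + 2 \<le> m + n"
        using k True by (auto simp: N_def r_def)
      show ?thesis
      proof (cases "N + 1 = b")
        case True
        hence kk: "m - 2 - k = b - n" "n - 2 - k = b - m" "m - 2 - k + (n - 2 - k) + 1 \<le> b"
          using k \<open>2 \<le> m \<and> 2 \<le> n\<close> by (auto simp: N_def r_def)
        \<comment> \<open>At the defect the other two \<open>chi\<close> have arguments at most
          b.\<close>
        have "chi b (b - n + (b - m)) = 1" "chi b (b - n + (b - m) + 1) = 1"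
          using kk by (auto simp: chi_le)
        thus ?thesis using True iff unfolding F_def e N chi_step2 N_def[symmetric] unfolding kk(1,2)
          by (simp add: algebra_simps)
      next
        case False
        thus ?thesis using iff unfolding F_def e N chi_step2 N_def[symmetric] by auto
      qed
    qed
    have "sigT a1 a2 b m n = F 0 + (F (Suc 0) + (\<Sum>k\<le>r. F (Suc (Suc k))))"
      unfolding sigT_def r(1) F_def[symmetric] sum.atMost_Suc_shift by simp
    also have "(\<Sum>k\<le>r. F (Suc (Suc k))) = sigT a1 a2 b (m - 2) (n - 2)
        + (\<Sum>k\<le>r. if k = m + n - b - 2 then (if b + 2 \<le> m + n then - 2 * psi a1 a2 b (b - n) (b - m) else 0)
            else 0)"
      unfolding sigT_def r(2) sum.distrib[symmetric] by (rule sum.cong) (simp_all add: F2)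
    also have "(\<Sum>k\<le>r. if k = m + n - b - 2 then (if b + 2 \<le> m + n then - 2 * psi a1 a2 b (b - n) (b - m)
        else 0) else 0)
        = (if b + 2 \<le> m + n \<and> m \<le> b \<and> n \<le> b then - 2 * psi a1 a2 b (b - n) (b - m) else 0)"
      using True by (auto simp: sum.delta r_def)
    finally show ?thesis using True by (simp add: sigH_def F0 F1)
  qed
qed

text \<open>
  Here \<open>b\<close> may be either of \<open>a1 + a2\<close> and \<open>a1 + a2 + 1\<close>, but the signs on the outer blocks are those of
  \<open>chi (a1 + a2 + 1)\<close> in both cases.
\<close>
lemma sigH_dominant:
  assumes "a1 + a2 \<le> b" "b \<le> a1 + a2 + 1"
  shows "sigH a1 a2 b m n = (if m = 0 then chi a2 n else if n = 0 then chi a1 m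
    else if m \<le> a1 \<and> n \<le> a2 then 2 else if m \<le> a1 \<or> n \<le> a2 then 0
    else if b < m \<and> b < n then 0 else - 2 * (chi (a1 + a2 + 1) m * chi (a1 + a2 + 1) n))"
  using sigH_interior[of m n a1 a2 b] sigH_summands_dominant[OF assms, of m n]
  by (cases "m = 0"; cases "n = 0"; simp only: sigH_boundary psi_def if_True if_False) (simp_all add: chi_le)

lemma sigH_mixed:
  assumes "b \<le> a2"
  shows "sigH 0 a2 b m n = (if m = 0 then chi a2 n else if n = 0 then chi 0 m
    else if m \<le> b then (if n \<le> a2 then 0 else 2 * chi a2 n) else if n \<le> b \<or> a2 < n then 0 else 2 * chi b m)"
  using sigH_interior[of m n 0 a2 b] sigH_summands_mixed[OF assms, of m n]
  by (cases "m = 0"; cases "n = 0"; simp only: sigH_boundary psi_def if_True if_False) (simp_all add: chi_le)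

lemma sigT_swap: "sigT a1 a2 b m n = sigT a2 a1 b n m"
  by (simp add: sigT_def psi_def min.commute mult_ac add.commute)

lemma sigH_swap: "sigH a1 a2 b m n = sigH a2 a1 b n m"
  unfolding sigH_def sigT_swap[of a1] by auto

section \<open>Two-variable generating functions as iterated power series\<close>

definition gf :: "bps \<Rightarrow> int fps fps" where
  "gf f = Abs_fps (\<lambda>m. Abs_fps (\<lambda>n. f m n))"

definition Y1 :: "int fps fps" where "Y1 = fps_X"
definition Y2 :: "int fps fps" where "Y2 = fps_const fps_X"

lemma gf_nth: "fps_nth (fps_nth (gf f) m) n = f m n"
  by (simp add: gf_def)

lemma gf_inject: "gf f = gf g \<Longrightarrow> f = g"
  by (intro ext) (metis gf_nth)

lemma gf_badd: "gf (badd f g) = gf f + gf g"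
  by (intro fps_ext) (simp add: gf_nth badd_def)

lemma gf_bmul: "gf (bmul f g) = gf f * gf g"
  by (intro fps_ext) (simp add: gf_nth bmul_def fps_mult_nth fps_sum_nth atLeast0AtMost)

lemma gf_bmon: "gf (bmon c i j) = of_int c * Y1 ^ i * Y2 ^ j"
proof -
  have eq: "of_int c * Y1 ^ i * Y2 ^ j = fps_const (of_int c * fps_X ^ j) * fps_X ^ i"
    by (simp add: Y1_def Y2_def fps_const_power fps_of_int[symmetric] mult_ac flip: fps_const_mult)
  show ?thesis unfolding eq
    by (intro fps_ext) (auto simp: gf_nth bmon_def fps_X_power_mult_right_nth fps_of_int[symmetric])
qed

lemma gf_bsum: "gf (bsum []) = 0" "gf (bsum (f # fs)) = gf f + gf (bsum fs)"
  by (auto simp: bsum_def gf_badd) (auto simp: gf_def fps_eq_iff)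

lemma gf_bprod: "gf (bprod []) = 1" "gf (bprod (f # fs)) = gf f * gf (bprod fs)"
  by (simp_all add: bprod_def gf_bmul gf_bmon)

lemma gf_denom: "gf denom = 2 * (1 - Y1 ^ 2) * (1 - Y2 ^ 2) * (1 - Y1 ^ 2 * Y2 ^ 2)"
  by (simp add: denom_def gf_bprod gf_badd gf_bmon algebra_simps)

lemma gf_tilde_f: "gf (tilde_f a1 a2 a3) =
    (1 + Y1) * (1 + Y2) * (1 + Y1 * Y2)
    - 2 * Y1 ^ (a1 + 1) * (1 + Y2) * (1 + Y1 * Y2)
    - 2 * Y2 ^ (a2 + 1) * (1 + Y1) * (1 + Y1 * Y2)
    - 2 * Y1 ^ (a3 + 1) * Y2 ^ (a3 + 1) * (1 + Y1) * (1 + Y2)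
    + 4 * Y1 ^ (a1 + 1 + (min a2 a3 + 1)) * Y2 ^ (min a2 a3 + 1) * (1 + Y2)
    + 4 * Y1 ^ (min a1 a3 + 1) * Y2 ^ (a2 + 1 + (min a1 a3 + 1)) * (1 + Y1)
    + 4 * Y1 ^ (max a1 a3 + 1) * Y2 ^ (max a2 a3 + 1) * (1 + Y1 * Y2)
    - 8 * Y1 ^ (min a2 a3 + a1 + 2) * Y2 ^ (min a1 a3 + a2 + 2)"
  unfolding tilde_f_def Let_def gf_bsum gf_bprod gf_badd gf_bmon by (simp add: mult.assoc)

definition tens :: "(nat \<Rightarrow> int) \<Rightarrow> (nat \<Rightarrow> int) \<Rightarrow> bps" where
  "tens u v = (\<lambda>m n. u m * v n)"

text \<open>\<open>tail_seq\<close> and \<open>ivl_seq\<close> are the one-variable profiles of the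
  blocks of \<open>sigH\<close>; their tensor products tile it.\<close>

definition tail_seq :: "nat \<Rightarrow> nat \<Rightarrow> nat \<Rightarrow> int" where
  "tail_seq k a n = (if k \<le> n then chi a n else 0)"

definition ivl_seq :: "nat \<Rightarrow> nat \<Rightarrow> nat \<Rightarrow> int" where
  "ivl_seq k a n = (if k \<le> n \<and> n \<le> a then 1 else 0)"

definition ser :: "(nat \<Rightarrow> int) \<Rightarrow> 'a::comm_ring_1 fps" where
  "ser u = Abs_fps (\<lambda>n. of_int (u n))"

lemma gf_tens: "gf (tens u v) = ser u * fps_const (ser v)"
  by (intro fps_ext) (simp add: gf_nth tens_def ser_def fps_of_int[symmetric] mult.commute)

lemma ser_one: "ser (\<lambda>n. if n = 0 then 1 else 0) = 1"
  by (intro fps_ext) (simp add: ser_def)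

text \<open>By \<open>chi_step2\<close>, multiplying by 1 - X^2 cancels everything except the two
  starting terms and the sign flip at a + 1.\<close>

lemma ser_tail:
  assumes "k \<le> a + 1"
  shows "(1 - fps_X ^ 2) * ser (tail_seq k a) = fps_X ^ k + fps_X ^ (k + 1) - 2 * fps_X ^ (a + 1)"
proof (intro fps_ext)
  fix n
  have "tail_seq k a n - (if n < 2 then 0 else tail_seq k a (n - 2))
    = (if n = k then 1 else 0) + (if n = k + 1 then 1 else 0) - 2 * (if n = a + 1 then 1 else 0)"
  proof -
    have "chi a n = chi a (n - 2) + (if n = a + 1 then - 2 else 0)" if "2 \<le> n"
      using chi_step2[of a "n - 2"] that by (auto simp: Suc_diff_Suc numeral_2_eq_2)
    thus ?thesis using assms by (auto simp: tail_seq_def chi_le chi_ge eps_simps)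
  qed
  note eq = arg_cong[OF this, of "of_int :: int \<Rightarrow> 'a"]
  have "fps_nth ((1 - fps_X ^ 2) * ser (tail_seq k a)) n
    = (of_int (tail_seq k a n - (if n < 2 then 0 else tail_seq k a (n - 2))) :: 'a)"
    by (simp add: left_diff_distrib fps_X_power_mult_nth ser_def)
  moreover have "fps_nth (fps_X ^ k + fps_X ^ (k + 1) - 2 * fps_X ^ (a + 1)) n
    = (of_int ((if n = k then 1 else 0) + (if n = k + 1 then 1 else 0) - 2 * (if n
        = a + 1 then 1 else 0)) :: 'a)"
    unfolding mult_2 by (simp only: fps_sub_nth fps_add_nth fps_X_power_nth) simp
  ultimately show "fps_nth ((1 - fps_X ^ 2) * ser (tail_seq k a)) n
      = fps_nth (fps_X ^ k + fps_X ^ (k + 1) - 2 * fps_X ^ (a + 1) :: 'a fps) n"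
    using eq by (simp only:)
qed

text \<open>Since \<open>chi a\<close> is 1 up to a, the interval is the difference of the tails
  starting at k and at a + 1.\<close>

lemma ser_ivl:
  assumes "k \<le> a + 1"
  shows "(1 - fps_X ^ 2) * ser (ivl_seq k a) = fps_X ^ k + fps_X ^ (k + 1) - fps_X ^ (a + 1) - fps_X ^ (a + 2)"
proof -
  have "ivl_seq k a n = tail_seq k a n - tail_seq (a + 1) a n" for n
    using assms by (auto simp: ivl_seq_def tail_seq_def chi_le)
  hence "ser (ivl_seq k a) = ser (tail_seq k a) - (ser (tail_seq (a + 1) a) :: 'a fps)"
    by (intro fps_ext) (simp add: ser_def)
  thus ?thesis
    by (simp only: right_diff_distrib ser_tail[OF assms] ser_tail[of "a + 1" a, OF order_refl]) simp
qed

lemma ser_Y: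
  assumes "(1 - fps_X ^ 2) * ser u = (p :: int fps)"
  shows "(1 - Y2 ^ 2) * fps_const (ser u) = fps_const p"
proof -
  have "1 - Y2 ^ 2 = fps_const (1 - fps_X ^ 2)"
    by (simp only: Y2_def fps_const_power fps_const_1_eq_1[where 'a = "int fps", symmetric] fps_const_sub)
  thus ?thesis by (simp only: fps_const_mult assms)
qed

lemma fps_const_X_power: "fps_const (fps_X ^ k) = Y2 ^ k"
  by (simp add: Y2_def fps_const_power)

lemma fps_const_ring: "fps_const (p + q) = fps_const p + fps_const q"
    "fps_const (p - q) = fps_const p - fps_const q"
  for p q :: "'a::comm_ring_1"
  by (simp_all only: fps_const_add fps_const_sub)

lemma tail_series:
  assumes "k \<le> a + 1"
  shows "(1 - Y1 ^ 2) * ser (tail_seq k a) = Y1 ^ k + Y1 ^ (k + 1) - 2 * Y1 ^ (a + 1)"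
    "(1 - Y2 ^ 2) * fps_const (ser (tail_seq k a)) = Y2 ^ k + Y2 ^ (k + 1) - 2 * Y2 ^ (a + 1)"
  unfolding ser_Y[OF ser_tail[OF assms]] mult_2 unfolding fps_const_ring fps_const_X_power
  by (simp_all only: Y1_def ser_tail[OF assms] mult_2)

lemma ivl_series:
  assumes "k \<le> a + 1"
  shows "(1 - Y1 ^ 2) * ser (ivl_seq k a) = Y1 ^ k + Y1 ^ (k + 1) - Y1 ^ (a + 1) - Y1 ^ (a + 2)"
    "(1 - Y2 ^ 2) * fps_const (ser (ivl_seq k a)) = Y2 ^ k + Y2 ^ (k + 1) - Y2 ^ (a + 1) - Y2 ^ (a + 2)"
  unfolding ser_Y[OF ser_ivl[OF assms]] unfolding fps_const_ring fps_const_X_power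
  by (simp_all only: Y1_def ser_ivl[OF assms])

lemma gf_tens_mult:
  assumes "(1 - Y1 ^ 2) * ser u = p" "(1 - Y2 ^ 2) * fps_const (ser v) = q"
  shows "(1 - Y1 ^ 2) * (1 - Y2 ^ 2) * gf (tens u v) = p * q"
  unfolding gf_tens assms[symmetric] by (simp only: mult_ac)

lemma sigH_gf: "gf (sigH a1 a2 b) = (1 - Y1 ^ 2 * Y2 ^ 2) * gf (sigT a1 a2 b)"
proof (intro fps_ext)
  fix m n
  have "(1 - Y1 ^ 2 * Y2 ^ 2) * f = f - fps_const (fps_X ^ 2) * (fps_X ^ 2 * f)" for f
    by (simp add: Y1_def Y2_def fps_const_power algebra_simps)
  thus "fps_nth (fps_nth (gf (sigH a1 a2 b)) m) n
      = fps_nth (fps_nth ((1 - Y1 ^ 2 * Y2 ^ 2) * gf (sigT a1 a2 b)) m) n"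
    by (auto simp: gf_nth sigH_def fps_X_power_mult_nth)
qed

lemma gf_of_int_mult: "gf (\<lambda>m n. c * f m n) = of_int c * gf f"
  by (intro fps_ext) (simp add: gf_nth fps_of_int[symmetric])

lemma gf_add: "gf (\<lambda>m n. f m n + g m n) = gf f + gf g" "gf (\<lambda>m n. f m n - g m n) = gf f - gf g"
  by (intro fps_ext; simp add: gf_nth)+

abbreviation one_seq :: "nat \<Rightarrow> int" where
  "one_seq \<equiv> (\<lambda>n. if n = 0 then 1 else 0)"

lemma one_series:
  "(1 - Y1 ^ 2) * ser one_seq = 1 - Y1 ^ 2" "(1 - Y2 ^ 2) * fps_const (ser one_seq) = 1 - Y2 ^ 2"
  by (simp_all add: ser_one)

text \<open>Distributes D over a block decomposition without expanding D, so that
  \<open>gf_tens_mult\<close> fits each summand.\<close>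

lemma distrib5:
  "D * (A + B - C + 2 * E - 2 * F + 2 * G) = D * A + D * B - D * C + 2 * (D * E) - 2 * (D * F) + 2 * (D * G)"
  "D * (A + B - C + 2 * E + 2 * G) = D * A + D * B - D * C + 2 * (D * E) + 2 * (D * G)"
  for D :: "'a::comm_ring_1"
  by (simp_all add: algebra_simps)

text \<open>The left side adds the six block series of \<open>sigT_gf_dominant\<close> with
  denominators cleared; the right side is the numerator with min and max resolved by a1, a2 <=
  b.\<close>

lemma dominant_polynomial_identity:
  fixes x y :: "'a::comm_ring_1"
  assumes "b = a1 + a2 \<or> b = a1 + a2 + 1"
  shows "(1 - x ^ 2) * (y ^ 0 + y ^ (0 + 1) - 2 * y ^ (a2 + 1)) + (x ^ 0 + x ^ (0 + 1)
      - 2 * x ^ (a1 + 1)) * (1 - y ^ 2)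
      - (1 - x ^ 2) * (1 - y ^ 2)
      + 2 * ((x ^ 1 + x ^ (1 + 1) - x ^ (a1 + 1) - x ^ (a1 + 2)) * (y ^ 1 + y ^ (1 + 1) - y ^ (a2 + 1)
          - y ^ (a2 + 2)))
      - 2 * ((x ^ (a1 + 1) + x ^ (a1 + 1 + 1) - 2 * x ^ (a1 + a2 + 1 + 1)) * (y ^ (a2 + 1) + y ^ (a2 + 1
          + 1) - 2 * y ^ (a1 + a2 + 1 + 1)))
      + 2 * ((x ^ (b + 1) + x ^ (b + 1 + 1) - 2 * x ^ (a1 + a2 + 1 + 1)) * (y ^ (b + 1) + y ^ (b + 1 + 1)
          - 2 * y ^ (a1 + a2 + 1 + 1)))
    = (1 + x) * (1 + y) * (1 + x * y)
      - 2 * x ^ (a1 + 1) * (1 + y) * (1 + x * y)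
      - 2 * y ^ (a2 + 1) * (1 + x) * (1 + x * y)
      - 2 * x ^ (b + 1) * y ^ (b + 1) * (1 + x) * (1 + y)
      + 4 * x ^ (a1 + 1 + (a2 + 1)) * y ^ (a2 + 1) * (1 + y)
      + 4 * x ^ (a1 + 1) * y ^ (a2 + 1 + (a1 + 1)) * (1 + x)
      + 4 * x ^ (b + 1) * y ^ (b + 1) * (1 + x * y)
      - 8 * x ^ (a2 + a1 + 2) * y ^ (a1 + a2 + 2)"
  using assms by (elim disjE) (simp_all add: power_add power2_eq_square algebra_simps)

text \<open>The blocks are the two axes with the corner counted once, the rectangle [1, a1] x
  [1, a2] with value 2, and the quadrant m > a1, n > a2 with values -2 up to sign, from which the
  quadrant m, n > b is removed.\<close>

theorem sigT_gf_dominant: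
  assumes "a1 + a2 \<le> b" "b \<le> a1 + a2 + 1"
  shows "(1 - Y1 ^ 2) * (1 - Y2 ^ 2) * (1 - Y1 ^ 2 * Y2 ^ 2) * gf (sigT a1 a2 b) = gf (tilde_f a1 a2 b)"
proof -
  let ?B = "a1 + a2 + 1"
  define D where "D = (1 - Y1 ^ 2) * (1 - Y2 ^ 2)"
  have "sigH a1 a2 b = (\<lambda>m n. tens one_seq (tail_seq 0 a2) m n + tens (tail_seq 0 a1) one_seq m n
      - tens one_seq one_seq m n + 2 * tens (ivl_seq 1 a1) (ivl_seq 1 a2) m n
      - 2 * tens (tail_seq (a1 + 1) ?B) (tail_seq (a2 + 1) ?B) m n
      + 2 * tens (tail_seq (b + 1) ?B) (tail_seq (b + 1) ?B) m n)"
    using assms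
    by (intro ext) (auto simp: sigH_dominant tens_def tail_seq_def ivl_seq_def chi_le)
  hence H: "gf (sigH a1 a2 b) = gf (tens one_seq (tail_seq 0 a2)) + gf (tens (tail_seq 0 a1) one_seq)
      - gf (tens one_seq one_seq) + 2 * gf (tens (ivl_seq 1 a1) (ivl_seq 1 a2))
      - 2 * gf (tens (tail_seq (a1 + 1) ?B) (tail_seq (a2 + 1) ?B))
      + 2 * gf (tens (tail_seq (b + 1) ?B) (tail_seq (b + 1) ?B))"
    by (simp add: gf_add gf_of_int_mult)
  have t: "0 \<le> a1 + 1" "0 \<le> a2 + 1" "1 \<le> a1 + 1" "1 \<le> a2 + 1" "a1 + 1 \<le> ?B + 1" "a2 + 1 \<le> ?B + 1"
      "b + 1 \<le> ?B + 1"
    using assms by auto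
  note ts = gf_tens_mult[OF one_series(1) tail_series(2)[OF t(2)]] gf_tens_mult[OF tail_series(1)[OF t(1)]
      one_series(2)]
    gf_tens_mult[OF one_series] gf_tens_mult[OF ivl_series(1)[OF t(3)] ivl_series(2)[OF t(4)]]
    gf_tens_mult[OF tail_series(1)[OF t(5)] tail_series(2)[OF t(6)]] gf_tens_mult[OF tail_series[OF t(7)]]
  have "D * (1 - Y1 ^ 2 * Y2 ^ 2) * gf (sigT a1 a2 b) = D * gf (sigH a1 a2 b)"
    by (simp add: sigH_gf mult.assoc)
  also have "\<dots> = D * gf (tens one_seq (tail_seq 0 a2)) + D * gf (tens (tail_seq 0 a1) one_seq)
      - D * gf (tens one_seq one_seq) + 2 * (D * gf (tens (ivl_seq 1 a1) (ivl_seq 1 a2)))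
      - 2 * (D * gf (tens (tail_seq (a1 + 1) ?B) (tail_seq (a2 + 1) ?B)))
      + 2 * (D * gf (tens (tail_seq (b + 1) ?B) (tail_seq (b + 1) ?B)))"
    unfolding H distrib5 ..
  also have "\<dots> = gf (tilde_f a1 a2 b)"
  proof -
    have mm: "min a2 b = a2" "min a1 b = a1" "max a1 b = b" "max a2 b = b" using assms by auto
    show ?thesis
      unfolding D_def ts gf_tilde_f mm
      by (rule dominant_polynomial_identity) (use assms in linarith)
  qed
  finally show ?thesis by (simp add: D_def)
qed

text \<open>Besides the axes the blocks are 1 <= m <= b, n > a and m > b, b < n <= a. The second
  claim uses the same blocks with the two variables exchanged.\<close>

theorem sigT_gf_mixed:
  assumes "b \<le> a"
  shows "(1 - Y1 ^ 2) * (1 - Y2 ^ 2) * (1 - Y1 ^ 2 * Y2 ^ 2) * gf (sigT 0 a b) = gf (tilde_f 0 a b)"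
    and "(1 - Y1 ^ 2) * (1 - Y2 ^ 2) * (1 - Y1 ^ 2 * Y2 ^ 2) * gf (sigT a 0 b) = gf (tilde_f a 0 b)"
proof -
  define D where "D = (1 - Y1 ^ 2) * (1 - Y2 ^ 2)"
  have eq: "sigH 0 a b m n = tens one_seq (tail_seq 0 a) m n + tens (tail_seq 0 0) one_seq m n
      - tens one_seq one_seq m n + 2 * tens (ivl_seq 1 b) (tail_seq (a + 1) a) m n
      + 2 * tens (tail_seq (b + 1) b) (ivl_seq (b + 1) a) m n" for m n
    using assms by (auto simp: sigH_mixed tens_def tail_seq_def ivl_seq_def chi_le)
  have H: "gf (sigH 0 a b) = gf (tens one_seq (tail_seq 0 a)) + gf (tens (tail_seq 0 0) one_seq)
      - gf (tens one_seq one_seq) + 2 * gf (tens (ivl_seq 1 b) (tail_seq (a + 1) a))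
      + 2 * gf (tens (tail_seq (b + 1) b) (ivl_seq (b + 1) a))"
    unfolding eq[abs_def] by (simp add: gf_add gf_of_int_mult)
  have "sigH a 0 b = (\<lambda>m n. tens (tail_seq 0 a) one_seq m n + tens one_seq (tail_seq 0 0) m n
      - tens one_seq one_seq m n + 2 * tens (tail_seq (a + 1) a) (ivl_seq 1 b) m n
      + 2 * tens (ivl_seq (b + 1) a) (tail_seq (b + 1) b) m n)"
    by (intro ext, subst sigH_swap, subst eq) (simp add: tens_def mult_ac)
  hence H': "gf (sigH a 0 b) = gf (tens (tail_seq 0 a) one_seq) + gf (tens one_seq (tail_seq 0 0))
      - gf (tens one_seq one_seq) + 2 * gf (tens (tail_seq (a + 1) a) (ivl_seq 1 b))
      + 2 * gf (tens (ivl_seq (b + 1) a) (tail_seq (b + 1) b))"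
    by (simp add: gf_add gf_of_int_mult)
  have t: "0 \<le> c + 1" "1 \<le> c + 1" "c + 1 \<le> c + 1" "b + 1 \<le> a + 1" for c :: nat
    using assms by auto
  note ts = gf_tens_mult[OF one_series(1) tail_series(2)[OF t(1)]] gf_tens_mult[OF tail_series(1)[OF t(1)]
      one_series(2)]
    gf_tens_mult[OF one_series] gf_tens_mult[OF ivl_series(1)[OF t(2)] tail_series(2)[OF t(3)]]
    gf_tens_mult[OF tail_series(1)[OF t(3)] ivl_series(2)[OF t(4)]]
    gf_tens_mult[OF tail_series(1)[OF t(3)] ivl_series(2)[OF t(2)]]
    gf_tens_mult[OF ivl_series(1)[OF t(4)] tail_series(2)[OF t(3)]]
  have mm: "min a b = b" "max a b = a" "min 0 b = 0" "max 0 b = b" using assms by auto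
  have "D * (1 - Y1 ^ 2 * Y2 ^ 2) * gf (sigT 0 a b) = D * gf (sigH 0 a b)"
    by (simp add: sigH_gf mult.assoc)
  also have "\<dots> = D * gf (tens one_seq (tail_seq 0 a)) + D * gf (tens (tail_seq 0 0) one_seq)
      - D * gf (tens one_seq one_seq) + 2 * (D * gf (tens (ivl_seq 1 b) (tail_seq (a + 1) a)))
      + 2 * (D * gf (tens (tail_seq (b + 1) b) (ivl_seq (b + 1) a)))"
    unfolding H distrib5 ..
  also have "\<dots> = gf (tilde_f 0 a b)"
    unfolding D_def ts gf_tilde_f mm by (simp add: power_add power2_eq_square algebra_simps)
  finally show "(1 - Y1 ^ 2) * (1 - Y2 ^ 2) * (1 - Y1 ^ 2 * Y2 ^ 2) * gf (sigT 0 a b) = gf (tilde_f 0 a b)"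
    by (simp add: D_def)
  have "D * (1 - Y1 ^ 2 * Y2 ^ 2) * gf (sigT a 0 b) = D * gf (sigH a 0 b)"
    by (simp add: sigH_gf mult.assoc)
  also have "\<dots> = D * gf (tens (tail_seq 0 a) one_seq) + D * gf (tens one_seq (tail_seq 0 0))
      - D * gf (tens one_seq one_seq) + 2 * (D * gf (tens (tail_seq (a + 1) a) (ivl_seq 1 b)))
      + 2 * (D * gf (tens (ivl_seq (b + 1) a) (tail_seq (b + 1) b)))"
    unfolding H' distrib5 ..
  also have "\<dots> = gf (tilde_f a 0 b)"
    unfolding D_def ts gf_tilde_f mm by (simp add: power_add power2_eq_square algebra_simps)
  finally show "(1 - Y1 ^ 2) * (1 - Y2 ^ 2) * (1 - Y1 ^ 2 * Y2 ^ 2) * gf (sigT a 0 b) = gf (tilde_f a 0 b)"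
    by (simp add: D_def)
qed

text \<open>\<open>denom\<close> carries the factor 2, hence the doubled numerator. The three
  alternatives are those that c3 = c1 + c2 forces on the floors.\<close>

theorem denom_sigT:
  assumes "a1 + a2 \<le> b \<and> b \<le> a1 + a2 + 1 \<or> a1 = 0 \<and> b \<le> a2 \<or> a2 = 0 \<and> b \<le> a1"
  shows "bmul denom (sigT a1 a2 b) = badd (tilde_f a1 a2 b) (tilde_f a1 a2 b)"
proof (rule gf_inject)
  have "(1 - Y1 ^ 2) * (1 - Y2 ^ 2) * (1 - Y1 ^ 2 * Y2 ^ 2) * gf (sigT a1 a2 b) = gf (tilde_f a1 a2 b)"
    using assms
  proof (elim disjE conjE)
    assume "a1 + a2 \<le> b" "b \<le> a1 + a2 + 1"
    thus ?thesis by (rule sigT_gf_dominant)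
  next
    assume "a1 = 0" "b \<le> a2"
    thus ?thesis using sigT_gf_mixed(1) by blast
  next
    assume "a2 = 0" "b \<le> a1"
    thus ?thesis using sigT_gf_mixed(2) by blast
  qed
  moreover have "gf (bmul denom (sigT a1 a2 b))
      = 2 * ((1 - Y1 ^ 2) * (1 - Y2 ^ 2) * (1 - Y1 ^ 2 * Y2 ^ 2) * gf (sigT a1 a2 b))"
    by (simp only: gf_bmul gf_denom mult.assoc)
  ultimately show "gf (bmul denom (sigT a1 a2 b)) = gf (badd (tilde_f a1 a2 b) (tilde_f a1 a2 b))"
    by (simp only: gf_badd mult_2)
qed

section \<open>Generic weights and walls\<close>

definition sgn_falling :: "real \<Rightarrow> nat \<Rightarrow> real" where
  "sgn_falling c n = (\<Prod>i<n. sgn (c - real (Suc i)))"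

lemma chi_Suc: "chi a (Suc n) = (if n < a then chi a n else - chi a n)"
  by (auto simp: chi_def eps_simps not_less le_Suc_eq)

lemma sgn_falling_eq_chi:
  assumes "\<And>n. c \<noteq> real (Suc n)"
  shows "sgn_falling c n = of_int (chi (nat \<lfloor>c\<rfloor>) n)"
proof (induction n)
  case 0
  show ?case by (simp add: sgn_falling_def chi_le)
next
  case (Suc n)
  have "sgn (c - real (Suc n)) = (if n < nat \<lfloor>c\<rfloor> then 1 else -1)"
  proof (cases "n < nat \<lfloor>c\<rfloor>")
    case True
    hence "real (Suc n) \<le> c" by linarith
    thus ?thesis using True assms[of n] by simp
  next
    case False
    hence "c < real (Suc n)" by linarith
    thus ?thesis using False by simp
  qed
  thus ?case using Suc by (simp add: sgn_falling_def chi_Suc)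
qed

lemma sgn_falling_add: "sgn_falling c (p + q) = sgn_falling c p * (\<Prod>j<q. sgn (c - real (Suc (p + j))))"
  by (induction q) (simp_all add: sgn_falling_def)

text \<open>Regrouped so that c1 and c2 enter through one falling product each, the form used for
  averaging over their walls.\<close>

lemma signA_sgn_falling:
  "signA c1 c2 c3 p q k = sgn_falling c1 p * sgn_falling c2 q * sgn_falling c3 q * (\<Prod>j<q. sgn (c3
      - real (Suc (p + j))))
     * (\<Prod>i<k. sgn (c3 - real (Suc (p + q + 1 + i))))"
proof -
  have e: "c3 - real p - real (Suc j) = c3 - real (Suc (p + j))"
    "c3 - 2 - real p - real q - real j = c3 - real (Suc (p + q + 1 + j))" for j by simp_all
  show ?thesis unfolding signA_def e prod.distrib sgn_falling_def by (simp only: mult.assoc)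
qed

text \<open>A product over a window of consecutive factors is a quotient of two falling products;
  all signs are 1 or -1 here, so dividing is multiplying.\<close>

lemma signA_eq_chi:
  assumes "\<And>n. c1 \<noteq> real (Suc n)" "\<And>n. c2 \<noteq> real (Suc n)" "\<And>n. c3 \<noteq> real (Suc n)"
  defines "a1 \<equiv> nat \<lfloor>c1\<rfloor>" and "a2 \<equiv> nat \<lfloor>c2\<rfloor>" and "a3 \<equiv> nat \<lfloor>c3\<rfloor>"
  shows "signA c1 c2 c3 p q k
    = of_int (psi a1 a2 a3 p q * (chi a3 (p + q) * chi a3 (p + q + 1) * chi a3 (p + q + k + 1)))"
proof -
  have sq: "sgn_falling c3 n * sgn_falling c3 n = 1" for n
    unfolding sgn_falling_eq_chi[OF assms(3)] by (simp flip: of_int_mult add: chi_square)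
  have cancel: "x = sgn_falling c3 n * y \<Longrightarrow> y = sgn_falling c3 n * x" for x y n
    using sq[of n] by (simp flip: mult.assoc)
  have "(\<Prod>j<q. sgn (c3 - real (Suc (p + j)))) = sgn_falling c3 p * sgn_falling c3 (p + q)"
    by (rule cancel, rule sgn_falling_add)
  moreover have "(\<Prod>i<k. sgn (c3 - real (Suc (p + q + 1 + i))))
      = sgn_falling c3 (p + q + 1) * sgn_falling c3 (p + q + 1 + k)"
    by (rule cancel, rule sgn_falling_add)
  moreover have "p + q + 1 + k = p + q + k + 1" by simp
  ultimately show ?thesis
    unfolding signA_sgn_falling psi_def a1_def a2_def a3_def of_int_mult
    by (simp only: sgn_falling_eq_chi[OF assms(1)] sgn_falling_eq_chi[OF assms(2)]
        sgn_falling_eq_chi[OF assms(3)] mult_ac)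
qed

lemma sigma_generic:
  assumes "\<And>k n. k \<in> {1, 2, 3} \<Longrightarrow> shifted l k \<noteq> real (Suc n)"
  shows "bmul denom (sigma l) = badd (tilde_f_at l) (tilde_f_at l)"
proof -
  define a where "a k = nat \<lfloor>shifted l k\<rfloor>" for k
  have c: "\<And>n. shifted l 1 \<noteq> real (Suc n)" "\<And>n. shifted l 2 \<noteq> real (Suc n)" "\<And>n. shifted l 3 \<noteq> real (Suc n)"
    using assms by blast+
  have "sigma l m n = sigT (a 1) (a 2) (a 3) m n" for m n
  proof -
    have "real_of_int (sigma l m n) = real_of_int (sigT (a 1) (a 2) (a 3) m n)"
      unfolding sigma_def sig_gram_A[OF c(3)] signA_eq_chi[OF c] sigT_def a_def of_int_sum ..
    thus ?thesis by linarith
  qed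
  hence sigma: "sigma l = sigT (a 1) (a 2) (a 3)" by (intro ext)
  have "a 1 + a 2 \<le> a 3 \<and> a 3 \<le> a 1 + a 2 + 1 \<or> a 1 = 0 \<and> a 3 \<le> a 2 \<or> a 2 = 0 \<and> a 3 \<le> a 1"
  proof -
    \<comment> \<open>A negative c1 gives c3 < c2, a negative c2 gives c3 < c1; for nonnegative c1
      and c2 the floor of the sum exceeds the sum of the floors by 0 or 1.\<close>
    consider "shifted l 1 < 0" | "shifted l 2 < 0" | "0 \<le> shifted l 1" "0 \<le> shifted l 2" by linarith
    thus ?thesis
    proof cases
      case 1
      hence "a 1 = 0" "a 3 \<le> a 2" unfolding a_def shifted_simps(3) by linarith+
      thus ?thesis by blast
    next
      case 2
      hence "a 2 = 0" "a 3 \<le> a 1" unfolding a_def shifted_simps(3) by linarith+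
      thus ?thesis by blast
    next
      case 3
      hence "a 1 + a 2 \<le> a 3" "a 3 \<le> a 1 + a 2 + 1" unfolding a_def shifted_simps(3) by linarith+
      thus ?thesis by blast
    qed
  qed
  moreover have "tilde_f_at l = tilde_f (a 1) (a 2) (a 3)"
    by (simp add: tilde_f_at_def a_of_def a_def shifted_def)
  ultimately show ?thesis using denom_sigT sigma by simp
qed

section \<open>Averaging across a wall\<close>

lemma bmul_average:
  assumes "\<And>m n. 2 * s m n = s1 m n + s2 m n"
  shows "2 * bmul d s m n = bmul d s1 m n + bmul d s2 m n"
proof -
  have "2 * bmul d s m n = (\<Sum>i\<le>m. \<Sum>j\<le>n. d i j * (2 * s (m - i) (n - j)))"
    by (simp add: bmul_def sum_distrib_left mult_ac)
  also have "\<dots> = bmul d s1 m n + bmul d s2 m n"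
    unfolding assms by (simp add: bmul_def algebra_simps sum.distrib)
  finally show ?thesis .
qed

lemma sgn_stable_non_int:
  fixes c :: real
  assumes "c \<notin> \<int>"
  shows "\<exists>\<delta>>0. \<forall>d. \<bar>d\<bar> < \<delta> \<longrightarrow> (\<forall>n :: int. sgn (c + d - of_int n) = sgn (c - of_int n))"
proof (intro exI[of _ "min (c - of_int \<lfloor>c\<rfloor>) (of_int \<lfloor>c\<rfloor> + 1 - c)"] conjI allI impI)
  have "of_int \<lfloor>c\<rfloor> \<noteq> c" using assms by (metis Ints_of_int)
  thus "0 < min (c - of_int \<lfloor>c\<rfloor>) (of_int \<lfloor>c\<rfloor> + 1 - c)" by linarith
  fix d :: real and n :: int
  assume d: "\<bar>d\<bar> < min (c - of_int \<lfloor>c\<rfloor>) (of_int \<lfloor>c\<rfloor> + 1 - c)"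
  show "sgn (c + d - of_int n) = sgn (c - of_int n)"
  proof (cases "n \<le> \<lfloor>c\<rfloor>")
    case True
    hence "real_of_int n \<le> of_int \<lfloor>c\<rfloor>" by simp
    hence "c - of_int n > 0" "c + d - of_int n > 0" using d by linarith+
    thus ?thesis by simp
  next
    case False
    hence "real_of_int n \<ge> of_int \<lfloor>c\<rfloor> + 1" by linarith
    hence "c - of_int n < 0" "c + d - of_int n < 0" using d by linarith+
    thus ?thesis by simp
  qed
qed

text \<open>For c < 1 every factor stays negative while |d| < 1 - c; otherwise c is not an integer
  at all.\<close>

lemma sgn_stable_pos:
  fixes c :: real
  assumes "\<And>n. c \<noteq> real (Suc n)"
  shows "\<exists>\<delta>>0. \<forall>d. \<bar>d\<bar> < \<delta> \<longrightarrow> (\<forall>n. sgn (c + d - real (Suc n)) = sgn (c - real (Suc n)))"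
proof (cases "c < 1")
  case True
  thus ?thesis by (intro exI[of _ "1 - c"]) auto
next
  case False
  have "c \<notin> \<int>"
  proof
    assume "c \<in> \<int>"
    then obtain k where k: "c = of_int k" by (auto elim: Ints_cases)
    hence "c = real (Suc (nat (k - 1)))" using False by simp
    thus False using assms by blast
  qed
  from sgn_stable_non_int[OF this] show ?thesis by (metis of_int_of_nat_eq)
qed

lemma near_nat_not_nat:
  assumes "0 < d" "d < 1"
  shows "real n0 + d \<noteq> real n" "real n0 - d \<noteq> real n"
proof -
  show "real n0 + d \<noteq> real n"
  proof
    assume "real n0 + d = real n"
    hence "real n0 < real n" "real n < real (Suc n0)" using assms by simp_all
    thus False unfolding of_nat_less_iff by simp
  qed
  show "real n0 - d \<noteq> real n"
  proof
    assume "real n0 - d = real n"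
    hence "real n < real n0" "real n0 < real (Suc n)" using assms by simp_all
    thus False unfolding of_nat_less_iff by simp
  qed
qed

text \<open>On the wall the product is 1 before the zero factor and 0 from there on; the two sides
  agree before that factor and are opposite from it on.\<close>

lemma sgn_falling_wall:
  assumes "n0 \<ge> 1" "0 < d" "d < 1"
  shows "2 * sgn_falling (real n0) p = sgn_falling (real n0 + d) p + sgn_falling (real n0 - d) p"
proof -
  note ne = near_nat_not_nat[OF assms(2,3)]
  have fl: "nat \<lfloor>real n0 + d\<rfloor> = n0" "nat \<lfloor>real n0 - d\<rfloor> = n0 - 1" using assms by linarith+
  obtain r where r: "n0 = Suc r" using assms by (cases n0) auto
  have "sgn_falling (real n0) p = (if p < n0 then 1 else 0)"
  proof (cases "p < n0")
    case True
    thus ?thesis unfolding sgn_falling_def by (simp add: prod.neutral)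
  next
    case False
    hence "n0 - 1 \<in> {..<p}" "sgn (real n0 - real (Suc (n0 - 1))) = 0" using assms by auto
    thus ?thesis using False unfolding sgn_falling_def by (auto intro!: prod_zero)
  qed
  thus ?thesis unfolding sgn_falling_eq_chi[OF ne(1)] sgn_falling_eq_chi[OF ne(2)] fl
    by (auto simp: r chi_le chi_ge eps_simps)
qed

definition same_chamber :: "real \<Rightarrow> real \<Rightarrow> bool" where
  "same_chamber c c' \<longleftrightarrow> (\<forall>n. sgn (c' - real (Suc n)) = sgn (c - real (Suc n)))"

lemma same_chamber_sgn_falling: "same_chamber c c' \<Longrightarrow> sgn_falling c' p = sgn_falling c p"
  by (simp add: same_chamber_def sgn_falling_def)

lemma same_chamber_generic:
  assumes "same_chamber c c'" "\<And>n. c \<noteq> real (Suc n)"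
  shows "c' \<noteq> real (Suc n)"
  using assms(1)[unfolded same_chamber_def, rule_format, of n] assms(2)[of n] by (auto simp: sgn_0_0)

lemma signA_same_chamber:
  assumes "same_chamber c3 c3'"
  shows "signA c1 c2 c3' p q k = sgn_falling c1 p * sgn_falling c2 q * sgn_falling c3 q * (\<Prod>j<q. sgn (c3
      - real (Suc (p + j))))
     * (\<Prod>i<k. sgn (c3 - real (Suc (p + q + 1 + i))))"
proof -
  have "sgn (c3' - real (Suc n)) = sgn (c3 - real (Suc n))" for n
    using assms by (simp only: same_chamber_def)
  thus ?thesis unfolding signA_sgn_falling same_chamber_sgn_falling[OF assms] by (simp only:)
qed

text \<open>The averaging hypothesis concerns the product of the c1-part and the c2-part, so that it
  covers the walls of alpha_1 and alpha_2 alike; the c3-part is the same at all three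
  weights.\<close>

lemma sigma_average_A:
  assumes c3: "\<And>n. shifted l 3 \<noteq> real (Suc n)" "same_chamber (shifted l 3) (shifted l' 3)"
      "same_chamber (shifted l 3) (shifted l'' 3)"
    and wall: "\<And>p q. 2 * (sgn_falling (shifted l 1) p * sgn_falling (shifted l 2) q)
      = sgn_falling (shifted l' 1) p * sgn_falling (shifted l' 2) q
          + sgn_falling (shifted l'' 1) p * sgn_falling (shifted l'' 2) q"
  shows "2 * sigma l m n = sigma l' m n + sigma l'' m n"
proof -
  have scale: "2 * (a * b * r * s * t) = a' * b' * r * s * t + a'' * b'' * r * s * t"
    if "2 * (a * b) = a' * b' + a'' * b''" for a b a' b' a'' b'' r s t :: real
  proof -
    have "2 * (a * b * r * s * t) = 2 * (a * b) * r * s * t" by simp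
    thus ?thesis unfolding that by (simp only: distrib_right)
  qed
  note c3' = same_chamber_generic[OF c3(2,1)] same_chamber_generic[OF c3(3,1)]
  have "2 * signA (shifted l 1) (shifted l 2) (shifted l 3) p q k
      = signA (shifted l' 1) (shifted l' 2) (shifted l' 3) p q k
          + signA (shifted l'' 1) (shifted l'' 2) (shifted l'' 3) p q k" for p q k
    unfolding signA_same_chamber[OF c3(2)] signA_same_chamber[OF c3(3)] signA_sgn_falling[of _ _ "shifted l 3"]
    by (rule scale[OF wall])
  hence "2 * real_of_int (sigma l m n) = real_of_int (sigma l' m n) + real_of_int (sigma l'' m n)"
    unfolding sigma_def sig_gram_A[OF c3(1)] sig_gram_A[OF c3'(1)] sig_gram_A[OF c3'(2)]
    by (simp add: sum_distrib_left sum.distrib)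
  thus ?thesis by linarith
qed

text \<open>The part of \<open>signB\<close> independent of c3. Here c1 is compared with integers of
  either sign, hence the \<open>of_int\<close> form that \<open>signB_rest_shift\<close>
  rewrites.\<close>

definition signB_rest :: "real \<Rightarrow> real \<Rightarrow> nat \<Rightarrow> nat \<Rightarrow> nat \<Rightarrow> real" where
  "signB_rest c1 c2 p q k = (\<Prod>i<k. sgn (c1 - of_int (1 - int p + int q + int i)))
     * (\<Prod>j<q. sgn (c1 - of_int (int (Suc j))) * sgn (c1 - of_int (int j - int p))) * sgn_falling c2 p"

lemma signB_sgn_falling: "signB c1 c2 c3 p q k = sgn_falling c3 q * signB_rest c1 c2 p q k"
proof -
  have e: "c1 - of_int (1 - int p + int q + int i) = c1 - 1 + real p - real q - real i"
    "c1 - of_int (int (Suc i)) = c1 - real (Suc i)"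
    "c1 - of_int (int i - int p) = c1 + real p - real i" for i by simp_all
  show ?thesis unfolding signB_def signB_rest_def sgn_falling_def e prod.distrib by (simp only: mult_ac)
qed

lemma signB_rest_shift:
  assumes "\<And>n :: int. sgn (c1' - of_int n) = sgn (c1 - of_int n)" "same_chamber c2 c2'"
  shows "signB_rest c1' c2' p q k = signB_rest c1 c2 p q k"
  unfolding signB_rest_def assms(1) same_chamber_sgn_falling[OF assms(2)] ..

lemma sigma_average_B:
  assumes c1: "shifted l 1 \<notin> \<int>" "\<And>n :: int. sgn (shifted l' 1 - of_int n) = sgn (shifted l 1 - of_int n)"
      "\<And>n :: int. sgn (shifted l'' 1 - of_int n) = sgn (shifted l 1 - of_int n)"
    and c2: "same_chamber (shifted l 2) (shifted l' 2)" "same_chamber (shifted l 2) (shifted l'' 2)"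
    and wall: "\<And>p. 2 * sgn_falling (shifted l 3) p
        = sgn_falling (shifted l' 3) p + sgn_falling (shifted l'' 3) p"
  shows "2 * sigma l m n = sigma l' m n + sigma l'' m n"
proof -
  have ne: "shifted l 1 \<noteq> of_int n" for n using c1(1) by auto
  have ne': "shifted l' 1 \<noteq> of_int n" "shifted l'' 1 \<noteq> of_int n" for n
    using c1(2)[of n] c1(3)[of n] ne[of n] by (auto simp: sgn_0_0)
  have "2 * signB (shifted l 1) (shifted l 2) (shifted l 3) p q k
      = signB (shifted l' 1) (shifted l' 2) (shifted l' 3) p q k
          + signB (shifted l'' 1) (shifted l'' 2) (shifted l'' 3) p q k" for p q k
    unfolding signB_sgn_falling signB_rest_shift[OF c1(2) c2(1)] signB_rest_shift[OF c1(3) c2(2)]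
    by (simp only: mult.assoc[symmetric] wall distrib_right)
  hence "2 * real_of_int (sigma l m n) = real_of_int (sigma l' m n) + real_of_int (sigma l'' m n)"
    unfolding sigma_def sig_gram_B[OF ne] sig_gram_B[OF ne'(1)] sig_gram_B[OF ne'(2)]
    by (simp add: sum_distrib_left sum.distrib)
  thus ?thesis by linarith
qed

lemma same_chamber_nearby:
  assumes "\<And>n. c \<noteq> real (Suc n)"
  shows "\<exists>\<delta>>0. \<forall>d. \<bar>d\<bar> < \<delta> \<longrightarrow> same_chamber c (c + d)"
  using sgn_stable_pos[OF assms] unfolding same_chamber_def .

lemma bmul_denom_sigma_average:
  assumes avg: "\<And>m n. 2 * sigma l m n = sigma l' m n + sigma l'' m n"
    and generic: "\<And>k n. k \<in> {1, 2, 3} \<Longrightarrow> shifted l' k \<noteq> real (Suc n)"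
        "\<And>k n. k \<in> {1, 2, 3} \<Longrightarrow> shifted l'' k \<noteq> real (Suc n)"
  shows "bmul denom (sigma l) = badd (tilde_f_at l') (tilde_f_at l'')"
proof (intro ext)
  fix m n
  have "2 * bmul denom (sigma l) m n = bmul denom (sigma l') m n + bmul denom (sigma l'') m n"
    by (rule bmul_average[OF avg])
  also have "bmul denom (sigma l') = badd (tilde_f_at l') (tilde_f_at l')"
    by (rule sigma_generic) (rule generic)
  also have "bmul denom (sigma l'') = badd (tilde_f_at l'') (tilde_f_at l'')"
    by (rule sigma_generic) (rule generic)
  also have "badd (tilde_f_at l') (tilde_f_at l') m n + badd (tilde_f_at l'') (tilde_f_at l'') m n
      = 2 * badd (tilde_f_at l') (tilde_f_at l'') m n"
    by (simp add: badd_def)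
  finally show "bmul denom (sigma l) m n = badd (tilde_f_at l') (tilde_f_at l'') m n" by simp
qed

lemma shifted_translate:
  "shifted (wadd l (wscale e (pos_root k))) j = shifted l j + e * ip (pos_root j) (pos_root k)"
  "shifted (wsub l (wscale e (pos_root k))) j = shifted l j - e * ip (pos_root j) (pos_root k)"
  by (auto simp: shifted_def ip_def wadd_def wsub_def wscale_def algebra_simps)

lemma ip_pos_root:
  "ip (pos_root 1) (pos_root 1) = 2" "ip (pos_root 2) (pos_root 2) = 2" "ip (pos_root 3) (pos_root 3) = 2"
  "ip (pos_root 1) (pos_root 2) = -1" "ip (pos_root 2) (pos_root 1) = -1" "ip (pos_root 3) (pos_root 1) = 1"
  "ip (pos_root 3) (pos_root 2) = 1" "ip (pos_root 1) (pos_root 3) = 1" "ip (pos_root 2) (pos_root 3) = 1"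
  by (simp_all add: ip_def pos_root_def)

theorem theorem8:
  fixes l :: "real \<times> real" and n0 k0 :: nat
  assumes "n0 \<ge> 1" and "k0 \<in> {1, 2, 3}" and "l \<in> vanishing_line n0 k0"
    and "\<forall>n k. n \<ge> 1 \<and> k \<in> {1, 2, 3} \<and> l \<in> vanishing_line n k \<longrightarrow> n = n0 \<and> k = k0"
  shows "\<exists>e0 > 0. \<forall>e. 0 < e \<and> e < e0 \<longrightarrow>
           bmul denom (sigma l) =
           badd (tilde_f_at (wadd l (wscale e (pos_root k0))))
                (tilde_f_at (wsub l (wscale e (pos_root k0))))"
proof -
  have line: "l \<in> vanishing_line n k \<longleftrightarrow> shifted l k = real n" for n k
    by (simp add: vanishing_line_def shifted_def)
  have wall: "shifted l k0 = real n0" using assms(3) line by simp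
  have off: "shifted l k \<noteq> real (Suc n)" if "k \<in> {1, 2, 3}" "k \<noteq> k0" for k n
    using assms(4)[rule_format, of "Suc n" k] that line[of "Suc n" k] by auto
  define lp where "lp e = wadd l (wscale e (pos_root k0))" for e
  define lm where "lm e = wsub l (wscale e (pos_root k0))" for e
  note shift = shifted_translate[of l _ k0, folded lp_def lm_def]
  have "\<exists>e0 > 0. \<forall>e. 0 < e \<and> e < e0 \<longrightarrow> bmul denom (sigma l) = badd (tilde_f_at (lp e)) (tilde_f_at (lm e))"
  proof -
    consider (one) "k0 = 1" | (two) "k0 = 2" | (three) "k0 = 3" using assms(2) by auto
    thus ?thesis
    proof cases
      case one
      obtain d2 where d2: "d2 > 0" "\<And>d. \<bar>d\<bar> < d2 \<Longrightarrow> same_chamber (shifted l 2) (shifted l 2 + d)"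
        using same_chamber_nearby[of "shifted l 2"] off[of 2] one by auto
      obtain d3 where d3: "d3 > 0" "\<And>d. \<bar>d\<bar> < d3 \<Longrightarrow> same_chamber (shifted l 3) (shifted l 3 + d)"
        using same_chamber_nearby[of "shifted l 3"] off[of 3] one by auto
      show ?thesis
      \<comment> \<open>Moving by e alpha changes (alpha, lambda + rho) by 2e because (alpha, alpha)
        = 2; the bound 1/2 keeps it strictly within distance 1 of n0.\<close>
      proof (intro exI[of _ "min (1/2) (min d2 d3)"] conjI allI impI)
        fix e :: real assume "0 < e \<and> e < min (1/2) (min d2 d3)"
        hence e: "0 < 2 * e" "2 * e < 1" "\<bar>e\<bar> < d2" "\<bar>- e\<bar> < d2" "\<bar>e\<bar> < d3" "\<bar>- e\<bar> < d3" by auto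
        have c: "shifted (lp e) 1 = real n0 + 2 * e" "shifted (lm e) 1 = real n0 - 2 * e"
          "shifted (lp e) 2 = shifted l 2 + - e" "shifted (lm e) 2 = shifted l 2 + e"
          "shifted (lp e) 3 = shifted l 3 + e" "shifted (lm e) 3 = shifted l 3 + - e"
          using wall unfolding shift one ip_pos_root by simp_all
        have s: "same_chamber (shifted l 2) (shifted (lp e) 2)" "same_chamber (shifted l 2) (shifted (lm e) 2)"
          "same_chamber (shifted l 3) (shifted (lp e) 3)" "same_chamber (shifted l 3) (shifted (lm e) 3)"
          unfolding c using d2(2) d3(2) e by blast+
        have o: "shifted l 2 \<noteq> real (Suc n)" "shifted l 3 \<noteq> real (Suc n)" for n
            using off[of 2] off[of 3] one by auto
        have "shifted (lp e) k \<noteq> real (Suc n) \<and> shifted (lm e) k \<noteq> real (Suc n)" if "k \<in> {1, 2, 3}" for k n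
          using that near_nat_not_nat[OF e(1,2), of n0 "Suc n"] same_chamber_generic[OF s(1) o(1)]
            same_chamber_generic[OF s(2) o(1)] same_chamber_generic[OF s(3) o(2)]
                same_chamber_generic[OF s(4) o(2)]
          unfolding c(1,2)[symmetric] by blast
        moreover have "2 * sigma l m n = sigma (lp e) m n + sigma (lm e) m n" for m n
        proof (rule sigma_average_A[OF o(2) s(3,4)])
          fix p q
          have "2 * sgn_falling (shifted l 1) p
              = sgn_falling (shifted (lp e) 1) p + sgn_falling (shifted (lm e) 1) p"
            unfolding c using sgn_falling_wall[OF assms(1) e(1,2)] wall one by simp
          thus "2 * (sgn_falling (shifted l 1) p * sgn_falling (shifted l 2) q)
              = sgn_falling (shifted (lp e) 1) p * sgn_falling (shifted (lp e) 2) q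
              + sgn_falling (shifted (lm e) 1) p * sgn_falling (shifted (lm e) 2) q"
            unfolding s(1,2)[THEN same_chamber_sgn_falling] by (simp flip: distrib_right mult.assoc)
        qed
        ultimately show "bmul denom (sigma l) = badd (tilde_f_at (lp e)) (tilde_f_at (lm e))"
          using bmul_denom_sigma_average[of l "lp e" "lm e"] by blast
      qed (use d2 d3 in simp)
    next
      case two
      obtain d1 where d1: "d1 > 0" "\<And>d. \<bar>d\<bar> < d1 \<Longrightarrow> same_chamber (shifted l 1) (shifted l 1 + d)"
        using same_chamber_nearby[of "shifted l 1"] off[of 1] two by auto
      obtain d3 where d3: "d3 > 0" "\<And>d. \<bar>d\<bar> < d3 \<Longrightarrow> same_chamber (shifted l 3) (shifted l 3 + d)"
        using same_chamber_nearby[of "shifted l 3"] off[of 3] two by auto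
      show ?thesis
      proof (intro exI[of _ "min (1/2) (min d1 d3)"] conjI allI impI)
        fix e :: real assume "0 < e \<and> e < min (1/2) (min d1 d3)"
        hence e: "0 < 2 * e" "2 * e < 1" "\<bar>e\<bar> < d1" "\<bar>- e\<bar> < d1" "\<bar>e\<bar> < d3" "\<bar>- e\<bar> < d3" by auto
        have c: "shifted (lp e) 2 = real n0 + 2 * e" "shifted (lm e) 2 = real n0 - 2 * e"
          "shifted (lp e) 1 = shifted l 1 + - e" "shifted (lm e) 1 = shifted l 1 + e"
          "shifted (lp e) 3 = shifted l 3 + e" "shifted (lm e) 3 = shifted l 3 + - e"
          using wall unfolding shift two ip_pos_root by simp_all
        have s: "same_chamber (shifted l 1) (shifted (lp e) 1)" "same_chamber (shifted l 1) (shifted (lm e) 1)"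
          "same_chamber (shifted l 3) (shifted (lp e) 3)" "same_chamber (shifted l 3) (shifted (lm e) 3)"
          unfolding c using d1(2) d3(2) e by blast+
        have o: "shifted l 1 \<noteq> real (Suc n)" "shifted l 3 \<noteq> real (Suc n)" for n
            using off[of 1] off[of 3] two by auto
        have "shifted (lp e) k \<noteq> real (Suc n) \<and> shifted (lm e) k \<noteq> real (Suc n)" if "k \<in> {1, 2, 3}" for k n
          using that near_nat_not_nat[OF e(1,2), of n0 "Suc n"] same_chamber_generic[OF s(1) o(1)]
            same_chamber_generic[OF s(2) o(1)] same_chamber_generic[OF s(3) o(2)]
                same_chamber_generic[OF s(4) o(2)]
          unfolding c(1,2)[symmetric] by blast
        moreover have "2 * sigma l m n = sigma (lp e) m n + sigma (lm e) m n" for m n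
        proof (rule sigma_average_A[OF o(2) s(3,4)])
          fix p q
          have "2 * sgn_falling (shifted l 2) q
              = sgn_falling (shifted (lp e) 2) q + sgn_falling (shifted (lm e) 2) q"
            unfolding c using sgn_falling_wall[OF assms(1) e(1,2)] wall two by simp
          thus "2 * (sgn_falling (shifted l 1) p * sgn_falling (shifted l 2) q)
              = sgn_falling (shifted (lp e) 1) p * sgn_falling (shifted (lp e) 2) q
              + sgn_falling (shifted (lm e) 1) p * sgn_falling (shifted (lm e) 2) q"
            unfolding s(1,2)[THEN same_chamber_sgn_falling] by (simp flip: distrib_left)
        qed
        ultimately show "bmul denom (sigma l) = badd (tilde_f_at (lp e)) (tilde_f_at (lm e))"
          using bmul_denom_sigma_average[of l "lp e" "lm e"] by blast
      qed (use d1 d3 in simp)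
    next
      case three
      \<comment> \<open>If c1 were an integer, then either c1 >= 1 or c2 = n0 - c1 >= 1 would be a
        positive integer and put lambda on a second line.\<close>
      have nonint: "shifted l 1 \<notin> \<int>"
      proof
        assume "shifted l 1 \<in> \<int>"
        then obtain k where k: "shifted l 1 = of_int k" by (auto elim: Ints_cases)
        show False
        proof (cases "k \<ge> 1")
          case True
          hence "shifted l 1 = real (Suc (nat (k - 1)))" using k by simp
          thus False using off[of 1 "nat (k - 1)"] three by simp
        next
          case False
          have "shifted l 2 = real n0 - of_int k" using wall k shifted_simps(3)[of l] three by simp
          hence "shifted l 2 = real (Suc (nat (int n0 - k - 1)))" using False assms(1) by simp
          thus False using off[of 2 "nat (int n0 - k - 1)"] three by simp
        qed
      qed
      obtain d1 where d1: "d1 > 0" "\<And>d n. \<bar>d\<bar> < d1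
          \<Longrightarrow> sgn (shifted l 1 + d - of_int n) = sgn (shifted l 1 - of_int n)"
        using sgn_stable_non_int[OF nonint] by blast
      obtain d2 where d2: "d2 > 0" "\<And>d. \<bar>d\<bar> < d2 \<Longrightarrow> same_chamber (shifted l 2) (shifted l 2 + d)"
        using same_chamber_nearby[of "shifted l 2"] off[of 2] three by auto
      show ?thesis
      proof (intro exI[of _ "min (1/2) (min d1 d2)"] conjI allI impI)
        fix e :: real assume "0 < e \<and> e < min (1/2) (min d1 d2)"
        hence e: "0 < 2 * e" "2 * e < 1" "\<bar>e\<bar> < d1" "\<bar>- e\<bar> < d1" "\<bar>e\<bar> < d2" "\<bar>- e\<bar> < d2" by auto
        have c: "shifted (lp e) 3 = real n0 + 2 * e" "shifted (lm e) 3 = real n0 - 2 * e"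
          "shifted (lp e) 1 = shifted l 1 + e" "shifted (lm e) 1 = shifted l 1 + - e"
          "shifted (lp e) 2 = shifted l 2 + e" "shifted (lm e) 2 = shifted l 2 + - e"
          using wall unfolding shift three ip_pos_root by simp_all
        have s: "same_chamber (shifted l 2) (shifted (lp e) 2)" "same_chamber (shifted l 2) (shifted (lm e) 2)"
          unfolding c using d2(2) e by blast+
        have s1: "sgn (shifted (lp e) 1 - of_int n) = sgn (shifted l 1 - of_int n)"
          "sgn (shifted (lm e) 1 - of_int n) = sgn (shifted l 1 - of_int n)" for n
          unfolding c using d1(2) e by blast+
        have s1': "same_chamber (shifted l 1) (shifted (lp e) 1)"
            "same_chamber (shifted l 1) (shifted (lm e) 1)"
          unfolding same_chamber_def using s1[of "int (Suc n)" for n] by simp_all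
        have o: "shifted l 1 \<noteq> real (Suc n)" "shifted l 2 \<noteq> real (Suc n)" for n
            using off[of 1] off[of 2] three by auto
        have "shifted (lp e) k \<noteq> real (Suc n) \<and> shifted (lm e) k \<noteq> real (Suc n)" if "k \<in> {1, 2, 3}" for k n
          using that near_nat_not_nat[OF e(1,2), of n0 "Suc n"] same_chamber_generic[OF s(1) o(2)]
            same_chamber_generic[OF s(2) o(2)] same_chamber_generic[OF s1'(1) o(1)]
                same_chamber_generic[OF s1'(2) o(1)]
          unfolding c(1,2)[symmetric] by blast
        moreover have "2 * sigma l m n = sigma (lp e) m n + sigma (lm e) m n" for m n
        proof (rule sigma_average_B[OF nonint s1 s])
          show "2 * sgn_falling (shifted l 3) p
              = sgn_falling (shifted (lp e) 3) p + sgn_falling (shifted (lm e) 3) p" for p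
            unfolding c using sgn_falling_wall[OF assms(1) e(1,2)] wall three by simp
        qed
        ultimately show "bmul denom (sigma l) = badd (tilde_f_at (lp e)) (tilde_f_at (lm e))"
          using bmul_denom_sigma_average[of l "lp e" "lm e"] by blast
      qed (use d1 d2 in simp)
    qed
  qed
  thus ?thesis unfolding lp_def lm_def .
qed

end
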